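(* Suppose that Assumptions (P) and (R) stated in the context hold and additionally that the mapping $A$ is linear. Let $\{x^k\}_{k\ge1}$ denote the iterates of the inexact power augmented Lagrangian method described in the context. If the inexact proximal point method (iPPM) described in the context is used to solve the subproblems in step (1), and if the inexact proximal point updates in iPPM are computed using the fast gradient method (FGM) described in the context, then for any $\varepsilon_\varphi>0$, $\varepsilon_A>0$ an $(\varepsilon_\varphi,\varepsilon_A)$-stationary point of $\min_{x\in\mathcal X}f(x)$ s.t. $A(x)=0$ is obtained after at most $T=\max\{T_\varphi,T_A\}$ FGM iterations, where $$T_\varphi=\widetilde O\left(\varepsilon_\varphi^{-2-2\frac{1-\nu}{1+3\nu}\frac{1+\nu}{\nu}-\frac{2}{1+3\nu}}\right),\qquad T_A=\widetilde O\left(\varepsilon_A^{-2\nu-2\frac{1-\nu}{1+3\nu}(1+\nu)-\frac{2\nu}{1+3\nu}}\right).$$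
   Context: Problem: minimize $f(x)+g(x)$ over $x\in\mathbb R^n$ subject to $A(x)=0$, where $f:\mathbb R^n\to\mathbb R$ and $A:\mathbb R^n\to\mathbb R^m$ are continuously differentiable, $J_A(x)$ is the Jacobian of $A$, and $g=\delta_{\mathcal X}$ is the indicator of a set $\mathcal X$. Norms are Euclidean/spectral; $N_{\mathcal X}$ is the normal cone. Assumption (P): $\mathcal X\subseteq\mathbb R^n$ is nonempty, convex and compact with diameter $D>0$ (with nonempty interior), and there are constants $L_f,A_{\max},J_{A\max},\nabla f_{\max}>0$ and $L_A$ such that, for all $x,x'\in\mathcal X$, $\|\nabla f(x')-\nabla f(x)\|\le L_f\|x'-x\|$, $\|J_A(x')-J_A(x)\|\le L_A\|x'-x\|$, $\|\nabla f(x)\|\le\nabla f_{\max}$, $\|A(x)\|\le A_{\max}$, $\|J_A(x)\|\le J_{A\max}$. When $A$ is linear one takes $L_A=0$. Assumption (R): for any nonempty compact $\mathcal S\subseteq\mathcal X$ there is $R>0$ such that $\operatorname{dist}(-J_A^\top(x)A(x),N_{\mathcal X}(x))\ge R\|A(x)\|$ for all $x\in\mathcal S$. $x$ is an $(\varepsilon_\varphi,\varepsilon_A)$-stationary point if there is $y\in\mathbb R^m$ with $\|A(x)\|\le\varepsilon_A$ and $\operatorname{dist}(-\nabla f(x)-J_A^\top(x)y,N_{\mathcal X}(x))\le\varepsilon_\varphi$. The notation $\widetilde O$ suppresses logarithmic factors and constants independent of $\varepsilon_\varphi,\varepsilon_A$. Fix $\nu\in(0,1]$ and $\phi(z)=\frac1{\nu+1}\|z\|^{\nu+1}$,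 so $\nabla\phi(z)=\|z\|^{\nu-1}z$ for $z\neq0$, $\nabla\phi(0)=0$. For $\beta>0$ let $\psi_\beta(x,y):=f(x)+\langle A(x),y\rangle+\frac{\beta}{\nu+1}\|A(x)\|^{\nu+1}$. Inexact power augmented Lagrangian method: given $x^1\in\mathcal X$, $y^1\in\mathbb R^m$, $\lambda>0$, $\omega>1$, $\sigma_1>0$, $\beta_1>0$, $\nu\in(0,1]$, for $k=1,2,\dots$: (1) set $\varepsilon_{k+1}=\lambda/\beta_k$ and obtain $x^{k+1}\in\mathcal X$ with $\operatorname{dist}(-\nabla_x\psi_{\beta_k}(x^{k+1},y^k),N_{\mathcal X}(x^{k+1}))\le\varepsilon_{k+1}$; (2) set $\sigma_{k+1}=\sigma_1\min\left(1,\frac{\|A(x^1)\|^\nu\log^2(2)}{\|A(x^{k+1})\|^\nu(k+1)\log^2(k+2)}\right)$ (the minimum is read as $1$ if $A(x^{k+1})=0$); (3) set $y^{k+1}=y^k+\sigma_{k+1}\nabla\phi(A(x^{k+1}))$; (4) set $\beta_{k+1}=\omega\beta_k$. iPPM (inexact proximal point method) for $\min_{x\in\mathcal X}\psi(x)$ with $\psi(x)=\psi_\beta(x,y)$, tolerance $\varepsilon>0$ and $\rho:=L_f+L_A(\|y\|+\beta A_{\max}^\nu)$ (so $\rho=L_f$ when $A$ is linear): starting from $x_1$, for $t=1,2,\dots$: let $F(\cdot)=\psi(\cdot)+\rho\|\cdot-x_t\|^2$ and obtain $x_{t+1}\in\mathcal X$ with $\operatorname{dist}(-\nabla F(x_{t+1}),N_{\mathcal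 X}(x_{t+1}))\le\varepsilon/4$; if $2\rho\|x_{t+1}-x_t\|\le\varepsilon/2$, return $x_{t+1}$. In step (1) of outer iteration $k$, iPPM is run with $\beta=\beta_k$, $y=y^k$, $\varepsilon=\varepsilon_{k+1}$, started at $x^k$. FGM (fast gradient method) for $\min_{x\in\mathcal X}F(x)$ with $F$ $\rho$-strongly convex and $(H_F,\nu)$-Hölder smooth on $\mathcal X$ (i.e. $\|\nabla F(x)-\nabla F(x')\|\le H_F\|x-x'\|^\nu$): given $x_0\in\mathcal X$ and accuracy parameter $\delta>0$, set $\mu=\rho$, $L=H_F\left(\frac{H_F}{2\delta}\frac{1-\nu}{1+\nu}\right)^{\frac{1-\nu}{1+\nu}}$ (equal to $H_F$ if $\nu=1$), $\alpha_0=1$ and $L+\mu\sum_{i=0}^k\alpha_i=\frac{L\alpha_{k+1}^2}{\sum_{i=0}^{k+1}\alpha_i}$; for $k=0,1,\dots$: $y_k=\arg\min_{x\in\mathcal X}\{\langle\nabla F(x_k),x-x_k\rangle+\frac L2\|x-x_k\|^2\}$, $z_k=\arg\min_{x\in\mathcal X}\{\frac L2\|x-x_0\|^2+\sum_{i=0}^k\alpha_i[\langle\nabla F(x_i),x-x_i\rangle+\frac\mu2\|x-x_i\|^2]\}$, $x_{k+1}=\tau_kz_k+(1-\tau_k)y_k$ with $\tau_k=\alpha_{k+1}/\sum_{i=0}^{k+1}\alpha_i$. For the functions $F$ arising here, $H_F=H_\beta+2\rho\max\{1,D^{1-\nu}\}$ with $H_\beta=[L_f+L_A\|y\|+\beta(2^{1-\nu}J_{A\max}^{1+\nu}+A_{\max}^\nu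 L_A)]\max\{1,D^{1-\nu}\}$. To return a point satisfying the required inequality, FGM is followed by a single projected gradient step. *)

theory Defs
  imports "HOL-Analysis.Analysis" "HOL-Library.Landau_Symbols"
begin

definition gradient :: "('a::real_inner \<Rightarrow> real) \<Rightarrow> 'a \<Rightarrow> 'a" where
  "gradient h x = (THE D. GDERIV h x :> D)"

(* Normal cone of convex analysis. Because infdist to the empty set is 0 in the library
   (not infinity), every distance to a normal cone below comes with x \<in> X. *)
definition normal_cone :: "'a::real_inner set \<Rightarrow> 'a \<Rightarrow> 'a set" where
  "normal_cone X x = (if x \<in> X then {v. \<forall>z\<in>X. v \<bullet> (z - x) \<le> 0} else {})"

(* The library norm on matrices is the Frobenius norm, so the spectral norm is written
   as the operator norm of the induced linear map. *)
definition assumption_P ::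
  "(real^'n) set \<Rightarrow> (real^'n \<Rightarrow> real) \<Rightarrow> (real^'n \<Rightarrow> real^'m) \<Rightarrow>
   real \<Rightarrow> real \<Rightarrow> real \<Rightarrow> real \<Rightarrow> real \<Rightarrow> real \<Rightarrow> bool" where
  "assumption_P X f A D Lf LA Amax JAmax gfmax \<longleftrightarrow>
     X \<noteq> {} \<and> convex X \<and> compact X \<and> interior X \<noteq> {} \<and> diameter X = D \<and> D > 0 \<and>
     Lf > 0 \<and> Amax > 0 \<and> JAmax > 0 \<and> gfmax > 0 \<and>
     (\<forall>x\<in>X. \<forall>x'\<in>X. norm (gradient f x' - gradient f x) \<le> Lf * norm (x' - x)) \<and>
     (\<forall>x\<in>X. \<forall>x'\<in>X. onorm ((*v) (jacobian A (at x') - jacobian A (at x))) \<le> LA * norm (x' - x)) \<and>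
     (\<forall>x\<in>X. norm (gradient f x) \<le> gfmax) \<and>
     (\<forall>x\<in>X. norm (A x) \<le> Amax) \<and>
     (\<forall>x\<in>X. onorm ((*v) (jacobian A (at x))) \<le> JAmax)"

definition assumption_R :: "(real^'n) set \<Rightarrow> (real^'n \<Rightarrow> real^'m) \<Rightarrow> bool" where
  "assumption_R X A \<longleftrightarrow>
     (\<forall>S. S \<noteq> {} \<and> compact S \<and> S \<subseteq> X \<longrightarrow>
        (\<exists>R>0. \<forall>x\<in>S.
           infdist (- (transpose (jacobian A (at x)) *v A x)) (normal_cone X x) \<ge> R * norm (A x)))"

definition stationary_point ::
  "(real^'n) set \<Rightarrow> (real^'n \<Rightarrow> real) \<Rightarrow> (real^'n \<Rightarrow> real^'m) \<Rightarrow> real \<Rightarrow> real \<Rightarrow> real^'n \<Rightarrow> bool" where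
  "stationary_point X f A eps_phi eps_A x \<longleftrightarrow>
     x \<in> X \<and>
     (\<exists>y. norm (A x) \<le> eps_A \<and>
          infdist (- gradient f x - transpose (jacobian A (at x)) *v y) (normal_cone X x) \<le> eps_phi)"

definition phi :: "real \<Rightarrow> 'b::real_inner \<Rightarrow> real" where
  "phi \<nu> z = 1 / (\<nu> + 1) * norm z powr (\<nu> + 1)"

definition psi ::
  "real \<Rightarrow> ('a \<Rightarrow> real) \<Rightarrow> ('a \<Rightarrow> 'b::real_inner) \<Rightarrow> real \<Rightarrow> 'b \<Rightarrow> 'a \<Rightarrow> real" where
  "psi \<nu> f A \<beta> y x = f x + A x \<bullet> y + \<beta> / (\<nu> + 1) * norm (A x) powr (\<nu> + 1)"

(* Outer iterates are indexed from 1; the values at index 0 (and eps 1) are never used. *)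
definition inexact_power_alm ::
  "(real^'n) set \<Rightarrow> (real^'n \<Rightarrow> real) \<Rightarrow> (real^'n \<Rightarrow> real^'m) \<Rightarrow> real \<Rightarrow>
   real \<Rightarrow> real \<Rightarrow> real \<Rightarrow> real \<Rightarrow> real^'n \<Rightarrow> real^'m \<Rightarrow>
   (nat \<Rightarrow> real^'n) \<Rightarrow> (nat \<Rightarrow> real^'m) \<Rightarrow> (nat \<Rightarrow> real) \<Rightarrow> (nat \<Rightarrow> real) \<Rightarrow> (nat \<Rightarrow> real) \<Rightarrow> bool" where
  "inexact_power_alm X f A \<nu> lam \<omega> \<sigma>\<^sub>1 \<beta>\<^sub>1 x\<^sub>1 y\<^sub>1 x y \<sigma> \<beta> eps \<longleftrightarrow>
     x 1 = x\<^sub>1 \<and> y 1 = y\<^sub>1 \<and> \<sigma> 1 = \<sigma>\<^sub>1 \<and> \<beta> 1 = \<beta>\<^sub>1 \<and>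
     (\<forall>k\<ge>1.
        eps (k + 1) = lam / \<beta> k \<and>
        x (k + 1) \<in> X \<and>
        infdist (- gradient (psi \<nu> f A (\<beta> k) (y k)) (x (k + 1))) (normal_cone X (x (k + 1)))
          \<le> eps (k + 1) \<and>
        \<sigma> (k + 1) = \<sigma>\<^sub>1 *
          (if A (x (k + 1)) = 0 then 1
           else min 1 (norm (A x\<^sub>1) powr \<nu> * (ln 2)\<^sup>2 /
                       (norm (A (x (k + 1))) powr \<nu> * real (k + 1) * (ln (real (k + 2)))\<^sup>2))) \<and>
        y (k + 1) = y k + \<sigma> (k + 1) *\<^sub>R gradient (phi \<nu>) (A (x (k + 1))) \<and>
        \<beta> (k + 1) = \<omega> * \<beta> k)"

definition ippm_rho :: "real \<Rightarrow> real \<Rightarrow> real \<Rightarrow> real \<Rightarrow> real \<Rightarrow> 'b::real_normed_vector \<Rightarrow> real" where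
  "ippm_rho Lf LA Amax \<nu> \<beta> y = Lf + LA * (norm y + \<beta> * Amax powr \<nu>)"

definition prox_objective :: "('a::real_normed_vector \<Rightarrow> real) \<Rightarrow> real \<Rightarrow> 'a \<Rightarrow> 'a \<Rightarrow> real" where
  "prox_objective h \<rho> c x = h x + \<rho> * (norm (x - c))\<^sup>2"

(* iPPM on h over X from x\<^sub>1: u 1, u 2, ... are its iterates and it stops in iteration T,
   returning u (T + 1). *)
definition ippm_run ::
  "'a::euclidean_space set \<Rightarrow> ('a \<Rightarrow> real) \<Rightarrow> real \<Rightarrow> real \<Rightarrow> 'a \<Rightarrow> (nat \<Rightarrow> 'a) \<Rightarrow> nat \<Rightarrow> bool" where
  "ippm_run X h \<rho> eps x\<^sub>1 u T \<longleftrightarrow>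
     1 \<le> T \<and> u 1 = x\<^sub>1 \<and>
     (\<forall>t\<in>{1..T}.
        u (t + 1) \<in> X \<and>
        infdist (- gradient (prox_objective h \<rho> (u t)) (u (t + 1))) (normal_cone X (u (t + 1)))
          \<le> eps / 4) \<and>
     (\<forall>t\<in>{1..<T}. \<not> 2 * \<rho> * norm (u (t + 1) - u t) \<le> eps / 2) \<and>
     2 * \<rho> * norm (u (T + 1) - u T) \<le> eps / 2"

definition holder_psi ::
  "real \<Rightarrow> real \<Rightarrow> real \<Rightarrow> real \<Rightarrow> real \<Rightarrow> real \<Rightarrow> real \<Rightarrow> 'b::real_normed_vector \<Rightarrow> real" where
  "holder_psi Lf LA Amax JAmax D \<nu> \<beta> y =
     (Lf + LA * norm y + \<beta> * (2 powr (1 - \<nu>) * JAmax powr (1 + \<nu>) + Amax powr \<nu> * LA))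
       * max 1 (D powr (1 - \<nu>))"

definition holder_F ::
  "real \<Rightarrow> real \<Rightarrow> real \<Rightarrow> real \<Rightarrow> real \<Rightarrow> real \<Rightarrow> real \<Rightarrow> 'b::real_normed_vector \<Rightarrow> real" where
  "holder_F Lf LA Amax JAmax D \<nu> \<beta> y =
     holder_psi Lf LA Amax JAmax D \<nu> \<beta> y
       + 2 * ippm_rho Lf LA Amax \<nu> \<beta> y * max 1 (D powr (1 - \<nu>))"

(* The case \<nu> = 1 is separate because 0 powr 0 = 0 in the library. *)
definition fgm_L :: "real \<Rightarrow> real \<Rightarrow> real \<Rightarrow> real" where
  "fgm_L H \<nu> \<delta> =
     (if \<nu> = 1 then H
      else H * (H / (2 * \<delta>) * ((1 - \<nu>) / (1 + \<nu>))) powr ((1 - \<nu>) / (1 + \<nu>)))"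

definition fgm_run ::
  "'a::euclidean_space set \<Rightarrow> ('a \<Rightarrow> real) \<Rightarrow> real \<Rightarrow> real \<Rightarrow> 'a \<Rightarrow>
   (nat \<Rightarrow> real) \<Rightarrow> (nat \<Rightarrow> 'a) \<Rightarrow> (nat \<Rightarrow> 'a) \<Rightarrow> (nat \<Rightarrow> 'a) \<Rightarrow> bool" where
  "fgm_run X F L \<mu> x\<^sub>0 \<alpha> x y z \<longleftrightarrow>
     x 0 = x\<^sub>0 \<and> \<alpha> 0 = 1 \<and>
     (\<forall>k. \<alpha> (k + 1) > 0 \<and>
          L + \<mu> * (\<Sum>i\<le>k. \<alpha> i) = L * (\<alpha> (k + 1))\<^sup>2 / (\<Sum>i\<le>k + 1. \<alpha> i)) \<and>
     (\<forall>k. is_arg_min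
            (\<lambda>w. gradient F (x k) \<bullet> (w - x k) + L / 2 * (norm (w - x k))\<^sup>2)
            (\<lambda>w. w \<in> X) (y k)) \<and>
     (\<forall>k. is_arg_min
            (\<lambda>w. L / 2 * (norm (w - x\<^sub>0))\<^sup>2 +
                 (\<Sum>i\<le>k. \<alpha> i * (gradient F (x i) \<bullet> (w - x i) + \<mu> / 2 * (norm (w - x i))\<^sup>2)))
            (\<lambda>w. w \<in> X) (z k)) \<and>
     (\<forall>k. let \<tau> = \<alpha> (k + 1) / (\<Sum>i\<le>k + 1. \<alpha> i)
          in x (k + 1) = \<tau> *\<^sub>R z k + (1 - \<tau>) *\<^sub>R y k)"

(* v results from N \<ge> 1 FGM iterations (k = 0, ..., N - 1), whose output is y (N - 1),
   followed by one projected gradient step of length \<gamma>. *)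
definition fgm_then_projected_step ::
  "'a::euclidean_space set \<Rightarrow> ('a \<Rightarrow> real) \<Rightarrow> real \<Rightarrow> real \<Rightarrow> 'a \<Rightarrow> nat \<Rightarrow> real \<Rightarrow> 'a \<Rightarrow> bool" where
  "fgm_then_projected_step X F L \<mu> x\<^sub>0 N \<gamma> v \<longleftrightarrow>
     1 \<le> N \<and>
     (\<exists>\<alpha> x y z. fgm_run X F L \<mu> x\<^sub>0 \<alpha> x y z \<and>
        v = closest_point X (y (N - 1) - \<gamma> *\<^sub>R gradient F (y (N - 1))))"

(* u k is the sequence of iPPM iterates in outer iteration k, T k the number of iPPM
   iterations, N k the number of FGM iterations per iPPM update, \<delta> k the FGM accuracy, \<gamma> k the
   length of the projected gradient step, and s k t c the FGM starting point for the t-th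
   update, whose proximal center is c. *)
definition full_run ::
  "(real^'n) set \<Rightarrow> (real^'n \<Rightarrow> real) \<Rightarrow> (real^'n \<Rightarrow> real^'m) \<Rightarrow>
   real \<Rightarrow> real \<Rightarrow> real \<Rightarrow> real \<Rightarrow> real \<Rightarrow>
   real \<Rightarrow> real \<Rightarrow> real \<Rightarrow> real \<Rightarrow> real \<Rightarrow> real^'n \<Rightarrow> real^'m \<Rightarrow>
   (nat \<Rightarrow> nat \<Rightarrow> real^'n \<Rightarrow> real^'n) \<Rightarrow> (nat \<Rightarrow> real) \<Rightarrow> (nat \<Rightarrow> real) \<Rightarrow> (nat \<Rightarrow> nat) \<Rightarrow>
   (nat \<Rightarrow> real^'n) \<Rightarrow> (nat \<Rightarrow> nat) \<Rightarrow> bool" where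
  "full_run X f A D Lf LA Amax JAmax \<nu> lam \<omega> \<sigma>\<^sub>1 \<beta>\<^sub>1 x\<^sub>1 y\<^sub>1 s \<delta> \<gamma> N x T \<longleftrightarrow>
     (\<exists>y \<sigma> \<beta> eps u.
        inexact_power_alm X f A \<nu> lam \<omega> \<sigma>\<^sub>1 \<beta>\<^sub>1 x\<^sub>1 y\<^sub>1 x y \<sigma> \<beta> eps \<and>
        (\<forall>k\<ge>1.
           let h = psi \<nu> f A (\<beta> k) (y k);
               \<rho> = ippm_rho Lf LA Amax \<nu> (\<beta> k) (y k);
               L = fgm_L (holder_F Lf LA Amax JAmax D \<nu> (\<beta> k) (y k)) \<nu> (\<delta> k)
           in ippm_run X h \<rho> (eps (k + 1)) (x k) (u k) (T k) \<and>
              x (k + 1) = u k (T k + 1) \<and>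
              (\<forall>t\<in>{1..T k}.
                 fgm_then_projected_step X (prox_objective h \<rho> (u k t)) L \<rho>
                   (s k t (u k t)) (N k) (\<gamma> k) (u k (t + 1)))))"

(* Only \<epsilon> \<rightarrow> 0+ matters, so polylogarithmic factors are powers of the logarithm of \<epsilon>. *)
definition soft_O :: "(real \<Rightarrow> real) \<Rightarrow> (real \<Rightarrow> real) set" where
  "soft_O g = {h. \<exists>c::nat. h \<in> O[at_right 0](\<lambda>\<epsilon>. g \<epsilon> * \<bar>ln \<epsilon>\<bar> ^ c)}"

end

theory Submission
  imports Defs
begin

text \<open>Let \<open>b = \<omega> ^ (k - 1)\<close>, so that the penalty is \<open>\<beta>\<^sub>1 b\<close> and the tolerance is proportional to
  \<open>1 / b\<close>. The multipliers are bounded because the dual steps telescope against \<open>1 / ln k\<close>; with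
  the regularity condition this makes \<open>b * norm (A x) powr \<nu>\<close> bounded along the outer iterates. Hence
  (i) a stationary point is reached as soon as \<open>b\<close> exceeds a constant times
  \<open>max (1 / eps_phi) (eps_A powr - \<nu>)\<close>, and (ii) each call of iPPM starts from a bounded
  suboptimality gap, of which every iteration consumes a multiple of \<open>1 / b\<^sup>2\<close>, so it takes \<open>O(b\<^sup>2)\<close>
  iterations. Each of these is a \<open>\<rho>\<close>-strongly convex problem whose gradient is Hoelder continuous with
  a constant \<open>O(b)\<close>, and hence smooth up to an error \<open>\<delta>\<close>; the estimate sequence of FGM bounds
  its gap by a linearly convergent term plus \<open>\<delta> (1 + sqrt (L / \<rho>))\<close>. A suitable power of \<open>b\<close> for
  \<open>\<delta>\<close> gives \<open>O(b powr p * ln b)\<close> iterations, and since \<open>b\<close> grows geometrically the sum over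
  the outer iterations costs only one more logarithm.\<close>

section \<open>Powers of the norm\<close>

text \<open>Two obstacles shape the proof. First, the parameters of FGM are fixed before any run,
  yet the subproblem of outer iteration k contains a multiplier that only the run produces.
  Linearity of \<open>A\<close> resolves this: with \<open>LA = 0\<close> neither the prox weight
  \<open>Lf\<close> nor the Hoelder constant involves the multiplier, so every parameter can be a
  function of k. Linearity also makes the penalty convex, so the prox problem keeps curvature
  \<open>Lf\<close> however large the penalty is. Second, FGM controls function values whereas iPPM
  asks for approximate stationarity. A projected gradient step converts one into the other, but for
  a merely Hoelder continuous gradient the conversion is expensive: tolerance \<open>1 / b\<close>
  with Hoelder constant of order \<open>b\<close> forces a step radius of order
  \<open>b powr (- 2 / \<nu>)\<close> and hence a gap that is a high negative power of
  \<open>b\<close>. This is the origin of the factor \<open>(1 + \<nu>) / \<nu>\<close> in the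
  exponent.\<close>

lemma powr_le_tangent:
  fixes x m \<theta> :: real
  assumes "0 < \<theta>" "\<theta> \<le> 1" "0 \<le> x" "0 < m"
  shows "x powr \<theta> \<le> m powr \<theta> * (1 + \<theta> * (x / m - 1))"
proof (cases "x = 0")
  case True
  then show ?thesis using assms by simp
next
  case False
  \<comment> \<open>Young's inequality for \<open>x / m\<close> and 1 is the tangent inequality at
    1; scaling by \<open>m powr \<theta>\<close> moves the point of tangency to
    \<open>m\<close>.\<close>
  have "(x / m) powr \<theta> * 1 powr (1 - \<theta>) \<le> \<theta> * (x / m) + (1 - \<theta>) * 1"
    using assms False by (intro Youngs_inequality_0) auto
  then have "(x / m) powr \<theta> \<le> 1 + \<theta> * (x / m - 1)"
    by (simp add: algebra_simps)
  then have "m powr \<theta> * (x / m) powr \<theta> \<le> m powr \<theta> * (1 + \<theta> * (x / m - 1))"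
    by (intro mult_left_mono) auto
  then show ?thesis
    using assms by (simp flip: powr_mult)
qed

text \<open>Both powers lie below the tangent at the mean \<open>m\<close>, and the linear parts
  cancel in the weighted sum. The mean 0 is separate because the tangent needs a positive base
  point.\<close>

lemma powr_concave_weighted:
  fixes x y \<theta> \<nu> :: real
  assumes \<nu>: "0 < \<nu>" "\<nu> \<le> 1" and \<theta>: "0 \<le> \<theta>" "\<theta> \<le> 1" and xy: "0 \<le> x" "0 \<le> y"
  shows "(1 - \<theta>) * x powr \<nu> + \<theta> * y powr \<nu> \<le> ((1 - \<theta>) * x + \<theta> * y) powr \<nu>"
proof -
  define m where "m = (1 - \<theta>) * x + \<theta> * y"
  have m0: "m \<ge> 0" "(1 - \<theta>) * x \<ge> 0" "\<theta> * y \<ge> 0" using assms by (auto simp: m_def)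
  show ?thesis
  proof (cases "m = 0")
    case True
    then have "(1 - \<theta>) * x = 0" "\<theta> * y = 0" using m0 unfolding m_def by linarith+
    then show ?thesis by auto
  next
    case False
    then have m: "m > 0" using m0 by simp
    have "(1 - \<theta>) * x powr \<nu> + \<theta> * y powr \<nu>
        \<le> (1 - \<theta>) * (m powr \<nu> * (1 + \<nu> * (x / m - 1))) + \<theta> * (m powr \<nu> * (1 + \<nu> * (y / m - 1)))"
      using assms m by (intro add_mono mult_left_mono powr_le_tangent) auto
    also have "\<dots> = m powr \<nu> * (1 + \<nu> * (((1 - \<theta>) * x + \<theta> * y) / m - 1))"
      by (simp add: algebra_simps add_divide_distrib diff_divide_distrib)
    also have "\<dots> = m powr \<nu>" using m by (simp add: m_def)
    finally show ?thesis by (simp add: m_def)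
  qed
qed

text \<open>The two fractions of \<open>x + y\<close> lie in [0, 1], where a number is at most its
  power with exponent at most 1; these powers therefore sum to at least 1.\<close>

lemma powr_subadditive:
  fixes x y \<nu> :: real
  assumes \<nu>: "0 < \<nu>" "\<nu> \<le> 1" and xy: "0 \<le> x" "0 \<le> y"
  shows "(x + y) powr \<nu> \<le> x powr \<nu> + y powr \<nu>"
proof (cases "x + y = 0")
  case True
  then show ?thesis using xy by simp
next
  case False
  then have p: "x + y > 0" using xy by simp
  have *: "u / (x + y) \<le> (u / (x + y)) powr \<nu>" if "0 \<le> u" "u \<le> x + y" for u
  proof -
    have "(u / (x + y)) powr 1 \<le> (u / (x + y)) powr \<nu>"
      using that p \<nu> by (intro powr_mono') auto
    then show ?thesis using that p by simp
  qed
  have "1 = x / (x + y) + y / (x + y)" using p by (simp add: add_divide_distrib[symmetric])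
  also have "\<dots> \<le> (x / (x + y)) powr \<nu> + (y / (x + y)) powr \<nu>"
    using xy by (intro add_mono *) auto
  also have "\<dots> = (x powr \<nu> + y powr \<nu>) / (x + y) powr \<nu>"
    by (simp add: powr_divide add_divide_distrib)
  finally show ?thesis using p by (simp add: field_simps)
qed

lemma power2_powr: "(x\<^sup>2) powr a = (x powr a)\<^sup>2" for x a :: real
  by (simp add: power2_eq_square powr_mult)

text \<open>For fixed norms \<open>s, t\<close>, the squared left-hand side is affine and the squared right-hand
  side concave in \<open>a \<bullet> b\<close>, so only the parallel and the antiparallel case matter.\<close>

lemma norm_powr_gradient_holder:
  fixes a b :: "'b::real_inner"
  assumes \<nu>: "0 < \<nu>" "\<nu> \<le> 1"
  shows "norm (norm a powr (\<nu> - 1) *\<^sub>R a - norm b powr (\<nu> - 1) *\<^sub>R b)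
         \<le> 2 powr (1 - \<nu>) * norm (a - b) powr \<nu>"
proof -
  have two: "1 \<le> (2::real) powr (1 - \<nu>)" using \<nu> by (intro ge_one_powr_ge_zero) auto
  have np: "norm (norm c powr (\<nu> - 1) *\<^sub>R c) = norm c powr \<nu>" for c :: 'b
    using powr_mult_base[of "norm c" "\<nu> - 1"] by (simp add: mult.commute)
  show ?thesis
  proof (cases "a = 0 \<or> b = 0")
    case True
    have "norm c powr \<nu> \<le> 2 powr (1 - \<nu>) * norm c powr \<nu>" for c :: 'b
      using mult_right_mono[OF two, of "norm c powr \<nu>"] by simp
    then show ?thesis using True np by (auto simp: norm_minus_commute)
  next
    case False
    define s t c where "s = norm a" and "t = norm b" and "c = a \<bullet> b"
    have st: "s > 0" "t > 0" using False by (auto simp: s_def t_def)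
    then have st': "s * t > 0" by simp
    have c: "\<bar>c\<bar> \<le> s * t" unfolding c_def s_def t_def by (rule Cauchy_Schwarz_ineq2)
    \<comment> \<open>The cosine of the angle is \<open>1 - 2 * \<theta>\<close>, so 0 is the
      parallel and 1 the antiparallel case. Both squared distances below are the same weighted
      average of their two extreme values.\<close>
    define \<theta> where "\<theta> = (s * t - c) / (2 * (s * t))"
    have \<theta>: "0 \<le> \<theta>" "\<theta> \<le> 1" using c st' unfolding \<theta>_def by (auto simp: field_simps)
    have c_eq: "c = (1 - 2 * \<theta>) * (s * t)" using st by (simp add: \<theta>_def field_simps)
    have dist2: "(norm (a - b))\<^sup>2 = (1 - \<theta>) * (s - t)\<^sup>2 + \<theta> * (s + t)\<^sup>2"
    proof -
      have "(norm (a - b))\<^sup>2 = s\<^sup>2 + t\<^sup>2 - 2 * c"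
        by (simp add: s_def t_def c_def power2_norm_eq_inner inner_diff inner_commute)
      then show ?thesis unfolding c_eq by (simp add: power2_eq_square algebra_simps)
    qed
    define S T where "S = s powr \<nu>" and "T = t powr \<nu>"
    have ipr: "(norm a powr (\<nu> - 1) *\<^sub>R a) \<bullet> (norm b powr (\<nu> - 1) *\<^sub>R b) = (1 - 2 * \<theta>) * (S * T)"
    proof -
      have "s powr (\<nu> - 1) * t powr (\<nu> - 1) * (s * t) = S * T"
      proof -
        have "s powr (\<nu> - 1) * t powr (\<nu> - 1) * (s * t) = (s * s powr (\<nu> - 1)) * (t * t powr (\<nu> - 1))"
          by (simp add: mult_ac)
        then show ?thesis
          using powr_mult_base[of s "\<nu> - 1"] powr_mult_base[of t "\<nu> - 1"] st
          by (simp add: S_def T_def)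
      qed
      then show ?thesis
        using c_eq by (simp add: c_def s_def t_def mult.left_commute mult.commute)
    qed
    have "(norm (norm a powr (\<nu> - 1) *\<^sub>R a - norm b powr (\<nu> - 1) *\<^sub>R b))\<^sup>2
        = S\<^sup>2 + T\<^sup>2 - 2 * ((1 - 2 * \<theta>) * (S * T))"
    proof -
      have "(norm (u - v))\<^sup>2 = (norm u)\<^sup>2 + (norm v)\<^sup>2 - 2 * (u \<bullet> v)" for u v :: 'b
        by (simp add: power2_norm_eq_inner inner_diff inner_commute)
      then show ?thesis by (simp only: ipr np) (simp add: S_def T_def s_def t_def)
    qed
    also have "\<dots> = (1 - \<theta>) * (S - T)\<^sup>2 + \<theta> * (S + T)\<^sup>2"
      by (simp add: power2_eq_square algebra_simps)
    also have "\<dots> \<le> (1 - \<theta>) * (2 powr (1 - \<nu>) * \<bar>s - t\<bar> powr \<nu>)\<^sup>2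
        + \<theta> * (2 powr (1 - \<nu>) * (s + t) powr \<nu>)\<^sup>2"
    proof -
      have "\<bar>S - T\<bar> \<le> \<bar>s - t\<bar> powr \<nu>"
        using powr_subadditive[OF \<nu>, of "s - t" t] powr_subadditive[OF \<nu>, of "t - s" s] st
          powr_mono2[of \<nu> s t] powr_mono2[of \<nu> t s] \<nu>
        unfolding S_def T_def by (cases "s \<le> t") auto
      also have "\<dots> \<le> 2 powr (1 - \<nu>) * \<bar>s - t\<bar> powr \<nu>"
        using mult_right_mono[OF two, of "\<bar>s - t\<bar> powr \<nu>"] by simp
      finally have 1: "(S - T)\<^sup>2 \<le> (2 powr (1 - \<nu>) * \<bar>s - t\<bar> powr \<nu>)\<^sup>2"
        by (metis abs_ge_zero power2_abs power_mono)
      have "S + T = 2 * ((1 - 1/2) * s powr \<nu> + 1/2 * t powr \<nu>)" by (simp add: S_def T_def)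
      also have "\<dots> \<le> 2 * ((1 - 1/2) * s + 1/2 * t) powr \<nu>"
        using \<nu> st by (intro mult_left_mono powr_concave_weighted) auto
      also have "(1 - 1/2) * s + 1/2 * t = (s + t) / 2" by simp
      also have "2 * ((s + t) / 2) powr \<nu> = 2 powr (1 - \<nu>) * (s + t) powr \<nu>"
        by (simp add: powr_divide powr_diff)
      finally have 2: "(S + T)\<^sup>2 \<le> (2 powr (1 - \<nu>) * (s + t) powr \<nu>)\<^sup>2"
        by (intro power_mono) (auto simp: S_def T_def)
      show ?thesis using \<theta> by (intro add_mono mult_left_mono 1 2) auto
    qed
    also have "\<dots> = (2 powr (1 - \<nu>))\<^sup>2 * ((1 - \<theta>) * ((s - t)\<^sup>2) powr \<nu> + \<theta> * ((s + t)\<^sup>2) powr \<nu>)"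
    proof -
      have "((s - t)\<^sup>2) powr \<nu> = (\<bar>s - t\<bar> powr \<nu>)\<^sup>2"
        using power2_powr[of "\<bar>s - t\<bar>" \<nu>] by simp
      then show ?thesis by (simp add: power2_powr power_mult_distrib algebra_simps)
    qed
    also have "\<dots> \<le> (2 powr (1 - \<nu>))\<^sup>2 * ((norm (a - b))\<^sup>2) powr \<nu>"
      unfolding dist2 using \<nu> \<theta> by (intro mult_left_mono powr_concave_weighted) auto
    also have "\<dots> = (2 powr (1 - \<nu>) * norm (a - b) powr \<nu>)\<^sup>2"
      by (simp add: power2_powr power_mult_distrib)
    finally show ?thesis by (rule power2_le_imp_le) simp
  qed
qed

text \<open>Cauchy-Schwarz leaves the scalars \<open>s\<close> and \<open>t\<close>, and Young's
  inequality with the conjugate exponents \<open>(\<nu> + 1) / \<nu>\<close> and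
  \<open>\<nu> + 1\<close> does the rest. It yields convexity of the penalty in
  \<open>psi\<close>.\<close>

lemma norm_powr_subgradient:
  fixes a b :: "'b::real_inner"
  assumes \<nu>: "0 < \<nu>"
  shows "norm a powr (\<nu> + 1) / (\<nu> + 1) + (norm a powr (\<nu> - 1) *\<^sub>R a) \<bullet> (b - a)
         \<le> norm b powr (\<nu> + 1) / (\<nu> + 1)"
proof -
  define s t where "s = norm a" and "t = norm b"
  have "a \<bullet> b \<le> s * t" unfolding s_def t_def by (rule norm_cauchy_schwarz)
  then have "s powr (\<nu> - 1) * (a \<bullet> b) \<le> s powr (\<nu> - 1) * (s * t)" by (intro mult_left_mono) auto
  also have "\<dots> = s powr \<nu> * t"
    using powr_mult_base[of s "\<nu> - 1"] by (simp add: s_def mult.commute mult.left_commute)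
  also have "\<dots> \<le> (s powr \<nu>) powr ((\<nu> + 1) / \<nu>) / ((\<nu> + 1) / \<nu>) + t powr (\<nu> + 1) / (\<nu> + 1)"
    using \<nu> by (intro Youngs_inequality) (auto simp: field_simps s_def t_def)
  also have "(s powr \<nu>) powr ((\<nu> + 1) / \<nu>) / ((\<nu> + 1) / \<nu>) = s powr (\<nu> + 1) * \<nu> / (\<nu> + 1)"
    using \<nu> by (simp add: powr_powr)
  finally have 1: "s powr (\<nu> - 1) * (a \<bullet> b) \<le> s powr (\<nu> + 1) * \<nu> / (\<nu> + 1) + t powr (\<nu> + 1) / (\<nu> + 1)" .
  have "s powr (\<nu> - 1) * (a \<bullet> a) = s powr (\<nu> - 1) * s * s"
    by (simp add: s_def dot_square_norm power2_eq_square)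
  also have "\<dots> = s powr (\<nu> + 1)"
    using powr_mult_base[of s "\<nu> - 1"] powr_mult_base[of s \<nu>] by (simp add: s_def mult.commute add.commute)
  finally have 2: "s powr (\<nu> - 1) * (a \<bullet> a) = s powr (\<nu> + 1)" .
  have 3: "s powr (\<nu> + 1) / (\<nu> + 1) + s powr (\<nu> + 1) * \<nu> / (\<nu> + 1) = s powr (\<nu> + 1)"
    using \<nu> by (subst add_divide_distrib[symmetric]) (simp add: field_simps)
  show ?thesis using 1 2 3 by (simp add: inner_diff_right s_def t_def algebra_simps)
qed

text \<open>Away from 0 this is the chain rule. At 0 the difference quotient has size
  \<open>norm y powr \<nu> / (\<nu> + 1)\<close>, which vanishes, and the formula agrees because it
  scales the zero vector.\<close>

lemma GDERIV_norm_powr: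
  fixes z :: "'b::real_inner"
  assumes \<nu>: "0 < \<nu>"
  shows "GDERIV (\<lambda>z. norm z powr (\<nu> + 1) / (\<nu> + 1)) z :> norm z powr (\<nu> - 1) *\<^sub>R z"
proof (cases "z = 0")
  case False
  have "DERIV (\<lambda>r. r powr (\<nu> + 1) / (\<nu> + 1)) (norm z) :> norm z powr \<nu>"
    using False \<nu> by (auto intro!: derivative_eq_intros)
  then have "GDERIV (\<lambda>z. norm z powr (\<nu> + 1) / (\<nu> + 1)) z :> norm z powr \<nu> *\<^sub>R sgn z"
    using GDERIV_norm[OF False] by (rule GDERIV_DERIV_compose[rotated])
  moreover have "norm z powr \<nu> *\<^sub>R sgn z = norm z powr (\<nu> - 1) *\<^sub>R z"
    using False by (simp add: sgn_div_norm powr_diff divide_simps)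
  ultimately show ?thesis by simp
next
  case True
  have "((\<lambda>y::'b. norm y powr \<nu> / (\<nu> + 1)) \<longlongrightarrow> 0 / (\<nu> + 1)) (at 0)"
    using \<nu> by (intro tendsto_divide tendsto_zero_powrI tendsto_norm_zero tendsto_const) auto
  then have "((\<lambda>y::'b. norm y powr \<nu> / (\<nu> + 1)) \<longlongrightarrow> 0) (at 0)" by simp
  then have "((\<lambda>y::'b. (norm y powr (\<nu> + 1) / (\<nu> + 1)) / norm y) \<longlongrightarrow> 0) (at 0)"
    by (rule tendsto_cong[THEN iffD1, rotated])
      (auto simp: eventually_at_filter powr_add)
  then show ?thesis
    using True \<nu> by (simp add: gderiv_def has_derivative_at2 tendsto_norm_zero_iff divide_inverse abs_mult mult.commute)
qed

section \<open>Gradients of differentiable functions\<close>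

lemma gradient_eqI:
  assumes "GDERIV h x :> g"
  shows "gradient h x = g"
proof -
  have "g' = g" if "GDERIV h x :> g'" for g'
  proof -
    have "(\<lambda>v. v \<bullet> g') = (\<lambda>v. v \<bullet> g)"
      using that assms unfolding gderiv_def by (rule has_derivative_unique)
    then show ?thesis by (metis inner_eq_zero_iff inner_diff_right right_minus_eq)
  qed
  then show ?thesis unfolding gradient_def using assms by blast
qed

lemma GDERIV_gradient:
  fixes h :: "'a::euclidean_space \<Rightarrow> real"
  assumes "h differentiable (at x)"
  shows "GDERIV h x :> gradient h x"
proof -
  obtain h' where h': "(h has_derivative h') (at x)" using assms unfolding differentiable_def by blast
  interpret bounded_linear h' using h' by (rule has_derivative_bounded_linear)
  have "h' v = v \<bullet> (\<Sum>b\<in>Basis. h' b *\<^sub>R b)" for v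
  proof -
    have "h' v = h' (\<Sum>b\<in>Basis. (v \<bullet> b) *\<^sub>R b)" by (simp add: euclidean_representation)
    also have "\<dots> = (\<Sum>b\<in>Basis. (v \<bullet> b) * h' b)" by (simp add: sum scale)
    finally show ?thesis by (simp add: inner_sum_right mult.commute)
  qed
  then have "h' = (\<lambda>v. v \<bullet> (\<Sum>b\<in>Basis. h' b *\<^sub>R b))" by (rule ext)
  then have "GDERIV h x :> (\<Sum>b\<in>Basis. h' b *\<^sub>R b)"
    using h' unfolding gderiv_def by simp
  then show ?thesis using gradient_eqI by metis
qed

section \<open>First-order inequalities on a convex set\<close>

text \<open>Let \<open>r\<close> be the claimed majorant minus \<open>F\<close> along the segment.
  Its derivative is nonnegative by Cauchy-Schwarz and the Hoelder condition, so
  \<open>r 0 \<le> r 1\<close>; no integral of the gradient is formed.\<close>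

lemma holder_gradient_upper_bound:
  fixes F :: "'a::real_inner \<Rightarrow> real"
  assumes X: "convex X" and x: "x \<in> X" and w: "w \<in> X" and \<nu>: "0 < \<nu>"
    and D: "\<And>u. u \<in> X \<Longrightarrow> GDERIV F u :> G u"
    and H: "\<And>u. u \<in> X \<Longrightarrow> norm (G u - G x) \<le> H * norm (u - x) powr \<nu>"
  shows "F w \<le> F x + G x \<bullet> (w - x) + H / (1 + \<nu>) * norm (w - x) powr (1 + \<nu>)"
proof -
  define d where "d = w - x"
  define r where "r t = t * (G x \<bullet> d) + H / (1 + \<nu>) * norm d powr (1 + \<nu>) * t powr (1 + \<nu>) - F (x + t *\<^sub>R d)" for t
  have inX: "x + t *\<^sub>R d \<in> X" if "0 \<le> t" "t \<le> 1" for t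
  proof -
    have "(1 - t) *\<^sub>R x + t *\<^sub>R w \<in> X" using X x w that by (auto simp: convex_alt)
    then show ?thesis by (simp add: d_def algebra_simps)
  qed
  have DF: "DERIV (\<lambda>t. F (x + t *\<^sub>R d)) t :> d \<bullet> G (x + t *\<^sub>R d)" if "0 \<le> t" "t \<le> 1" for t
  proof -
    have 1: "((\<lambda>t. x + t *\<^sub>R d) has_derivative (\<lambda>h. h *\<^sub>R d)) (at t)"
      by (auto intro!: derivative_eq_intros)
    have 2: "(F has_derivative (\<lambda>h. h \<bullet> G (x + t *\<^sub>R d))) (at (x + t *\<^sub>R d))"
      using D[OF inX[OF that]] by (simp add: gderiv_def)
    have "((\<lambda>t. F (x + t *\<^sub>R d)) has_derivative (\<lambda>h. (h *\<^sub>R d) \<bullet> G (x + t *\<^sub>R d))) (at t)"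
      using has_derivative_compose[OF 1 2] by simp
    then show ?thesis unfolding has_field_derivative_def
      by (rule has_derivative_eq_rhs) (auto simp: fun_eq_iff)
  qed
  have "r 0 \<le> r 1"
  proof (rule DERIV_nonneg_imp_increasing_open[where f = r])
    fix t :: real assume t: "0 < t" "t < 1"
    have "DERIV r t :> G x \<bullet> d + H / (1 + \<nu>) * norm d powr (1 + \<nu>) * ((1 + \<nu>) * t powr \<nu>) - d \<bullet> G (x + t *\<^sub>R d)"
      unfolding r_def using t by (auto intro!: derivative_eq_intros DF)
    moreover have "(G (x + t *\<^sub>R d) - G x) \<bullet> d \<le> H * norm d powr (1 + \<nu>) * t powr \<nu>"
    proof -
      have "(G (x + t *\<^sub>R d) - G x) \<bullet> d \<le> norm (G (x + t *\<^sub>R d) - G x) * norm d"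
        by (rule norm_cauchy_schwarz)
      also have "\<dots> \<le> H * norm (t *\<^sub>R d) powr \<nu> * norm d"
        using H[OF inX[of t]] t by (intro mult_right_mono) auto
      also have "\<dots> = H * t powr \<nu> * (norm d * norm d powr \<nu>)" using t by (simp add: powr_mult)
      also have "norm d * norm d powr \<nu> = norm d powr (1 + \<nu>)" by (simp add: powr_mult_base)
      finally show ?thesis by (simp add: mult_ac)
    qed
    then have "0 \<le> G x \<bullet> d + H / (1 + \<nu>) * norm d powr (1 + \<nu>) * ((1 + \<nu>) * t powr \<nu>) - d \<bullet> G (x + t *\<^sub>R d)"
      using \<nu> by (simp add: inner_diff_left inner_diff_right inner_commute[of _ d] mult_ac)
    ultimately show "\<exists>y. DERIV r t :> y \<and> y \<ge> 0" by blast
  next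
    have "continuous_on {0..1} (\<lambda>t. F (x + t *\<^sub>R d))"
      by (rule DERIV_atLeastAtMost_imp_continuous_on) (use DF in blast)
    then show "continuous_on {0..1} r" unfolding r_def using \<nu>
      by (intro continuous_intros continuous_on_powr') auto
  qed simp
  then show ?thesis by (simp add: r_def d_def)
qed

text \<open>The upper bound with exponent 1, applied to \<open>- F\<close>.\<close>

lemma lipschitz_gradient_lower_bound:
  fixes F :: "'a::real_inner \<Rightarrow> real"
  assumes X: "convex X" and x: "x \<in> X" and w: "w \<in> X"
    and D: "\<And>u. u \<in> X \<Longrightarrow> GDERIV F u :> G u"
    and H: "\<And>u. u \<in> X \<Longrightarrow> norm (G u - G x) \<le> H * norm (u - x)"
  shows "F w \<ge> F x + G x \<bullet> (w - x) - H / 2 * (norm (w - x))\<^sup>2"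
proof -
  have "- F w \<le> - F x + (- G x) \<bullet> (w - x) + H / (1 + 1) * norm (w - x) powr (1 + 1)"
  proof (rule holder_gradient_upper_bound[OF X x w])
    fix u assume u: "u \<in> X"
    show "GDERIV (\<lambda>x. - F x) u :> - G u" using D[OF u] by (rule GDERIV_minus)
    show "norm (- G u - - G x) \<le> H * norm (u - x) powr 1"
      using H[OF u] by (simp add: norm_minus_commute)
  qed auto
  then show ?thesis by simp
qed

text \<open>In the variable \<open>r\<^sup>2\<close> the left side is a concave power, hence below
  each of its tangents. The tangent with constant term \<open>\<delta>\<close> has slope half of
  \<open>fgm_L\<close>; this is where that formula comes from.\<close>

lemma holder_to_quadratic:
  fixes r H \<nu> \<delta> :: real
  assumes \<nu>: "0 < \<nu>" "\<nu> \<le> 1" and pos: "H > 0" "\<delta> > 0" "r \<ge> 0"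
  shows "H / (1 + \<nu>) * r powr (1 + \<nu>) \<le> fgm_L H \<nu> \<delta> / 2 * r\<^sup>2 + \<delta>"
proof (cases "\<nu> = 1")
  case True
  then show ?thesis using pos by (simp add: fgm_L_def)
next
  case False
  then have \<nu>1: "\<nu> < 1" using \<nu> by simp
  define k where "k = (1 - \<nu>) / (1 + \<nu>)"
  have k: "k > 0" using \<nu> \<nu>1 by (simp add: k_def)
  define B where "B = H / (2 * \<delta>) * k"
  have B: "B > 0" using pos k by (simp add: B_def)
  \<comment> \<open>The point of tangency, chosen so that the constant term of the tangent equals
    \<open>\<delta>\<close>.\<close>
  define m where "m = (1 / B) powr (2 / (1 + \<nu>))"
  have m: "m > 0" using B by (simp add: m_def)
  have mB: "m powr ((1 + \<nu>) / 2) = 1 / B"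
  proof -
    have "2 / (1 + \<nu>) * ((1 + \<nu>) / 2) = 1" using \<nu> by simp
    then show ?thesis using B by (simp only: m_def powr_powr) simp
  qed
  have mL: "(1 / B) / m = B powr k"
  proof -
    have "(1 / B) / m = (1 / B) powr 1 / (1 / B) powr (2 / (1 + \<nu>))"
      using B by (simp add: m_def)
    also have "\<dots> = (1 / B) powr (1 - 2 / (1 + \<nu>))" by (simp add: powr_diff)
    also have "1 - 2 / (1 + \<nu>) = - k" using \<nu> by (simp add: k_def field_simps)
    finally show ?thesis using B by (simp add: powr_minus powr_divide)
  qed
  have "r powr (1 + \<nu>) = (r\<^sup>2) powr ((1 + \<nu>) / 2)"
  proof -
    have "r\<^sup>2 = r powr 2" using pos by simp
    moreover have "2 * ((1 + \<nu>) / 2) = 1 + \<nu>" by simp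
    ultimately show ?thesis by (simp only: powr_powr)
  qed
  also have "\<dots> \<le> m powr ((1 + \<nu>) / 2) * (1 + (1 + \<nu>) / 2 * (r\<^sup>2 / m - 1))"
    using \<nu> m by (intro powr_le_tangent) auto
  also have "\<dots> = (1 + \<nu>) / 2 * ((1 / B) / m) * r\<^sup>2 + (1 / B) * ((1 - \<nu>) / 2)"
    unfolding mB using m B by (simp add: field_simps)
  also have "\<dots> = (1 + \<nu>) / 2 * B powr k * r\<^sup>2 + (1 / B) * ((1 - \<nu>) / 2)"
    unfolding mL by simp
  finally have "H / (1 + \<nu>) * r powr (1 + \<nu>)
      \<le> H / (1 + \<nu>) * ((1 + \<nu>) / 2 * B powr k * r\<^sup>2 + (1 / B) * ((1 - \<nu>) / 2))"
    using pos \<nu> by (intro mult_left_mono) auto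
  also have "\<dots> = H * B powr k / 2 * r\<^sup>2 + H / (1 + \<nu>) * ((1 - \<nu>) / 2) * (1 / B)"
  proof -
    have "H / (1 + \<nu>) * ((1 + \<nu>) / 2 * B powr k * r\<^sup>2) = H * B powr k / 2 * r\<^sup>2" using \<nu> by simp
    then show ?thesis by (simp only: distrib_left) simp
  qed
  also have "H / (1 + \<nu>) * ((1 - \<nu>) / 2) * (1 / B) = \<delta>"
  proof -
    have eq: "H / (1 + \<nu>) * ((1 - \<nu>) / 2) = H * k / 2" by (simp add: k_def)
    show ?thesis unfolding eq B_def using k pos by simp
  qed
  finally show ?thesis using False by (simp add: fgm_L_def B_def k_def)
qed

section \<open>Normal cones\<close>

lemma closed_normal_cone: "closed (normal_cone X x)"
proof (cases "x \<in> X")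
  case True
  then have "normal_cone X x = (\<Inter>z\<in>X. {v. v \<bullet> (z - x) \<le> 0})"
    by (auto simp: normal_cone_def)
  moreover have "closed {v. v \<bullet> (z - x) \<le> 0}" for z
    by (intro closed_Collect_le continuous_intros)
  ultimately show ?thesis by auto
qed (simp add: normal_cone_def)

lemma zero_in_normal_cone: "x \<in> X \<Longrightarrow> 0 \<in> normal_cone X x"
  by (simp add: normal_cone_def)

text \<open>The cone is closed and contains 0, so a nearest normal vector exists. Membership of
  \<open>x\<close> keeps the cone nonempty; \<open>infdist\<close> to the empty set would be
  0.\<close>

lemma infdist_normal_coneE:
  fixes p :: "'a::euclidean_space"
  assumes "x \<in> X" "infdist p (normal_cone X x) \<le> e"
  obtains n where "n \<in> normal_cone X x" "norm (p - n) \<le> e"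
proof -
  obtain n where "n \<in> normal_cone X x" "infdist p (normal_cone X x) = dist p n"
    using infdist_attains_inf[OF closed_normal_cone] zero_in_normal_cone[OF assms(1)] by blast
  then show ?thesis using assms(2) that by (auto simp: dist_norm)
qed

lemma infdist_normal_coneI:
  "n \<in> normal_cone X x \<Longrightarrow> norm (p - n) \<le> e \<Longrightarrow> infdist p (normal_cone X x) \<le> e"
  by (rule infdist_le2) (auto simp: dist_norm)

lemma infdist_normal_cone_add:
  assumes "infdist p (normal_cone X x) \<le> e" "norm (p - p') \<le> e'"
  shows "infdist p' (normal_cone X x) \<le> e + e'"
  using infdist_triangle[of p' "normal_cone X x" p] assms by (simp add: dist_norm norm_minus_commute)

text \<open>Approximate stationarity as a variational inequality: a nearby normal vector is
  nonpositive on feasible directions, and the remainder has norm at most \<open>e\<close>.\<close>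

lemma almost_stationary_inner_ge:
  fixes g :: "'a::euclidean_space"
  assumes "x \<in> X" "infdist (- g) (normal_cone X x) \<le> e" "w \<in> X"
  shows "- e * norm (w - x) \<le> g \<bullet> (w - x)"
proof -
  obtain n where n: "n \<in> normal_cone X x" "norm (- g - n) \<le> e"
    using infdist_normal_coneE[OF assms(1,2)] .
  have "n \<bullet> (w - x) \<le> 0" using n assms by (simp add: normal_cone_def)
  moreover have "(- g - n) \<bullet> (w - x) \<le> e * norm (w - x)"
    using norm_cauchy_schwarz[of "- g - n" "w - x"] mult_right_mono[OF n(2), of "norm (w - x)"] by simp
  ultimately show ?thesis by (simp add: inner_diff_left)
qed

section \<open>The fast gradient method\<close>

text \<open>Minimality is tested at the point with weight \<open>s\<close> on \<open>z\<close>.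
  Dividing by \<open>1 - s\<close> leaves a factor \<open>s\<close> on the quadratic term, which the
  limit towards 1 removes.\<close>

lemma is_arg_min_strongly_convex:
  fixes Q :: "'a::real_inner \<Rightarrow> real"
  assumes X: "convex X" and z: "is_arg_min Q (\<lambda>w. w \<in> X) z" and w: "w \<in> X"
    and Q: "\<And>t. 0 < t \<Longrightarrow> t < 1 \<Longrightarrow>
      Q ((1 - t) *\<^sub>R z + t *\<^sub>R w) \<le> (1 - t) * Q z + t * Q w - m / 2 * (t * (1 - t)) * (norm (w - z))\<^sup>2"
  shows "Q z + m / 2 * (norm (w - z))\<^sup>2 \<le> Q w"
proof -
  have "s * (m / 2 * (norm (w - z))\<^sup>2) \<le> Q w - Q z" if s: "0 < s" "s < 1" for s
  proof -
    have "z \<in> X" using z by (simp add: is_arg_min_def)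
    then have "(1 - (1 - s)) *\<^sub>R z + (1 - s) *\<^sub>R w \<in> X" using convexD[OF X _ w, of z s "1 - s"] s by simp
    then have "Q z \<le> Q ((1 - (1 - s)) *\<^sub>R z + (1 - s) *\<^sub>R w)"
      using z by (force simp: is_arg_min_def)
    also have "\<dots> \<le> s * Q z + (1 - s) * Q w - m / 2 * ((1 - s) * s) * (norm (w - z))\<^sup>2"
      using Q[of "1 - s"] s by simp
    finally have "(1 - s) * (s * (m / 2 * (norm (w - z))\<^sup>2)) \<le> (1 - s) * (Q w - Q z)"
      by (simp add: algebra_simps)
    then show ?thesis using s by simp
  qed
  then have "m / 2 * (norm (w - z))\<^sup>2 \<le> Q w - Q z" by (rule field_le_mult_one_interval)
  then show ?thesis by simp
qed

lemma norm_convex_combination: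
  fixes z w c :: "'a::real_inner"
  shows "(norm ((1 - t) *\<^sub>R z + t *\<^sub>R w - c))\<^sup>2
    = (1 - t) * (norm (z - c))\<^sup>2 + t * (norm (w - c))\<^sup>2 - t * (1 - t) * (norm (w - z))\<^sup>2"
proof -
  have "(1 - t) *\<^sub>R z + t *\<^sub>R w - c = (1 - t) *\<^sub>R (z - c) + t *\<^sub>R (w - c)" by (simp add: algebra_simps)
  moreover have "w - z = (w - c) - (z - c)" by simp
  ultimately show ?thesis
    unfolding power2_norm_eq_inner
    by (simp only: inner_add inner_diff inner_scaleR_left inner_scaleR_right) (simp add: inner_commute algebra_simps)
qed

lemma exists_is_arg_min_compact:
  fixes Q :: "'a::topological_space \<Rightarrow> real"
  assumes "compact X" "X \<noteq> {}" "continuous_on X Q"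
  shows "\<exists>z. is_arg_min Q (\<lambda>w. w \<in> X) z"
proof -
  obtain z where "z \<in> X" "\<forall>y\<in>X. Q z \<le> Q y" using continuous_attains_inf[OF assms] by blast
  then show ?thesis unfolding is_arg_min_def by (meson not_less)
qed

text \<open>Estimate sequences: up to the accumulated oracle error, \<open>S k * F (y k)\<close> is bounded by the
  minimum over \<open>X\<close> of \<open>\<Psi> k\<close>, the weighted sum of the lower models of \<open>F\<close>.\<close>

lemma fgm_gap:
  fixes F :: "'a::euclidean_space \<Rightarrow> real"
  assumes X: "convex X" and x0: "x\<^sub>0 \<in> X" and L: "L > 0" and \<mu>: "\<mu> > 0" and \<delta>: "\<delta> \<ge> 0"
    and run: "fgm_run X F L \<mu> x\<^sub>0 \<alpha> x y z"
    and lower: "\<And>u v. u \<in> X \<Longrightarrow> v \<in> X \<Longrightarrow>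
      F u + gradient F u \<bullet> (v - u) + \<mu> / 2 * (norm (v - u))\<^sup>2 \<le> F v"
    and upper: "\<And>u v. u \<in> X \<Longrightarrow> v \<in> X \<Longrightarrow>
      F v \<le> F u + gradient F u \<bullet> (v - u) + L / 2 * (norm (v - u))\<^sup>2 + \<delta>"
    and w: "w \<in> X"
  shows "y k \<in> X"
    and "F (y k) \<le> F w + L / 2 * (norm (w - x\<^sub>0))\<^sup>2 / (1 + sqrt (\<mu> / L)) ^ k + \<delta> * (1 + sqrt (L / \<mu>))"
proof -
  define S where "S k = (\<Sum>i\<le>k. \<alpha> i)" for k
  define g where "g i = gradient F (x i)" for i
  have run0: "x 0 = x\<^sub>0" "\<alpha> 0 = 1" using run by (auto simp: fgm_run_def)
  have \<alpha>1: "\<alpha> (Suc k) > 0" for k using run by (simp add: fgm_run_def)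
  have S0: "S 0 = 1" and SS: "S (Suc k) = S k + \<alpha> (Suc k)" for k
    using run0 by (simp_all add: S_def)
  have Spos: "S k > 0" for k by (induction k) (simp_all add: S0 SS add_pos_pos \<alpha>1)
  have S_eq: "L + \<mu> * S k = L * (\<alpha> (Suc k))\<^sup>2 / S (Suc k)" for k
    using run by (simp add: fgm_run_def S_def)
  have ymin: "is_arg_min (\<lambda>w. g k \<bullet> (w - x k) + L / 2 * (norm (w - x k))\<^sup>2) (\<lambda>w. w \<in> X) (y k)" for k
    using run by (simp add: fgm_run_def g_def)
  define \<Psi> where "\<Psi> k w = L / 2 * (norm (w - x\<^sub>0))\<^sup>2
    + (\<Sum>i\<le>k. \<alpha> i * (F (x i) + g i \<bullet> (w - x i) + \<mu> / 2 * (norm (w - x i))\<^sup>2))" for k w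
  \<comment> \<open>The terms \<open>\<alpha> i * F (x i)\<close> do not depend on the argument, so
    \<open>\<Psi> k\<close> has the same minimizers as the objective in
    \<open>fgm_run\<close>.\<close>
  have zmin: "is_arg_min (\<Psi> k) (\<lambda>w. w \<in> X) (z k)" for k
  proof -
    have "\<Psi> k w = (L / 2 * (norm (w - x\<^sub>0))\<^sup>2 +
        (\<Sum>i\<le>k. \<alpha> i * (gradient F (x i) \<bullet> (w - x i) + \<mu> / 2 * (norm (w - x i))\<^sup>2))) + (\<Sum>i\<le>k. \<alpha> i * F (x i))" for w
      by (simp add: \<Psi>_def g_def sum.distrib distrib_left)
    moreover have "is_arg_min (\<lambda>w. L / 2 * (norm (w - x\<^sub>0))\<^sup>2 +
        (\<Sum>i\<le>k. \<alpha> i * (gradient F (x i) \<bullet> (w - x i) + \<mu> / 2 * (norm (w - x i))\<^sup>2))) (\<lambda>w. w \<in> X) (z k)"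
      using run by (simp add: fgm_run_def)
    ultimately show ?thesis by (simp add: is_arg_min_def)
  qed
  have yX: "y k \<in> X" and zX: "z k \<in> X" for k
    using ymin[of k] zmin[of k] by (auto simp: is_arg_min_def)
  show "y k \<in> X" by (rule yX)
  define \<tau> where "\<tau> k = \<alpha> (Suc k) / S (Suc k)" for k
  have \<tau>: "0 \<le> \<tau> k" "\<tau> k \<le> 1" for k
    using \<alpha>1[of k] Spos[of k] by (auto simp: \<tau>_def SS field_simps)
  have xS: "x (Suc k) = \<tau> k *\<^sub>R z k + (1 - \<tau> k) *\<^sub>R y k" for k
    using run by (simp add: fgm_run_def \<tau>_def S_def Let_def)
  have comb: "\<tau> k *\<^sub>R u + (1 - \<tau> k) *\<^sub>R v \<in> X" if "u \<in> X" "v \<in> X" for k u v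
    using X \<tau>[of k] that by (simp add: convex_def)
  have xX: "x k \<in> X" for k
    using run0 x0 comb[OF zX yX] by (cases k) (auto simp: xS)
  \<comment> \<open>The regularizer and the weighted models add up to curvature
    \<open>L + \<mu> * S k\<close>, the left side of the equation for
    \<open>\<alpha> (Suc k)\<close>.\<close>
  have \<Psi>_strong: "\<Psi> k (z k) + (L + \<mu> * S k) / 2 * (norm (w - z k))\<^sup>2 \<le> \<Psi> k w" if "w \<in> X" for k w
  proof (rule is_arg_min_strongly_convex[OF X zmin that])
    fix t :: real
    let ?u = "(1 - t) *\<^sub>R z k + t *\<^sub>R w"
    let ?c = "t * (1 - t) * (norm (w - z k))\<^sup>2"
    let ?q = "\<lambda>i u. F (x i) + g i \<bullet> (u - x i) + \<mu> / 2 * (norm (u - x i))\<^sup>2"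
    have q: "\<alpha> i * ?q i ?u = (1 - t) * (\<alpha> i * ?q i (z k)) + t * (\<alpha> i * ?q i w) - \<alpha> i * (\<mu> / 2 * ?c)" for i
    proof -
      have "?u - x i = (1 - t) *\<^sub>R (z k - x i) + t *\<^sub>R (w - x i)" by (simp add: algebra_simps)
      then have "g i \<bullet> (?u - x i) = (1 - t) * (g i \<bullet> (z k - x i)) + t * (g i \<bullet> (w - x i))"
        by (simp add: inner_add_right)
      then show ?thesis by (simp only: norm_convex_combination) (simp add: field_simps)
    qed
    have "\<Psi> k ?u = (1 - t) * \<Psi> k (z k) + t * \<Psi> k w - L / 2 * ?c - (\<Sum>i\<le>k. \<alpha> i * (\<mu> / 2 * ?c))"
    proof -
      have "L / 2 * ((1 - t) * a + t * b - c) + ((1 - t) * p + t * r - s)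
          = (1 - t) * (L / 2 * a + p) + t * (L / 2 * b + r) - L / 2 * c - s" for a b c p r s :: real
        by (simp add: field_simps)
      moreover have "(\<Sum>i\<le>k. \<alpha> i * ?q i ?u) = (1 - t) * (\<Sum>i\<le>k. \<alpha> i * ?q i (z k))
          + t * (\<Sum>i\<le>k. \<alpha> i * ?q i w) - (\<Sum>i\<le>k. \<alpha> i * (\<mu> / 2 * ?c))"
        unfolding q by (simp only: sum.distrib sum_subtractf sum_distrib_left)
      ultimately show ?thesis unfolding \<Psi>_def by (simp only: norm_convex_combination)
    qed
    also have "(\<Sum>i\<le>k. \<alpha> i * (\<mu> / 2 * ?c)) = S k * (\<mu> / 2 * ?c)"
      unfolding S_def by (rule sum_distrib_right[symmetric])
    finally have "\<Psi> k ?u = (1 - t) * \<Psi> k (z k) + t * \<Psi> k w - L / 2 * ?c - S k * (\<mu> / 2 * ?c)" .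
    moreover have "L / 2 * ?c + S k * (\<mu> / 2 * ?c) = (L + \<mu> * S k) / 2 * (t * (1 - t)) * (norm (w - z k))\<^sup>2"
      by (simp add: field_simps)
    ultimately show "\<Psi> k ?u \<le> (1 - t) * \<Psi> k (z k) + t * \<Psi> k w
        - (L + \<mu> * S k) / 2 * (t * (1 - t)) * (norm (w - z k))\<^sup>2"
      by linarith
  qed
  have main: "S k * F (y k) \<le> \<Psi> k (z k) + \<delta> * (\<Sum>i\<le>k. S i)" for k
  proof (induction k)
    case 0
    have "F (y 0) \<le> F x\<^sub>0 + (g 0 \<bullet> (y 0 - x\<^sub>0) + L / 2 * (norm (y 0 - x\<^sub>0))\<^sup>2) + \<delta>"
      using upper[OF xX yX, of 0 0] by (simp add: g_def run0)
    also have "\<dots> \<le> F x\<^sub>0 + (g 0 \<bullet> (z 0 - x\<^sub>0) + L / 2 * (norm (z 0 - x\<^sub>0))\<^sup>2) + \<delta>"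
      using ymin[of 0] zX[of 0] by (force simp: is_arg_min_def run0)
    also have "\<dots> \<le> \<Psi> 0 (z 0) + \<delta>" using \<mu> by (simp add: \<Psi>_def run0)
    finally show ?case by (simp add: S0)
  next
    case (Suc k)
    \<comment> \<open>\<open>v\<close> is \<open>x (Suc k)\<close> with \<open>z k\<close> replaced
      by \<open>z (Suc k)\<close>. Testing the minimality of \<open>y (Suc k)\<close> at
      \<open>v\<close> turns its quadratic term into a multiple of the squared distance between the
      two minimizers.\<close>
    define v where "v = \<tau> k *\<^sub>R z (Suc k) + (1 - \<tau> k) *\<^sub>R y k"
    define x' where "x' = x (Suc k)"
    define g' where "g' = g (Suc k)"
    define a where "a = \<alpha> (Suc k)"
    have vX: "v \<in> X" unfolding v_def by (rule comb[OF zX yX])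
    have v_diff: "v - x' = \<tau> k *\<^sub>R (z (Suc k) - z k)" by (simp add: v_def x'_def xS algebra_simps)
    have S\<tau>: "S (Suc k) * \<tau> k = a" using Spos[of "Suc k"] by (simp add: \<tau>_def a_def)
    have bal: "S (Suc k) *\<^sub>R (v - x') = S k *\<^sub>R (y k - x') + a *\<^sub>R (z (Suc k) - x')"
    proof -
      have "S (Suc k) *\<^sub>R v = a *\<^sub>R z (Suc k) + S k *\<^sub>R y k"
        using S\<tau> by (simp add: v_def scaleR_right_distrib right_diff_distrib a_def SS)
      then show ?thesis by (simp add: algebra_simps SS a_def)
    qed
    have bal': "S (Suc k) * (g' \<bullet> (v - x')) = S k * (g' \<bullet> (y k - x')) + a * (g' \<bullet> (z (Suc k) - x'))"
      using arg_cong[OF bal, of "\<lambda>u. g' \<bullet> u"] by (simp add: inner_add_right)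
    \<comment> \<open>The recursion for \<open>\<alpha>\<close> enters here: the cost of moving to
      \<open>v\<close> is exactly what the strong convexity of \<open>\<Psi> k\<close> pays
      for.\<close>
    have quad: "(L + \<mu> * S k) / 2 * (norm (z (Suc k) - z k))\<^sup>2 = S (Suc k) * (L / 2 * (norm (v - x'))\<^sup>2)"
    proof -
      have "(norm (v - x'))\<^sup>2 = (\<tau> k)\<^sup>2 * (norm (z (Suc k) - z k))\<^sup>2"
        unfolding v_diff by (simp add: power_mult_distrib)
      then show ?thesis
        unfolding S_eq using Spos[of "Suc k"] by (simp add: \<tau>_def power2_eq_square)
    qed
    have "S (Suc k) * F (y (Suc k))
        \<le> S (Suc k) * (F x' + (g' \<bullet> (y (Suc k) - x') + L / 2 * (norm (y (Suc k) - x'))\<^sup>2) + \<delta>)"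
      using upper[OF xX yX, of "Suc k" "Suc k"] Spos[of "Suc k"]
      by (intro mult_left_mono) (auto simp: g_def g'_def x'_def)
    also have "\<dots> \<le> S (Suc k) * (F x' + (g' \<bullet> (v - x') + L / 2 * (norm (v - x'))\<^sup>2) + \<delta>)"
      using ymin[of "Suc k"] vX Spos[of "Suc k"]
      by (intro mult_left_mono add_left_mono add_right_mono) (force simp: is_arg_min_def g'_def x'_def)+
    also have "\<dots> = S k * (F x' + g' \<bullet> (y k - x')) + a * (F x' + g' \<bullet> (z (Suc k) - x'))
        + (L + \<mu> * S k) / 2 * (norm (z (Suc k) - z k))\<^sup>2 + \<delta> * S (Suc k)"
      unfolding quad using bal' by (simp add: algebra_simps SS a_def)
    also have "\<dots> \<le> S k * F (y k) + a * (F x' + g' \<bullet> (z (Suc k) - x'))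
        + (L + \<mu> * S k) / 2 * (norm (z (Suc k) - z k))\<^sup>2 + \<delta> * S (Suc k)"
    proof -
      have "0 \<le> \<mu> / 2 * (norm (y k - x'))\<^sup>2" using \<mu> by simp
      then have "F x' + g' \<bullet> (y k - x') \<le> F (y k)"
        using lower[OF xX[of "Suc k"] yX[of k]] by (simp add: g_def g'_def x'_def)
      then show ?thesis using Spos[of k] by (intro add_right_mono mult_left_mono) auto
    qed
    also have "\<dots> \<le> \<Psi> k (z k) + \<delta> * (\<Sum>i\<le>k. S i) + a * (F x' + g' \<bullet> (z (Suc k) - x'))
        + (L + \<mu> * S k) / 2 * (norm (z (Suc k) - z k))\<^sup>2 + \<delta> * S (Suc k)"
      using Suc.IH by simp
    also have "\<dots> \<le> \<Psi> k (z (Suc k)) + a * (F x' + g' \<bullet> (z (Suc k) - x') + \<mu> / 2 * (norm (z (Suc k) - x'))\<^sup>2)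
        + \<delta> * (\<Sum>i\<le>Suc k. S i)"
    proof -
      have "a * (F x' + g' \<bullet> (z (Suc k) - x')) \<le> a * (F x' + g' \<bullet> (z (Suc k) - x') + \<mu> / 2 * (norm (z (Suc k) - x'))\<^sup>2)"
        using \<alpha>1[of k] \<mu> by (intro mult_left_mono) (auto simp: a_def)
      then show ?thesis using \<Psi>_strong[OF zX[of "Suc k"], of k] by (simp add: algebra_simps)
    qed
    also have "\<dots> = \<Psi> (Suc k) (z (Suc k)) + \<delta> * (\<Sum>i\<le>Suc k. S i)"
      by (simp add: \<Psi>_def a_def x'_def g'_def)
    finally show ?case .
  qed
  define q where "q = sqrt (\<mu> / L)"
  have q: "q > 0" "1 / q = sqrt (L / \<mu>)"
    using L \<mu> by (auto simp: q_def real_sqrt_divide)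
  have q2: "q\<^sup>2 = \<mu> / L" using L \<mu> by (simp add: q_def)
  \<comment> \<open>Dropping \<open>L\<close> from the recursion gives
    \<open>q * S k \<le> \<alpha> (Suc k)\<close>, so the weights grow geometrically.\<close>
  have grow: "(1 + q) * S k \<le> S (Suc k)" for k
  proof -
    have "L * (q * S k)\<^sup>2 = \<mu> * (S k)\<^sup>2" using q2 L by (simp add: power_mult_distrib)
    also have "\<dots> \<le> \<mu> * S k * S (Suc k)"
      using \<mu> Spos[of k] \<alpha>1[of k] by (simp add: power2_eq_square SS)
    also have "\<dots> \<le> (L + \<mu> * S k) * S (Suc k)"
      using L Spos[of "Suc k"] by (intro mult_right_mono) auto
    also have "\<dots> = L * (\<alpha> (Suc k))\<^sup>2" unfolding S_eq using Spos[of "Suc k"] by simp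
    finally have "(q * S k)\<^sup>2 \<le> (\<alpha> (Suc k))\<^sup>2" using L by simp
    then have "q * S k \<le> \<alpha> (Suc k)" by (rule power2_le_imp_le) (use \<alpha>1 less_imp_le in auto)
    then show ?thesis by (simp add: SS algebra_simps)
  qed
  have pow: "(1 + q) ^ k \<le> S k" for k
  proof (induction k)
    case (Suc k)
    have "(1 + q) ^ Suc k \<le> (1 + q) * S k" using Suc q by simp
    then show ?case using grow[of k] by linarith
  qed (simp add: S0)
  have sumS: "(\<Sum>i\<le>k. S i) \<le> (1 + 1 / q) * S k" for k
  proof (induction k)
    case 0
    show ?case using q L \<mu> by (simp add: S0)
  next
    case (Suc k)
    have "(1 + 1 / q) * S k = ((1 + q) * S k) / q" using q by (simp add: field_simps)
    also have "\<dots> \<le> S (Suc k) / q" using grow[of k] q by (intro divide_right_mono) auto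
    finally show ?case using Suc by (simp add: algebra_simps)
  qed
  have "S k * F (y k) \<le> \<Psi> k w + \<delta> * (\<Sum>i\<le>k. S i)"
    using main[of k] zmin[of k] w by (force simp: is_arg_min_def)
  also have "\<Psi> k w \<le> L / 2 * (norm (w - x\<^sub>0))\<^sup>2 + (\<Sum>i\<le>k. \<alpha> i * F w)"
  proof -
    have "\<alpha> i \<ge> 0" for i using \<alpha>1 run0 by (cases i) (auto intro: less_imp_le)
    then show ?thesis unfolding \<Psi>_def
      using lower[OF xX w] by (intro add_left_mono sum_mono mult_left_mono) (auto simp: g_def)
  qed
  also have "(\<Sum>i\<le>k. \<alpha> i * F w) = S k * F w" by (simp add: S_def sum_distrib_right)
  also have "\<delta> * (\<Sum>i\<le>k. S i) \<le> \<delta> * ((1 + 1 / q) * S k)" by (intro mult_left_mono sumS \<delta>)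
  finally have "S k * F (y k) \<le> S k * (F w + L / 2 * (norm (w - x\<^sub>0))\<^sup>2 / S k + \<delta> * (1 + 1 / q))"
    using Spos[of k] by (simp add: algebra_simps)
  then have "F (y k) \<le> F w + L / 2 * (norm (w - x\<^sub>0))\<^sup>2 / S k + \<delta> * (1 + 1 / q)"
    using Spos[of k] by simp
  also have "\<dots> \<le> F w + L / 2 * (norm (w - x\<^sub>0))\<^sup>2 / (1 + q) ^ k + \<delta> * (1 + 1 / q)"
    using pow[of k] L q by (intro add_mono divide_left_mono) (auto intro!: mult_pos_pos Spos)
  finally show "F (y k) \<le> F w + L / 2 * (norm (w - x\<^sub>0))\<^sup>2 / (1 + sqrt (\<mu> / L)) ^ k + \<delta> * (1 + sqrt (L / \<mu>))"
    using q by (simp add: q_def)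
qed

text \<open>FGM is an explicit recursion once a positive \<open>\<alpha> (Suc k)\<close> and the two
  minimizers exist: the former is a root of a quadratic, the latter come from compactness.\<close>

lemma fgm_run_exists:
  fixes F :: "'a::euclidean_space \<Rightarrow> real"
  assumes X: "compact X" "X \<noteq> {}" and L: "L > 0" and \<mu>: "\<mu> > 0"
  shows "\<exists>\<alpha> x y z. fgm_run X F L \<mu> x\<^sub>0 \<alpha> x y z"
proof -
  \<comment> \<open>The positive root of
    \<open>L * a\<^sup>2 = (L + \<mu> * S) * (S + a)\<close>.\<close>
  define a where "a S = (let c = L + \<mu> * S in (c + sqrt (c\<^sup>2 + 4 * L * c * S)) / (2 * L))" for S
  have a: "a S > 0" "L * (a S)\<^sup>2 = (L + \<mu> * S) * (S + a S)" if "S > 0" for S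
  proof -
    define c r where "c = L + \<mu> * S" and "r = sqrt (c\<^sup>2 + 4 * L * c * S)"
    have c: "c > 0" using L \<mu> that by (simp add: c_def add_pos_pos)
    have r: "r \<ge> 0" "r\<^sup>2 = c\<^sup>2 + 4 * L * c * S" using c L that by (auto simp: r_def)
    have eq: "a S = (c + r) / (2 * L)" by (simp add: a_def c_def r_def Let_def)
    show "a S > 0" unfolding eq using c r L by simp
    have "L * (a S)\<^sup>2 = (c\<^sup>2 + 2 * c * r + r\<^sup>2) / (4 * L)"
      unfolding eq using L by (simp add: power2_eq_square field_simps)
    also have "\<dots> = c * (S + a S)" unfolding eq r(2) using L by (simp add: power2_eq_square field_simps)
    finally show "L * (a S)\<^sup>2 = (L + \<mu> * S) * (S + a S)" by (simp add: c_def)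
  qed
  define S where "S = rec_nat 1 (\<lambda>_ S. S + a S)"
  have S0: "S 0 = 1" and SS: "S (Suc k) = S k + a (S k)" for k by (simp_all add: S_def)
  have Spos: "S k > 0" for k by (induction k) (simp_all add: S0 SS add_pos_pos a)
  define \<alpha> where "\<alpha> k = (case k of 0 \<Rightarrow> 1 | Suc j \<Rightarrow> a (S j))" for k
  have sum\<alpha>: "(\<Sum>i\<le>k. \<alpha> i) = S k" for k by (induction k) (simp_all add: \<alpha>_def S0 SS)
  define m where "m x w = gradient F x \<bullet> (w - x) + \<mu> / 2 * (norm (w - x))\<^sup>2" for x w
  define Y where "Y x = (SOME y. is_arg_min (\<lambda>w. gradient F x \<bullet> (w - x) + L / 2 * (norm (w - x))\<^sup>2) (\<lambda>w. w \<in> X) y)" for x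
  define Z where "Z Q = (SOME z. is_arg_min Q (\<lambda>w. w \<in> X) z)" for Q :: "'a \<Rightarrow> real"
  define nxt where "nxt k x Q = (let \<tau> = \<alpha> (Suc k) / S (Suc k) in \<tau> *\<^sub>R Z Q + (1 - \<tau>) *\<^sub>R Y x)" for k x Q
  \<comment> \<open>Since \<open>z k\<close> depends on all earlier points, the state carries the
    objective built so far together with the current point.\<close>
  define st where "st = rec_nat (x\<^sub>0, \<lambda>w. L / 2 * (norm (w - x\<^sub>0))\<^sup>2 + \<alpha> 0 * m x\<^sub>0 w)
    (\<lambda>k (x, Q). (nxt k x Q, \<lambda>w. Q w + \<alpha> (Suc k) * m (nxt k x Q) w))"
  define x where "x k = fst (st k)" for k
  define Q where "Q k = snd (st k)" for k
  have x0: "x 0 = x\<^sub>0" and xS: "x (Suc k) = nxt k (x k) (Q k)" for k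
    by (simp_all add: x_def Q_def st_def split_beta)
  have Q_eq: "Q k = (\<lambda>w. L / 2 * (norm (w - x\<^sub>0))\<^sup>2 + (\<Sum>i\<le>k. \<alpha> i * m (x i) w))" for k
  proof (induction k)
    case 0
    show ?case by (simp add: x0) (simp add: Q_def st_def)
  next
    case (Suc k)
    have "Q (Suc k) = (\<lambda>w. Q k w + \<alpha> (Suc k) * m (x (Suc k)) w)"
      unfolding xS by (simp add: x_def Q_def st_def split_beta)
    then show ?case using Suc by (simp add: algebra_simps)
  qed
  have Ymin: "is_arg_min (\<lambda>w. gradient F x \<bullet> (w - x) + L / 2 * (norm (w - x))\<^sup>2) (\<lambda>w. w \<in> X) (Y x)" for x
    unfolding Y_def by (rule someI_ex, rule exists_is_arg_min_compact[OF X]) (intro continuous_intros)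
  have Zmin: "is_arg_min (Q k) (\<lambda>w. w \<in> X) (Z (Q k))" for k
    unfolding Z_def by (rule someI_ex, rule exists_is_arg_min_compact[OF X])
      (unfold Q_eq m_def, intro continuous_intros)
  have "fgm_run X F L \<mu> x\<^sub>0 \<alpha> x (\<lambda>k. Y (x k)) (\<lambda>k. Z (Q k))"
    unfolding fgm_run_def sum\<alpha>
  proof (intro conjI allI)
    fix k
    show "0 < \<alpha> (k + 1)" using a(1)[OF Spos] by (simp add: \<alpha>_def)
    show "L + \<mu> * S k = L * (\<alpha> (k + 1))\<^sup>2 / S (k + 1)"
      using a(2)[OF Spos[of k]] Spos[of "Suc k"] by (simp add: \<alpha>_def SS)
    show "is_arg_min (\<lambda>w. L / 2 * (norm (w - x\<^sub>0))\<^sup>2 +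
        (\<Sum>i\<le>k. \<alpha> i * (gradient F (x i) \<bullet> (w - x i) + \<mu> / 2 * (norm (w - x i))\<^sup>2))) (\<lambda>w. w \<in> X) (Z (Q k))"
      using Zmin[of k] unfolding Q_eq m_def .
    show "let \<tau> = \<alpha> (k + 1) / S (k + 1) in x (k + 1) = \<tau> *\<^sub>R Z (Q k) + (1 - \<tau>) *\<^sub>R Y (x k)"
      by (simp add: xS nxt_def Let_def)
    show "is_arg_min (\<lambda>w. gradient F (x k) \<bullet> (w - x k) + L / 2 * (norm (w - x k))\<^sup>2) (\<lambda>w. w \<in> X) (Y (x k))"
      by (rule Ymin)
  qed (auto simp: x0 \<alpha>_def)
  then show ?thesis by blast
qed

text \<open>The step moves by less than \<open>r\<close>, because a longer one would decrease \<open>F\<close> by more than the gap.\<close>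

lemma projected_gradient_step:
  fixes F :: "'a::euclidean_space \<Rightarrow> real"
  assumes X: "convex X" "closed X" and y: "y \<in> X" and \<nu>: "0 < \<nu>" "\<nu> \<le> 1" and pos: "H > 0" "r > 0"
    and v: "v = closest_point X (y - (r powr (1 - \<nu>) / (2 * H)) *\<^sub>R G y)"
    and upper: "\<And>u. u \<in> X \<Longrightarrow> F u \<le> F y + G y \<bullet> (u - y) + H / (1 + \<nu>) * norm (u - y) powr (1 + \<nu>)"
    and holder: "\<And>u. u \<in> X \<Longrightarrow> norm (G u - G y) \<le> H * norm (u - y) powr \<nu>"
    and gap: "\<And>u. u \<in> X \<Longrightarrow> F y - F u < H * r powr (1 + \<nu>)"
  shows "v \<in> X" and "infdist (- G v) (normal_cone X v) \<le> 3 * H * r powr \<nu>"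
proof -
  define \<gamma> where "\<gamma> = r powr (1 - \<nu>) / (2 * H)"
  have \<gamma>: "\<gamma> > 0" using pos by (simp add: \<gamma>_def)
  have inv\<gamma>: "1 / \<gamma> = 2 * H * r powr (\<nu> - 1)"
    using pos powr_minus[of r "1 - \<nu>"] by (simp add: \<gamma>_def field_simps)
  show vX: "v \<in> X" unfolding v using closest_point_in_set[of X] X y by blast
  define d where "d = norm (v - y)"
  have dot: "(y - \<gamma> *\<^sub>R G y - v) \<bullet> (u - v) \<le> 0" if "u \<in> X" for u
    unfolding v \<gamma>_def by (rule closest_point_dot) (use X that in auto)
  have "\<gamma> * (G y \<bullet> (v - y)) \<le> - d\<^sup>2"
    using dot[OF y] by (simp add: d_def power2_norm_eq_inner inner_diff inner_commute algebra_simps)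
  then have "G y \<bullet> (v - y) \<le> - (d\<^sup>2) / \<gamma>"
    by (intro pos_le_divide_eq[THEN iffD2, OF \<gamma>]) (simp only: mult.commute)
  then have desc: "G y \<bullet> (v - y) \<le> - (2 * H * r powr (\<nu> - 1) * d\<^sup>2)"
    unfolding inv\<gamma>[symmetric] by simp
  \<comment> \<open>For \<open>r \<le> d\<close> the Hoelder error is at most
    \<open>H * r powr (\<nu> - 1) * d\<^sup>2\<close>, because \<open>\<nu> - 1 \<le> 0\<close>.
    That is half of the linear decrease \<open>desc\<close>, and the other half already reaches the
    gap bound.\<close>
  have "d < r"
  proof (rule ccontr)
    assume "\<not> d < r"
    then have dr: "r \<le> d" by simp
    have d2: "d powr (1 + \<nu>) = d powr (\<nu> - 1) * d\<^sup>2"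
      using dr pos powr_add[of d "\<nu> - 1" 2] by (simp add: add.commute)
    have r2: "r powr (1 + \<nu>) = r powr (\<nu> - 1) * r\<^sup>2"
      using pos powr_add[of r "\<nu> - 1" 2] by (simp add: add.commute)
    have "H / (1 + \<nu>) * d powr (1 + \<nu>) \<le> H * d powr (1 + \<nu>)"
      using pos \<nu> by (intro mult_right_mono) (auto simp: divide_le_eq)
    also have "\<dots> \<le> H * (r powr (\<nu> - 1) * d\<^sup>2)"
      unfolding d2 using pos \<nu> dr by (intro mult_left_mono mult_right_mono powr_mono2') auto
    finally have "F v \<le> F y - H * (r powr (\<nu> - 1) * d\<^sup>2)"
      using upper[OF vX] desc by (simp add: d_def[symmetric] algebra_simps)
    moreover have "H * (r powr (\<nu> - 1) * r\<^sup>2) \<le> H * (r powr (\<nu> - 1) * d\<^sup>2)"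
      using pos dr by (intro mult_left_mono power_mono) auto
    ultimately show False using gap[OF vX] unfolding r2 by linarith
  qed
  \<comment> \<open>The projection residual is normal to \<open>X\<close> at \<open>v\<close> by the
    obtuse angle property. Scaled by \<open>1 / \<gamma>\<close>, it differs from
    \<open>- G v\<close> by a gradient variation, at most \<open>H * r powr \<nu>\<close>, and a
    displacement term, at most twice that.\<close>
  define n where "n = (1 / \<gamma>) *\<^sub>R (y - \<gamma> *\<^sub>R G y - v)"
  have n: "n \<in> normal_cone X v"
    using vX dot \<gamma> by (auto simp: normal_cone_def n_def mult_nonneg_nonpos divide_nonpos_pos)
  have "- G v - n = (G y - G v) + (1 / \<gamma>) *\<^sub>R (v - y)"
    using \<gamma> by (simp add: n_def algebra_simps)
  then have "norm (- G v - n) \<le> norm (G y - G v) + norm ((1 / \<gamma>) *\<^sub>R (v - y))"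
    by (simp only: norm_triangle_ineq)
  also have "norm (G y - G v) \<le> H * d powr \<nu>" using holder[OF vX] by (simp add: d_def norm_minus_commute)
  also have "norm ((1 / \<gamma>) *\<^sub>R (v - y)) = 2 * H * r powr (\<nu> - 1) * d"
    unfolding inv\<gamma> using pos by (simp add: d_def abs_mult)
  also have "\<dots> \<le> 2 * H * r powr (\<nu> - 1) * r"
    using pos \<open>d < r\<close> by (intro mult_left_mono) auto
  also have "\<dots> = 2 * H * r powr \<nu>"
    using powr_mult_base[of r "\<nu> - 1"] pos by (simp add: mult.commute)
  also have "H * d powr \<nu> \<le> H * r powr \<nu>"
    using pos \<nu> \<open>d < r\<close> by (intro mult_left_mono powr_mono2) (auto simp: d_def)
  finally show "infdist (- G v) (normal_cone X v) \<le> 3 * H * r powr \<nu>"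
    by (intro infdist_normal_coneI[OF n]) simp
qed

section \<open>The inexact proximal point method\<close>

text \<open>The prox term and strong convexity give a decrease of
  \<open>3 * \<rho> / 2 * d\<^sup>2\<close> up to an error \<open>e / 4 * d\<close>. A step too long
  to stop has \<open>e \<le> 4 * \<rho> * d\<close>, so part of the decrease absorbs the error and
  \<open>\<rho> / 2 * d\<^sup>2\<close> remains.\<close>

lemma ippm_step_decrease:
  fixes h :: "'a::euclidean_space \<Rightarrow> real"
  assumes \<rho>: "\<rho> > 0" and e: "e \<ge> 0" and c: "c \<in> X" and v: "v \<in> X"
    and stat: "infdist (- gradient (prox_objective h \<rho> c) v) (normal_cone X v) \<le> e / 4"
    and lower: "prox_objective h \<rho> c v + gradient (prox_objective h \<rho> c) v \<bullet> (c - v)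
      + \<rho> / 2 * (norm (c - v))\<^sup>2 \<le> prox_objective h \<rho> c c"
    and long: "\<not> 2 * \<rho> * norm (v - c) \<le> e / 2"
  shows "h v + e\<^sup>2 / (32 * \<rho>) \<le> h c"
proof -
  define d where "d = norm (v - c)"
  have d: "d \<ge> 0" "e \<le> 4 * \<rho> * d" using long by (auto simp: d_def)
  have "- (e / 4) * d \<le> gradient (prox_objective h \<rho> c) v \<bullet> (c - v)"
    using almost_stationary_inner_ge[OF v stat c] by (simp add: d_def norm_minus_commute)
  then have 1: "h v + \<rho> * d\<^sup>2 - e / 4 * d + \<rho> / 2 * d\<^sup>2 \<le> h c"
    using lower by (simp add: prox_objective_def d_def norm_minus_commute)
  have "e / 4 * d \<le> \<rho> * d * d" using d by (intro mult_right_mono) auto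
  then have 2: "e / 4 * d \<le> \<rho> * d\<^sup>2" by (simp add: power2_eq_square)
  have "e\<^sup>2 \<le> (4 * \<rho> * d)\<^sup>2" using d e by (intro power_mono) auto
  then have "e\<^sup>2 / (32 * \<rho>) \<le> \<rho> / 2 * d\<^sup>2"
    using \<rho> by (simp add: divide_le_eq power2_eq_square algebra_simps)
  then show ?thesis using 1 2 by linarith
qed

lemma ippm_run_in_set:
  assumes "ippm_run X h \<rho> e x\<^sub>1 u T" "x\<^sub>1 \<in> X" "1 \<le> t" "t \<le> T + 1"
  shows "u t \<in> X"
proof (cases "t = 1")
  case False
  then have "t - 1 \<in> {1..T}" "t = (t - 1) + 1" using assms by auto
  then show ?thesis using assms(1) unfolding ippm_run_def by metis
qed (use assms in \<open>simp add: ippm_run_def\<close>)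

text \<open>Telescoping of the decreases. The last iteration meets the stopping test and gives no
  guaranteed decrease, so \<open>T - 1\<close> iterations are counted and the sum ends at
  \<open>u T\<close>.\<close>

lemma ippm_run_length:
  fixes h :: "'a::euclidean_space \<Rightarrow> real"
  assumes \<rho>: "\<rho> > 0" and e: "e \<ge> 0" and x1: "x\<^sub>1 \<in> X" and run: "ippm_run X h \<rho> e x\<^sub>1 u T"
    and lower: "\<And>c v. c \<in> X \<Longrightarrow> v \<in> X \<Longrightarrow> prox_objective h \<rho> c v
      + gradient (prox_objective h \<rho> c) v \<bullet> (c - v) + \<rho> / 2 * (norm (c - v))\<^sup>2 \<le> prox_objective h \<rho> c c"
  shows "real (T - 1) * (e\<^sup>2 / (32 * \<rho>)) \<le> h x\<^sub>1 - h (u T)"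
proof -
  have "real j * (e\<^sup>2 / (32 * \<rho>)) \<le> h x\<^sub>1 - h (u (Suc j))" if "j < T" for j
    using that
  proof (induction j)
    case 0
    then show ?case using run by (simp add: ippm_run_def)
  next
    case (Suc j)
    have t: "Suc j \<in> {1..T}" "Suc j \<in> {1..<T}" using Suc.prems by auto
    have in_X: "u (Suc j) \<in> X" "u (Suc j + 1) \<in> X"
      using ippm_run_in_set[OF run x1] Suc.prems by auto
    have "h (u (Suc j + 1)) + e\<^sup>2 / (32 * \<rho>) \<le> h (u (Suc j))"
    proof (rule ippm_step_decrease[OF \<rho> e in_X _ lower[OF in_X]])
      show "infdist (- gradient (prox_objective h \<rho> (u (Suc j))) (u (Suc j + 1)))
          (normal_cone X (u (Suc j + 1))) \<le> e / 4"
        using run t(1) unfolding ippm_run_def by blast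
      show "\<not> 2 * \<rho> * norm (u (Suc j + 1) - u (Suc j)) \<le> e / 2"
        using run t(2) unfolding ippm_run_def by blast
    qed
    then show ?case using Suc by (simp add: algebra_simps add_divide_distrib)
  qed
  moreover have "T \<ge> 1" using run by (simp add: ippm_run_def)
  ultimately show ?thesis by (metis Suc_diff_1 diff_less less_numeral_extra(1) order_less_le_trans)
qed

text \<open>Every iteration that does not stop decreases \<open>h\<close> by a fixed amount, so the method stops.\<close>

lemma ippm_run_exists:
  fixes h :: "'a::euclidean_space \<Rightarrow> real"
  assumes \<rho>: "\<rho> > 0" and e: "e > 0" and x1: "x\<^sub>1 \<in> X" and below: "\<And>v. v \<in> X \<Longrightarrow> b \<le> h v"
    and lower: "\<And>c v. c \<in> X \<Longrightarrow> v \<in> X \<Longrightarrow> prox_objective h \<rho> c v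
      + gradient (prox_objective h \<rho> c) v \<bullet> (c - v) + \<rho> / 2 * (norm (c - v))\<^sup>2 \<le> prox_objective h \<rho> c c"
    and P: "\<And>t c. c \<in> X \<Longrightarrow> \<exists>v. P t c v"
    and P_stat: "\<And>t c v. c \<in> X \<Longrightarrow> P t c v \<Longrightarrow>
      v \<in> X \<and> infdist (- gradient (prox_objective h \<rho> c) v) (normal_cone X v) \<le> e / 4"
  shows "\<exists>u T. ippm_run X h \<rho> e x\<^sub>1 u T \<and> (\<forall>t\<in>{1..T}. P t (u t) (u (t + 1)))"
proof -
  define nxt where "nxt t c = (SOME v. P t c v)" for t c
  have nxt: "P t c (nxt t c)" if "c \<in> X" for t c unfolding nxt_def by (rule someI_ex[OF P[OF that]])
  \<comment> \<open>Indices start at 1, so the recursion runs on \<open>t - 1\<close>. The choice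
    may depend on \<open>t\<close>, as the starting point of FGM does.\<close>
  define u where "u t = rec_nat x\<^sub>1 (\<lambda>j. nxt (Suc j)) (t - 1)" for t
  have u1: "u 1 = x\<^sub>1" and uS: "u (Suc t + 1) = nxt (Suc t) (u (Suc t))" for t by (simp_all add: u_def)
  have nxt_X: "nxt t c \<in> X" if "c \<in> X" for t c using P_stat[OF that nxt[OF that]] by blast
  have uX: "u (Suc t) \<in> X" for t
    using u1 x1 nxt_X uS by (induction t) auto
  define stop where "stop t \<longleftrightarrow> 2 * \<rho> * norm (u (t + 1) - u t) \<le> e / 2" for t
  have "\<exists>t\<ge>1. stop t"
  proof (rule ccontr)
    assume no: "\<not> (\<exists>t\<ge>1. stop t)"
    have "h (u (Suc t)) + real t * (e\<^sup>2 / (32 * \<rho>)) \<le> h x\<^sub>1" for t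
    proof (induction t)
      case (Suc t)
      have "h (u (Suc t + 1)) + e\<^sup>2 / (32 * \<rho>) \<le> h (u (Suc t))"
      proof (rule ippm_step_decrease[OF \<rho> _ uX _ _ lower])
        show "infdist (- gradient (prox_objective h \<rho> (u (Suc t))) (u (Suc t + 1)))
            (normal_cone X (u (Suc t + 1))) \<le> e / 4"
          using P_stat[OF uX nxt[OF uX]] unfolding uS by blast
        show "\<not> 2 * \<rho> * norm (u (Suc t + 1) - u (Suc t)) \<le> e / 2"
          using no unfolding stop_def by force
      qed (use e uX[of t] uX[of "Suc t"] in auto)
      then show ?case using Suc by (simp add: algebra_simps add_divide_distrib)
    qed (use u1 in simp)
    then have bound: "real t * (e\<^sup>2 / (32 * \<rho>)) \<le> h x\<^sub>1 - b" for t
      using below[OF uX[of t]] by (smt (verit))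
    obtain t :: nat where "(h x\<^sub>1 - b) / (e\<^sup>2 / (32 * \<rho>)) < real t" using reals_Archimedean2 by blast
    moreover have "e\<^sup>2 / (32 * \<rho>) > 0" using e \<rho> by simp
    ultimately have "h x\<^sub>1 - b < real t * (e\<^sup>2 / (32 * \<rho>))" by (simp only: pos_divide_less_eq)
    then show False using bound[of t] by linarith
  qed
  \<comment> \<open>The first stopping time: \<open>ippm_run\<close> demands that every earlier
    iteration fails the test.\<close>
  define T where "T = (LEAST t. t \<ge> 1 \<and> stop t)"
  have T: "T \<ge> 1" "stop T" using \<open>\<exists>t\<ge>1. stop t\<close> LeastI_ex[of "\<lambda>t. t \<ge> 1 \<and> stop t"] by (auto simp: T_def)
  have before: "\<not> stop t" if "1 \<le> t" "t < T" for t using that not_less_Least unfolding T_def by blast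
  have step: "P t (u t) (u (t + 1)) \<and> u t \<in> X" if "t \<in> {1..T}" for t
    using that uX[of "t - 1"] uS[of "t - 1"] nxt[OF uX[of "t - 1"], of t] by simp
  have "ippm_run X h \<rho> e x\<^sub>1 u T"
    unfolding ippm_run_def
  proof (intro conjI ballI)
    fix t assume t: "t \<in> {1..T}"
    show "u (t + 1) \<in> X"
      and "infdist (- gradient (prox_objective h \<rho> (u t)) (u (t + 1))) (normal_cone X (u (t + 1))) \<le> e / 4"
      using P_stat step[OF t] by blast+
  next
    fix t assume "t \<in> {1..<T}"
    then show "\<not> 2 * \<rho> * norm (u (t + 1) - u t) \<le> e / 2" using before unfolding stop_def by simp
  qed (use T u1 in \<open>simp_all add: stop_def\<close>)
  then show ?thesis using step by blast
qed

lemma norm_add3_le: "norm (a + b + c) \<le> norm a + norm b + norm c" for a b c :: "'a::real_normed_vector"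
  using norm_triangle_ineq[of "a + b" c] norm_triangle_ineq[of a b] by linarith

section \<open>The augmented Lagrangian of a linearly constrained problem\<close>

text \<open>The constraint map is affine, so a constant term is allowed; the argument 0 of
  \<open>assumption_P\<close> is the value of \<open>LA\<close>.\<close>

locale linear_power_alm =
  fixes X :: "(real^'n) set" and f :: "real^'n \<Rightarrow> real" and A :: "real^'n \<Rightarrow> real^'m"
    and D Lf Amax JAmax gfmax \<nu> :: real
  assumes f_diff: "\<And>x. f differentiable (at x)"
    and A_diff: "\<And>x. A differentiable (at x)"
    and P: "assumption_P X f A D Lf 0 Amax JAmax gfmax"
    and A_linear: "linear (\<lambda>x. A x - A 0)"
    and \<nu>: "0 < \<nu>" "\<nu> \<le> 1"
begin

lemma X: "X \<noteq> {}" "convex X" "compact X" "closed X"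
  using P by (auto simp: assumption_P_def compact_imp_closed)

lemma pos: "D > 0" "Lf > 0" "Amax > 0" "JAmax > 0" "gfmax > 0"
  using P by (auto simp: assumption_P_def)

lemma norm_diff_le: "x \<in> X \<Longrightarrow> w \<in> X \<Longrightarrow> norm (x - w) \<le> D"
  using diameter_bounded_bound[OF compact_imp_bounded[OF X(3)]] P
  by (auto simp: assumption_P_def dist_norm)

section \<open>The affine constraint map and the gradient of the augmented Lagrangian\<close>

definition M :: "real^'n^'m" where "M = matrix (\<lambda>x. A x - A 0)"

lemma M_mult: "M *v v = A v - A 0"
  using fun_cong[OF matrix_vector_mul(2)[OF A_linear]] by (simp add: M_def)

lemma A_affine: "A w = A x + M *v (w - x)"
  by (simp add: M_mult matrix_vector_mult_diff_distrib)

lemma A_has_derivative: "(A has_derivative (\<lambda>v. M *v v)) (at x)"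
proof -
  have "((\<lambda>w. A x + M *v (w - x)) has_derivative (\<lambda>v. M *v v)) (at x)"
    by (auto intro!: derivative_eq_intros bounded_linear.has_derivative[OF matrix_vector_mul_bounded_linear])
  then show ?thesis by (simp flip: A_affine)
qed

lemma jacobian_eq: "jacobian A (at x) = M"
  unfolding jacobian_def frechet_derivative_at[OF A_has_derivative, symmetric] by simp

lemma norm_M_mult: "norm (M *v v) \<le> JAmax * norm v"
proof -
  obtain x where "x \<in> X" using X by blast
  then have "onorm ((*v) M) \<le> JAmax" using P by (auto simp: assumption_P_def jacobian_eq)
  then have "onorm ((*v) M) * norm v \<le> JAmax * norm v" by (rule mult_right_mono) simp
  then show ?thesis using onorm[OF matrix_vector_mul_bounded_linear, of M v] by linarith
qed

lemma inner_transpose_M: "(transpose M *v u) \<bullet> v = u \<bullet> (M *v v)"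
  using dot_lmul_matrix[of u M v] vector_transpose_matrix[of u "transpose M"] by simp

text \<open>Testing \<open>transpose M *v u\<close> against itself moves \<open>M\<close> to the
  other factor, so the adjoint inherits the norm bound.\<close>

lemma norm_transpose_M_mult: "norm (transpose M *v u) \<le> JAmax * norm u"
proof (cases "transpose M *v u = 0")
  case True
  then show ?thesis using pos by simp
next
  case False
  let ?w = "transpose M *v u"
  have "(norm ?w)\<^sup>2 = u \<bullet> (M *v ?w)" by (simp only: power2_norm_eq_inner inner_transpose_M)
  also have "\<dots> \<le> norm u * (JAmax * norm ?w)"
    using norm_cauchy_schwarz[of u "M *v ?w"] mult_left_mono[OF norm_M_mult[of ?w] norm_ge_zero[of u]]
    by linarith
  finally have "norm ?w * norm ?w \<le> (JAmax * norm u) * norm ?w"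
    by (simp add: power2_eq_square mult_ac)
  then show ?thesis using False by simp
qed

lemma gradient_phi:
  fixes z :: "'b::real_inner"
  shows "gradient (phi \<nu>) z = norm z powr (\<nu> - 1) *\<^sub>R z"
proof (rule gradient_eqI)
  have "phi \<nu> = (\<lambda>z::'b. norm z powr (\<nu> + 1) / (\<nu> + 1))" by (simp add: phi_def fun_eq_iff)
  then show "GDERIV (phi \<nu>) z :> norm z powr (\<nu> - 1) *\<^sub>R z" using GDERIV_norm_powr[OF \<nu>(1), of z] by simp
qed

lemma norm_gradient_phi: "norm (gradient (phi \<nu>) z) = norm z powr \<nu>"
  using powr_mult_base[of "norm z" "\<nu> - 1"] by (simp add: gradient_phi mult.commute)

definition psi_gradient :: "real \<Rightarrow> real^'m \<Rightarrow> real^'n \<Rightarrow> real^'n" where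
  "psi_gradient \<beta> y x = gradient f x + transpose M *v (y + \<beta> *\<^sub>R (norm (A x) powr (\<nu> - 1) *\<^sub>R A x))"

lemma GDERIV_psi: "GDERIV (psi \<nu> f A \<beta> y) x :> psi_gradient \<beta> y x"
proof -
  have f': "(f has_derivative (\<lambda>h. h \<bullet> gradient f x)) (at x)"
    using GDERIV_gradient[OF f_diff[of x]] by (simp add: gderiv_def)
  have g': "((\<lambda>z. norm z powr (\<nu> + 1) / (\<nu> + 1)) has_derivative
      (\<lambda>h. h \<bullet> (norm (A x) powr (\<nu> - 1) *\<^sub>R A x))) (at (A x))"
    using GDERIV_norm_powr[OF \<nu>(1), of "A x"] by (simp add: gderiv_def)
  have psi_eq: "psi \<nu> f A \<beta> y = (\<lambda>x. f x + A x \<bullet> y + \<beta> * (norm (A x) powr (\<nu> + 1) / (\<nu> + 1)))"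
    by (simp add: psi_def fun_eq_iff)
  have inner: "h \<bullet> (transpose M *v u) = (M *v h) \<bullet> u" for h u
    using inner_transpose_M[of u h] by (simp add: inner_commute)
  show ?thesis
    unfolding gderiv_def psi_eq psi_gradient_def
    by (rule has_derivative_eq_rhs,
        rule has_derivative_add[OF has_derivative_add[OF f' has_derivative_inner_left[OF A_has_derivative]]
          has_derivative_mult_right[OF has_derivative_compose[OF A_has_derivative g']]])
      (simp only: inner inner_add_right inner_scaleR_right add.assoc)
qed

lemma gradient_psi: "gradient (psi \<nu> f A \<beta> y) x = psi_gradient \<beta> y x"
  by (rule gradient_eqI[OF GDERIV_psi])

lemma GDERIV_prox_psi:
  "GDERIV (prox_objective (psi \<nu> f A \<beta> y) \<rho> c) x :> psi_gradient \<beta> y x + (2 * \<rho>) *\<^sub>R (x - c)"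
proof -
  have "((\<lambda>x. psi \<nu> f A \<beta> y x + \<rho> * ((x - c) \<bullet> (x - c))) has_derivative
      (\<lambda>h. h \<bullet> psi_gradient \<beta> y x + \<rho> * ((x - c) \<bullet> h + h \<bullet> (x - c)))) (at x)"
    using GDERIV_psi[of \<beta> y x] unfolding gderiv_def by (auto intro!: derivative_eq_intros)
  then show ?thesis
    unfolding gderiv_def prox_objective_def power2_norm_eq_inner
    by (rule has_derivative_eq_rhs) (simp add: fun_eq_iff inner_add_right inner_commute)
qed

lemma gradient_prox_psi:
  "gradient (prox_objective (psi \<nu> f A \<beta> y) \<rho> c) x = psi_gradient \<beta> y x + (2 * \<rho>) *\<^sub>R (x - c)"
  by (rule gradient_eqI[OF GDERIV_prox_psi])

section \<open>Weak convexity and Hoelder smoothness of the proximal objective\<close>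

lemma f_lower: "x \<in> X \<Longrightarrow> w \<in> X \<Longrightarrow> f x + gradient f x \<bullet> (w - x) - Lf / 2 * (norm (w - x))\<^sup>2 \<le> f w"
  using lipschitz_gradient_lower_bound[OF X(2), of x w f "gradient f" Lf] GDERIV_gradient[OF f_diff] P
  by (simp add: assumption_P_def)

text \<open>The inner product with \<open>y\<close> is affine in \<open>x\<close> and the penalty is
  convex, so only \<open>f\<close> loses curvature: \<open>psi\<close> is weakly convex with
  constant \<open>Lf\<close>, whatever \<open>\<beta>\<close> and \<open>y\<close> are.\<close>

lemma psi_lower:
  assumes "x \<in> X" "w \<in> X" "\<beta> \<ge> 0"
  shows "psi \<nu> f A \<beta> y x + psi_gradient \<beta> y x \<bullet> (w - x) - Lf / 2 * (norm (w - x))\<^sup>2 \<le> psi \<nu> f A \<beta> y w"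
proof -
  let ?g = "norm (A x) powr (\<nu> - 1) *\<^sub>R A x"
  have Aw: "M *v (w - x) = A w - A x" using A_affine[of w x] by simp
  have "\<beta> * (norm (A x) powr (\<nu> + 1) / (\<nu> + 1) + ?g \<bullet> (A w - A x)) \<le> \<beta> * (norm (A w) powr (\<nu> + 1) / (\<nu> + 1))"
    by (intro mult_left_mono norm_powr_subgradient \<nu> assms)
  moreover have "psi_gradient \<beta> y x \<bullet> (w - x)
      = gradient f x \<bullet> (w - x) + (A w \<bullet> y - A x \<bullet> y) + \<beta> * (?g \<bullet> (A w - A x))"
    unfolding psi_gradient_def inner_add_left[of "gradient f x"]
    by (simp only: inner_transpose_M Aw inner_add_left inner_scaleR_left)
      (simp add: inner_diff_left inner_diff_right inner_commute)
  ultimately show ?thesis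
    using f_lower[OF assms(1,2)] by (simp add: psi_def distrib_left)
qed

text \<open>The prox term contributes \<open>Lf * (norm (w - x))\<^sup>2\<close> exactly, twice what
  weak convexity costs; half of it remains as strong convexity.\<close>

lemma prox_psi_lower:
  fixes y :: "real^'m"
  assumes "x \<in> X" "w \<in> X" "\<beta> \<ge> 0"
  defines "F \<equiv> \<lambda>c. prox_objective (psi \<nu> f A \<beta> y) Lf c"
  shows "F c x + gradient (F c) x \<bullet> (w - x) + Lf / 2 * (norm (w - x))\<^sup>2 \<le> F c w"
proof -
  have "w - c = (x - c) + (w - x)" by simp
  then have "(norm (w - c))\<^sup>2 = (norm (x - c))\<^sup>2 + 2 * ((x - c) \<bullet> (w - x)) + (norm (w - x))\<^sup>2"
    by (simp only: power2_norm_eq_inner inner_add) (simp add: inner_commute)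
  then have "Lf * (norm (w - c))\<^sup>2 = Lf * (norm (x - c))\<^sup>2 + ((2 * Lf) *\<^sub>R (x - c)) \<bullet> (w - x) + Lf * (norm (w - x))\<^sup>2"
    by (simp only: distrib_left inner_scaleR_left mult.assoc mult.left_commute)
  then show ?thesis
    using psi_lower[OF assms(1,2,3), of y]
    unfolding F_def gradient_prox_psi by (simp add: prox_objective_def inner_add_left)
qed

text \<open>For \<open>LA = 0\<close> the constant does not depend on the multiplier, so 0 stands in
  for it. Hence the FGM parameters can be chosen before the multipliers are known.\<close>

definition prox_holder :: "real \<Rightarrow> real" where
  "prox_holder \<beta> = holder_F Lf 0 Amax JAmax D \<nu> \<beta> (0::real^'m)"

lemma holder_F_eq: "holder_F Lf 0 Amax JAmax D \<nu> \<beta> (y::real^'m) = prox_holder \<beta>"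
  by (simp add: prox_holder_def holder_F_def holder_psi_def ippm_rho_def)

lemma prox_holder_eq:
  "prox_holder \<beta> = (3 * Lf + \<beta> * (2 powr (1 - \<nu>) * JAmax powr (1 + \<nu>))) * max 1 (D powr (1 - \<nu>))"
  by (simp add: prox_holder_def holder_F_def holder_psi_def ippm_rho_def algebra_simps)

lemma prox_holder_pos: "\<beta> \<ge> 0 \<Longrightarrow> prox_holder \<beta> > 0"
  unfolding prox_holder_eq using pos by (intro mult_pos_pos add_pos_nonneg) auto

text \<open>On a set of diameter \<open>D\<close> a Lipschitz bound is a Hoelder bound with factor
  \<open>D powr (1 - \<nu>)\<close>, which treats \<open>f\<close> and the prox term; the penalty
  gradient is Hoelder already. The maximum with 1 lets one factor cover all three.\<close>

lemma prox_gradient_holder: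
  fixes y :: "real^'m"
  assumes "x \<in> X" "w \<in> X" "\<beta> \<ge> 0"
  defines "F \<equiv> \<lambda>c. prox_objective (psi \<nu> f A \<beta> y) Lf c"
  shows "norm (gradient (F c) x - gradient (F c) w) \<le> prox_holder \<beta> * norm (x - w) powr \<nu>"
proof -
  define d where "d = norm (x - w)"
  define m where "m = max 1 (D powr (1 - \<nu>))"
  have d: "0 \<le> d" "d \<le> D" using norm_diff_le[OF assms(1,2)] by (auto simp: d_def)
  have "d = d powr (1 - \<nu>) * d powr \<nu>" using d by (simp flip: powr_add)
  also have "\<dots> \<le> m * d powr \<nu>"
    using d \<nu> powr_mono2[of "1 - \<nu>" d D] by (intro mult_right_mono) (auto simp: m_def)
  finally have dm: "d \<le> m * d powr \<nu>" .
  define g where "g u = norm (A u) powr (\<nu> - 1) *\<^sub>R A u" for u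
  have Aw: "A x - A w = M *v (x - w)" using A_affine[of x w] by simp
  have "gradient (F c) x - gradient (F c) w
      = (gradient f x - gradient f w) + (2 * Lf) *\<^sub>R (x - w) + transpose M *v (\<beta> *\<^sub>R (g x - g w))"
    unfolding F_def gradient_prox_psi
    by (simp add: psi_gradient_def g_def algebra_simps matrix_vector_mult_diff_distrib matrix_vector_right_distrib)
  then have "norm (gradient (F c) x - gradient (F c) w)
      \<le> norm (gradient f x - gradient f w) + norm ((2 * Lf) *\<^sub>R (x - w)) + norm (transpose M *v (\<beta> *\<^sub>R (g x - g w)))"
    by (simp only: norm_add3_le)
  also have "norm (gradient f x - gradient f w) \<le> Lf * d"
    using P assms by (auto simp: assumption_P_def d_def)
  also have "norm ((2 * Lf) *\<^sub>R (x - w)) = 2 * Lf * d" using pos by (simp add: d_def)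
  also have "norm (transpose M *v (\<beta> *\<^sub>R (g x - g w))) \<le> JAmax * (\<beta> * norm (g x - g w))"
    using norm_transpose_M_mult[of "\<beta> *\<^sub>R (g x - g w)"] assms by simp
  also have "\<dots> \<le> JAmax * (\<beta> * (2 powr (1 - \<nu>) * norm (A x - A w) powr \<nu>))"
    unfolding g_def using pos assms by (intro mult_left_mono norm_powr_gradient_holder \<nu>) auto
  also have "\<dots> \<le> JAmax * (\<beta> * (2 powr (1 - \<nu>) * (JAmax * d) powr \<nu>))"
    unfolding Aw d_def using pos assms \<nu>
    by (intro mult_left_mono powr_mono2 norm_M_mult) auto
  also have "\<dots> = \<beta> * (2 powr (1 - \<nu>) * JAmax powr (1 + \<nu>)) * (1 * d powr \<nu>)"
    using pos by (simp add: powr_mult powr_add)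
  also have "\<dots> \<le> \<beta> * (2 powr (1 - \<nu>) * JAmax powr (1 + \<nu>)) * (m * d powr \<nu>)"
    using assms by (intro mult_left_mono mult_right_mono) (auto simp: m_def)
  also have "Lf * d + 2 * Lf * d = 3 * Lf * d" by simp
  also have "\<dots> \<le> 3 * Lf * (m * d powr \<nu>)" using dm pos by (intro mult_left_mono) auto
  finally show ?thesis unfolding prox_holder_eq by (simp add: d_def m_def algebra_simps)
qed

lemma prox_upper_holder:
  fixes y :: "real^'m"
  assumes "x \<in> X" "w \<in> X" "\<beta> \<ge> 0"
  defines "F \<equiv> \<lambda>c. prox_objective (psi \<nu> f A \<beta> y) Lf c"
  shows "F c w \<le> F c x + gradient (F c) x \<bullet> (w - x) + prox_holder \<beta> / (1 + \<nu>) * norm (w - x) powr (1 + \<nu>)"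
proof (rule holder_gradient_upper_bound[OF X(2) assms(1,2) \<nu>(1)])
  fix u
  show "GDERIV (F c) u :> gradient (F c) u"
    unfolding F_def gradient_prox_psi by (rule GDERIV_prox_psi)
  assume "u \<in> X"
  then show "norm (gradient (F c) u - gradient (F c) x) \<le> prox_holder \<beta> * norm (u - x) powr \<nu>"
    unfolding F_def by (intro prox_gradient_holder assms)
qed

section \<open>Accuracy of one proximal update\<close>

definition prox_radius :: "real \<Rightarrow> real \<Rightarrow> real" where
  "prox_radius \<beta> e = (e / (12 * prox_holder \<beta>)) powr (1 / \<nu>)"

definition step_length :: "real \<Rightarrow> real \<Rightarrow> real" where
  "step_length \<beta> e = prox_radius \<beta> e powr (1 - \<nu>) / (2 * prox_holder \<beta>)"

lemma prox_radius_pos: "\<beta> \<ge> 0 \<Longrightarrow> e > 0 \<Longrightarrow> prox_radius \<beta> e > 0"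
  using prox_holder_pos[of \<beta>] by (simp add: prox_radius_def)

lemma step_length_pos: "\<beta> \<ge> 0 \<Longrightarrow> e > 0 \<Longrightarrow> step_length \<beta> e > 0"
  using prox_holder_pos[of \<beta>] prox_radius_pos[of \<beta> e] by (simp add: step_length_def)

lemma fgm_L_pos: "H > 0 \<Longrightarrow> \<delta> > 0 \<Longrightarrow> fgm_L H \<nu> \<delta> > 0"
  using \<nu> by (auto simp: fgm_L_def intro!: mult_pos_pos)

text \<open>The hypothesis \<open>gap\<close> is the bound of \<open>fgm_gap\<close> at the output
  index \<open>N - 1\<close>, with the distance to the starting point replaced by \<open>D\<close>,
  made small enough for the projected step.\<close>

lemma prox_update_stationary:
  assumes \<beta>: "\<beta> \<ge> 0" and e: "e > 0" and \<delta>: "\<delta> > 0" and c: "c \<in> X" and s: "s \<in> X"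
  defines "H \<equiv> prox_holder \<beta>"
  defines "L \<equiv> fgm_L H \<nu> \<delta>"
  assumes gap: "L / 2 * D\<^sup>2 / (1 + sqrt (Lf / L)) ^ (N - 1) + \<delta> * (1 + sqrt (L / Lf)) < e / 12 * prox_radius \<beta> e"
    and v: "fgm_then_projected_step X (prox_objective (psi \<nu> f A \<beta> y) Lf c) L Lf s N (step_length \<beta> e) v"
  shows "v \<in> X \<and> infdist (- gradient (prox_objective (psi \<nu> f A \<beta> y) Lf c) v) (normal_cone X v) \<le> e / 4"
proof -
  let ?F = "prox_objective (psi \<nu> f A \<beta> y) Lf c"
  let ?r = "prox_radius \<beta> e"
  have H: "H > 0" using prox_holder_pos[OF \<beta>] by (simp add: H_def)
  have L: "L > 0" using fgm_L_pos[OF H \<delta>] by (simp add: L_def)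
  have r: "?r > 0" by (rule prox_radius_pos[OF \<beta> e])
  \<comment> \<open>\<open>prox_radius\<close> is the solution of this equation: the residual
    \<open>3 * H * r powr \<nu>\<close> of the projected step becomes \<open>e / 4\<close>, and the
    gap it demands becomes \<open>e / 12\<close> times the radius.\<close>
  have Hr: "H * ?r powr \<nu> = e / 12"
    using H e \<nu> by (simp add: prox_radius_def powr_powr H_def[symmetric])
  have Hr': "H * ?r powr (1 + \<nu>) = e / 12 * ?r"
    using Hr r by (simp add: powr_add mult_ac)
  obtain \<alpha> x y' z where run: "fgm_run X ?F L Lf s \<alpha> x y' z"
    and v_eq: "v = closest_point X (y' (N - 1) - step_length \<beta> e *\<^sub>R gradient ?F (y' (N - 1)))"
    using v unfolding fgm_then_projected_step_def by blast
  have lower: "?F u + gradient ?F u \<bullet> (w - u) + Lf / 2 * (norm (w - u))\<^sup>2 \<le> ?F w" if "u \<in> X" "w \<in> X" for u w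
    by (rule prox_psi_lower[OF that \<beta>])
  have upper: "?F w \<le> ?F u + gradient ?F u \<bullet> (w - u) + L / 2 * (norm (w - u))\<^sup>2 + \<delta>" if "u \<in> X" "w \<in> X" for u w
    using prox_upper_holder[OF that \<beta>, of y c]
      holder_to_quadratic[OF \<nu> H \<delta> norm_ge_zero[of "w - u"]] by (simp add: H_def L_def)
  have gap': "?F (y' k) \<le> ?F w + L / 2 * (norm (w - s))\<^sup>2 / (1 + sqrt (Lf / L)) ^ k + \<delta> * (1 + sqrt (L / Lf))"
    if "w \<in> X" for w k
    by (rule fgm_gap(2)[OF X(2) s L pos(2) less_imp_le[OF \<delta>] run lower upper that])
  show ?thesis
  proof (intro conjI)
    note step = projected_gradient_step[where G = "gradient ?F" and F = ?F and y = "y' (N - 1)",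
        OF X(2,4) _ \<nu> H r v_eq[unfolded step_length_def H_def[symmetric]]]
    have yX: "y' (N - 1) \<in> X" by (rule fgm_gap(1)[OF X(2) s L pos(2) less_imp_le[OF \<delta>] run lower upper s])
    have gap'': "?F (y' (N - 1)) - ?F u < H * ?r powr (1 + \<nu>)" if u: "u \<in> X" for u
    proof -
      have "(norm (u - s))\<^sup>2 \<le> D\<^sup>2" using norm_diff_le[OF u s] by (intro power_mono) auto
      then have "L / 2 * (norm (u - s))\<^sup>2 / (1 + sqrt (Lf / L)) ^ (N - 1) \<le> L / 2 * D\<^sup>2 / (1 + sqrt (Lf / L)) ^ (N - 1)"
        using L pos by (intro divide_right_mono mult_left_mono) auto
      then show ?thesis using gap'[OF u, of "N - 1"] gap unfolding Hr' by linarith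
    qed
    have up: "?F u \<le> ?F (y' (N - 1)) + gradient ?F (y' (N - 1)) \<bullet> (u - y' (N - 1))
        + H / (1 + \<nu>) * norm (u - y' (N - 1)) powr (1 + \<nu>)" if "u \<in> X" for u
      unfolding H_def by (rule prox_upper_holder[OF yX that \<beta>])
    have hol: "norm (gradient ?F u - gradient ?F (y' (N - 1))) \<le> H * norm (u - y' (N - 1)) powr \<nu>" if "u \<in> X" for u
      unfolding H_def by (rule prox_gradient_holder[OF that yX \<beta>])
    show "v \<in> X" by (rule step(1)[OF yX up hol gap''])
    have "infdist (- gradient ?F v) (normal_cone X v) \<le> 3 * H * ?r powr \<nu>"
      by (rule step(2)[OF yX up hol gap''])
    also have "3 * H * ?r powr \<nu> = 3 * (H * ?r powr \<nu>)" by simp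
    also have "\<dots> = e / 4" unfolding Hr by simp
    finally show "infdist (- gradient ?F v) (normal_cone X v) \<le> e / 4" .
  qed
qed

lemma fgm_then_projected_step_exists:
  assumes "\<rho> > 0" "L > 0" "N \<ge> 1"
  shows "\<exists>v. fgm_then_projected_step X F L \<rho> s N \<gamma> v"
  using fgm_run_exists[OF X(3,1) assms(2,1), of F s] assms(3) unfolding fgm_then_projected_step_def by blast

text \<open>Scaling the normal vector by \<open>\<beta> * norm (A x) powr (\<nu> - 1)\<close> isolates the feasibility
  residual controlled by the regularity condition.\<close>

lemma feasibility_bound:
  assumes x: "x \<in> X" and \<beta>: "\<beta> > 0" and e: "e \<ge> 0"
    and stat: "infdist (- gradient (psi \<nu> f A \<beta> y) x) (normal_cone X x) \<le> e"
    and reg: "R * norm (A x) \<le> infdist (- (transpose M *v A x)) (normal_cone X x)"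
  shows "R * (\<beta> * norm (A x) powr \<nu>) \<le> e + gfmax + JAmax * norm y"
proof (cases "A x = 0")
  case True
  then show ?thesis using e pos by simp
next
  case False
  define \<kappa> where "\<kappa> = \<beta> * norm (A x) powr (\<nu> - 1)"
  have \<kappa>: "\<kappa> > 0" using \<beta> False by (simp add: \<kappa>_def)
  obtain n where n: "n \<in> normal_cone X x" "norm (- psi_gradient \<beta> y x - n) \<le> e"
    using infdist_normal_coneE[OF x stat] unfolding gradient_psi .
  define p where "p = - psi_gradient \<beta> y x - n"
  have n': "(1 / \<kappa>) *\<^sub>R n \<in> normal_cone X x"
    using n(1) \<kappa> by (auto simp: normal_cone_def divide_nonpos_pos split: if_splits)
  have "\<kappa> *\<^sub>R (transpose M *v A x) = psi_gradient \<beta> y x - gradient f x - transpose M *v y"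
    by (simp add: psi_gradient_def \<kappa>_def matrix_vector_right_distrib matrix_vector_mult_scaleR)
  then have eq: "\<kappa> *\<^sub>R (- (transpose M *v A x) - (1 / \<kappa>) *\<^sub>R n) = p + gradient f x + transpose M *v y"
    using \<kappa> by (simp add: p_def algebra_simps)
  have "\<kappa> * norm (- (transpose M *v A x) - (1 / \<kappa>) *\<^sub>R n) = norm (p + gradient f x + transpose M *v y)"
    unfolding eq[symmetric] using \<kappa> by simp
  also have "\<dots> \<le> norm p + norm (gradient f x) + norm (transpose M *v y)"
    by (rule norm_add3_le)
  also have "\<dots> \<le> e + gfmax + JAmax * norm y"
    using n(2) P x norm_transpose_M_mult[of y] by (intro add_mono) (auto simp: p_def assumption_P_def)
  finally have 1: "\<kappa> * norm (- (transpose M *v A x) - (1 / \<kappa>) *\<^sub>R n) \<le> e + gfmax + JAmax * norm y" .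
  have "R * norm (A x) \<le> norm (- (transpose M *v A x) - (1 / \<kappa>) *\<^sub>R n)"
    using reg infdist_le[OF n', of "- (transpose M *v A x)"] by (simp add: dist_norm)
  then have "\<kappa> * (R * norm (A x)) \<le> \<kappa> * norm (- (transpose M *v A x) - (1 / \<kappa>) *\<^sub>R n)"
    using \<kappa> by (intro mult_left_mono) auto
  moreover have "\<kappa> * (R * norm (A x)) = R * (\<beta> * norm (A x) powr \<nu>)"
    using powr_mult_base[of "norm (A x)" "\<nu> - 1"] by (simp add: \<kappa>_def mult_ac)
  ultimately show ?thesis using 1 by simp
qed

text \<open>The Lagrange multiplier is \<open>y\<close> plus \<open>\<beta>\<close> times the
  gradient of \<open>phi \<nu>\<close> at \<open>A x\<close>; with it the gradient of the Lagrangian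
  is that of \<open>psi\<close>.\<close>

lemma stationary_pointI:
  assumes x: "x \<in> X" and stat: "infdist (- gradient (psi \<nu> f A \<beta> y) x) (normal_cone X x) \<le> eps_phi"
    and feas: "norm (A x) \<le> eps_A"
  shows "stationary_point X f A eps_phi eps_A x"
  unfolding stationary_point_def jacobian_eq
proof (intro conjI exI x feas)
  show "infdist (- gradient f x - transpose M *v (y + \<beta> *\<^sub>R (norm (A x) powr (\<nu> - 1) *\<^sub>R A x)))
      (normal_cone X x) \<le> eps_phi"
    using stat by (simp add: gradient_psi psi_gradient_def)
qed

section \<open>Bounds on the augmented Lagrangian\<close>

lemma bounded_f: "\<exists>B. \<forall>x\<in>X. \<bar>f x\<bar> \<le> B"
proof -
  have "continuous_on X f"
    using f_diff by (intro continuous_at_imp_continuous_on) (simp add: differentiable_imp_continuous_within)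
  then have "bounded (f ` X)" using X by (intro compact_imp_bounded compact_continuous_image)
  then show ?thesis by (auto simp: bounded_iff)
qed

lemma psi_ge:
  assumes "\<And>x. x \<in> X \<Longrightarrow> \<bar>f x\<bar> \<le> B" "w \<in> X" "\<beta> \<ge> 0"
  shows "- B - Amax * norm y \<le> psi \<nu> f A \<beta> y w"
proof -
  have "\<bar>A w \<bullet> y\<bar> \<le> norm (A w) * norm y" by (rule Cauchy_Schwarz_ineq2)
  also have "\<dots> \<le> Amax * norm y" using P assms by (intro mult_right_mono) (auto simp: assumption_P_def)
  finally have "- (Amax * norm y) \<le> A w \<bullet> y" by simp
  moreover have "0 \<le> \<beta> / (\<nu> + 1) * norm (A w) powr (\<nu> + 1)" using \<nu> assms by simp
  ultimately show ?thesis using assms(1)[OF assms(2)] by (simp add: psi_def)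
qed

text \<open>One factor \<open>norm (A w)\<close> of the penalty is bounded by \<open>Amax\<close>.
  What remains is \<open>\<beta> * norm (A w) powr \<nu>\<close>, the quantity that stays bounded
  along the outer iterates.\<close>

lemma psi_le:
  assumes "\<And>x. x \<in> X \<Longrightarrow> \<bar>f x\<bar> \<le> B" "w \<in> X" "\<beta> \<ge> 0"
  shows "psi \<nu> f A \<beta> y w \<le> B + Amax * norm y + Amax * (\<beta> * norm (A w) powr \<nu>)"
proof -
  have Aw: "norm (A w) \<le> Amax" using P assms by (auto simp: assumption_P_def)
  have "A w \<bullet> y \<le> norm (A w) * norm y" by (rule norm_cauchy_schwarz)
  also have "\<dots> \<le> Amax * norm y" using Aw by (intro mult_right_mono) auto
  finally have 1: "A w \<bullet> y \<le> Amax * norm y" .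
  have "\<beta> / (\<nu> + 1) * norm (A w) powr (\<nu> + 1) \<le> \<beta> * norm (A w) powr (\<nu> + 1)"
    using \<nu> assms by (intro mult_right_mono) (auto simp: divide_le_eq mult_le_cancel_left1)
  also have "\<dots> = norm (A w) * (\<beta> * norm (A w) powr \<nu>)"
    using powr_mult_base[of "norm (A w)" \<nu>] by (simp add: add.commute mult_ac)
  also have "\<dots> \<le> Amax * (\<beta> * norm (A w) powr \<nu>)" using Aw assms by (intro mult_right_mono) auto
  finally show ?thesis using 1 assms(1)[OF assms(2)] by (simp add: psi_def)
qed

end

section \<open>Iteration counts and parameters\<close>

text \<open>Separate powers of \<open>H\<close> and \<open>\<delta>\<close> suit the later choice of
  \<open>\<delta>\<close> as a power of \<open>b\<close>. For \<open>\<nu> < 1\<close> only the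
  factor \<open>(k / 2) powr k\<close> is dropped.\<close>

lemma fgm_L_le:
  assumes \<nu>: "0 < \<nu>" "\<nu> \<le> 1" and pos: "H > 0" "\<delta> > 0"
  shows "fgm_L H \<nu> \<delta> \<le> H powr (2 / (1 + \<nu>)) * \<delta> powr (- ((1 - \<nu>) / (1 + \<nu>)))"
proof (cases "\<nu> = 1")
  case True
  then show ?thesis using pos by (simp add: fgm_L_def)
next
  case False
  define k where "k = (1 - \<nu>) / (1 + \<nu>)"
  have k: "0 < k" "k \<le> 1" "1 + k = 2 / (1 + \<nu>)" using \<nu> False by (auto simp: k_def field_simps)
  have "H / (2 * \<delta>) * k \<le> H / \<delta>"
    using pos k by (simp add: field_simps)
  then have "(H / (2 * \<delta>) * k) powr k \<le> (H / \<delta>) powr k"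
    using pos k by (intro powr_mono2) auto
  then have "fgm_L H \<nu> \<delta> \<le> H * (H / \<delta>) powr k"
    using False pos unfolding fgm_L_def by (simp add: k_def)
  also have "\<dots> = H powr (1 + k) * \<delta> powr (- k)"
    using pos by (simp add: powr_add powr_divide powr_minus_divide)
  finally show ?thesis by (simp add: k(3) flip: k_def)
qed

text \<open>This is \<open>ln x \<le> x - 1\<close> at \<open>1 / (1 + q)\<close>. It gives
  \<open>W \<le> (1 + q) ^ n\<close> as soon as n is at least \<open>(1 + 1 / q) * ln W\<close>, for
  small and large \<open>q\<close> alike.\<close>

lemma ln_one_plus_ge: "ln (1 + q) \<ge> q / (1 + q)" if "q > 0" for q :: real
proof -
  have "ln (1 / (1 + q)) \<le> 1 / (1 + q) - 1" using that by (intro ln_le_minus_one) auto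
  moreover have "1 / (1 + q) - 1 = - (q / (1 + q))" using that by (simp add: field_simps)
  ultimately show ?thesis using that by (simp add: ln_div)
qed

text \<open>With \<open>\<delta> = d\<^sub>0 b powr (-e)\<close> the conditioning \<open>sqrt (L / \<rho>)\<close> grows like \<open>b powr p\<close>, where
  \<open>p - e = - a\<close>; so the accumulated oracle error \<open>\<delta> sqrt (L / \<rho>)\<close> meets the target \<open>b powr (- a)\<close>.\<close>

lemma fgm_parameters:
  fixes \<nu> \<rho> D h \<eta> a :: real
  assumes \<nu>: "0 < \<nu>" "\<nu> \<le> 1" and pos: "\<rho> > 0" "D > 0" "h > 0" "\<eta> > 0" "a > 0"
  defines "p \<equiv> (1 - \<nu>) / (1 + 3 * \<nu>) * a + 2 / (1 + 3 * \<nu>)"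
  shows "\<exists>(\<delta> :: real \<Rightarrow> real) (N :: real \<Rightarrow> nat) C. \<forall>b\<ge>1.
    \<delta> b > 0 \<and> N b \<ge> 1 \<and> real (N b) \<le> C * b powr p * (1 + ln b) \<and>
    (\<forall>H. 0 < H \<and> H \<le> h * b \<longrightarrow>
      (let L = fgm_L H \<nu> (\<delta> b) in
        L / 2 * D\<^sup>2 / (1 + sqrt (\<rho> / L)) ^ (N b - 1) + \<delta> b * (1 + sqrt (L / \<rho>)) < \<eta> * b powr (- a)))"
proof -
  define \<kappa> where "\<kappa> = (1 - \<nu>) / (1 + \<nu>)"
  \<comment> \<open>\<open>e\<close> and \<open>p\<close> solve the two equations
    \<open>p - e = - a\<close> and \<open>p = 1 / (1 + \<nu>) + e * \<kappa> / 2\<close>; the second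
    is the growth of \<open>sqrt (L / \<rho>)\<close> according to \<open>fgm_L_le\<close>.\<close>
  define e where "e = (2 * (1 + \<nu>) * a + 2) / (1 + 3 * \<nu>)"
  have \<nu>3: "1 + 3 * \<nu> > 0" "1 + \<nu> > 0" using \<nu> by auto
  have \<kappa>: "0 \<le> \<kappa>" "\<kappa> < 1" using \<nu> by (auto simp: \<kappa>_def)
  have p0: "p > 0" unfolding p_def using \<nu> \<nu>3 pos by (intro add_nonneg_pos) auto
  have pe: "p - e = - a"
  proof -
    have "p = ((1 - \<nu>) * a + 2) / (1 + 3 * \<nu>)" by (simp add: p_def add_divide_distrib)
    then have "p - e = (- a * (1 + 3 * \<nu>)) / (1 + 3 * \<nu>)"
      unfolding e_def by (simp only: diff_divide_distrib[symmetric]) (simp add: algebra_simps)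
    then show ?thesis using \<nu>3 by simp
  qed
  have p_eq: "1 / (1 + \<nu>) + e * \<kappa> / 2 = p"
  proof -
    have "e * \<kappa> / 2 = (1 - \<nu>) * a / (1 + 3 * \<nu>) + (1 - \<nu>) / ((1 + 3 * \<nu>) * (1 + \<nu>))"
    proof -
      have "e * \<kappa> / 2 = ((1 + \<nu>) * ((1 - \<nu>) * a) + (1 - \<nu>)) / ((1 + 3 * \<nu>) * (1 + \<nu>))"
      proof -
        define E where "E = ((1 + \<nu>) * a + 1) / (1 + 3 * \<nu>)"
        have "e = 2 * E" by (simp add: e_def E_def)
        then have "e * \<kappa> / 2 = E * \<kappa>" by simp
        then show ?thesis unfolding E_def \<kappa>_def times_divide_times_eq by (simp add: algebra_simps)
      qed
      also have "\<dots> = (1 + \<nu>) * ((1 - \<nu>) * a) / ((1 + 3 * \<nu>) * (1 + \<nu>)) + (1 - \<nu>) / ((1 + 3 * \<nu>) * (1 + \<nu>))"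
        by (rule add_divide_distrib)
      finally show ?thesis using \<nu>3 by simp
    qed
    moreover have "1 / (1 + \<nu>) + (1 - \<nu>) / ((1 + 3 * \<nu>) * (1 + \<nu>)) = 2 / (1 + 3 * \<nu>)"
    proof -
      have eq: "1 / (1 + \<nu>) = (1 + 3 * \<nu>) / ((1 + 3 * \<nu>) * (1 + \<nu>))" using \<nu>3 by simp
      have "1 / (1 + \<nu>) + (1 - \<nu>) / ((1 + 3 * \<nu>) * (1 + \<nu>)) = (2 * (1 + \<nu>)) / ((1 + 3 * \<nu>) * (1 + \<nu>))"
        unfolding eq add_divide_distrib[symmetric] by (simp add: algebra_simps)
      also have "\<dots> = 2 / (1 + 3 * \<nu>)"
        by (rule mult_divide_mult_cancel_right) (use \<nu>3 in simp)
      finally show ?thesis .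
    qed
    ultimately show ?thesis unfolding p_def times_divide_eq_left by linarith
  qed
  define c1 where "c1 = h powr (1 / (1 + \<nu>)) / sqrt \<rho>"
  have c1: "c1 > 0" using pos by (simp add: c1_def)
  define \<theta> where "\<theta> = 1 - \<kappa> / 2"
  have \<theta>: "0 < \<theta>" "\<theta> \<le> 1" using \<kappa> by (auto simp: \<theta>_def)
  \<comment> \<open>The power makes \<open>(1 + c1) * d0 powr \<theta>\<close> at most
    \<open>\<eta> / 2\<close>; the cap 1 gives \<open>d0 \<le> d0 powr \<theta>\<close>.\<close>
  define d0 where "d0 = min 1 ((\<eta> / (2 * (1 + c1))) powr (1 / \<theta>))"
  have d0: "0 < d0" "d0 \<le> 1" using pos c1 by (auto simp: d0_def)
  have d0\<theta>: "d0 powr \<theta> \<le> \<eta> / (2 * (1 + c1))"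
  proof -
    have "d0 powr \<theta> \<le> ((\<eta> / (2 * (1 + c1))) powr (1 / \<theta>)) powr \<theta>"
      using d0 \<theta> by (intro powr_mono2) (auto simp: d0_def)
    then show ?thesis using \<theta> pos c1 by (simp add: powr_powr)
  qed
  define c2 where "c2 = c1 * d0 powr (- (\<kappa> / 2))"
  have c2: "c2 > 0" using c1 d0 by (simp add: c2_def)
  \<comment> \<open>The summand 1 makes the final comparison with \<open>\<eta>\<close> strict and
    keeps \<open>ln (W b)\<close> nonnegative.\<close>
  define K where "K = 1 + \<rho> * c2\<^sup>2 * D\<^sup>2 / \<eta>"
  have K: "K \<ge> 1" using pos by (simp add: K_def)
  define \<delta> where "\<delta> b = d0 * b powr (- e)" for b
  define W where "W b = K * b powr (2 * p + a)" for b
  \<comment> \<open>The geometric rate has to reach \<open>W b\<close>, for which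
    \<open>(1 + 1 / q) * ln (W b)\<close> steps suffice, where \<open>1 / q = c2 * b powr p\<close>.
    The extra 1 offsets the exponent \<open>N b - 1\<close>.\<close>
  define N where "N b = 1 + nat \<lceil>(1 + c2) * b powr p * ln (W b)\<rceil>" for b
  define C where "C = 2 + (1 + c2) * (ln K + (2 * p + a))"
  have lnW: "ln (W b) = ln K + (2 * p + a) * ln b" if "b \<ge> 1" for b
    using K that by (simp add: W_def ln_mult)
  have W1: "W b \<ge> 1" if "b \<ge> 1" for b
    using mult_mono[OF K ge_one_powr_ge_zero[of b "2 * p + a"]] that p0 pos K by (simp add: W_def)
  have N_bound: "real (N b) \<le> C * b powr p * (1 + ln b)" if b: "b \<ge> 1" for b
  proof -
    have lb: "0 \<le> ln b" and bp: "1 \<le> b powr p" using b p0 by (auto intro: ge_one_powr_ge_zero)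
    have prod: "1 \<le> b powr p * (1 + ln b)" using mult_mono[OF bp, of 1 "1 + ln b"] lb by simp
    have "0 \<le> (1 + c2) * b powr p * ln (W b)" using c2 W1[OF b] by simp
    then have "real (N b) \<le> 2 + (1 + c2) * b powr p * ln (W b)"
      unfolding N_def by linarith
    also have "\<dots> = 2 + (1 + c2) * b powr p * (ln K + (2 * p + a) * ln b)" by (simp add: lnW b)
    also have "\<dots> \<le> 2 * (b powr p * (1 + ln b)) + (1 + c2) * b powr p * ((ln K + (2 * p + a)) * (1 + ln b))"
    proof (intro add_mono mult_left_mono)
      have "0 \<le> ln K * ln b" using K lb by simp
      then show "ln K + (2 * p + a) * ln b \<le> (ln K + (2 * p + a)) * (1 + ln b)"
        using p0 pos by (simp add: algebra_simps)
    qed (use prod c2 in auto)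
    also have "\<dots> = C * b powr p * (1 + ln b)" by (simp add: C_def algebra_simps)
    finally show ?thesis .
  qed
  have gap: "L / 2 * D\<^sup>2 / (1 + sqrt (\<rho> / L)) ^ (N b - 1) + \<delta> b * (1 + sqrt (L / \<rho>)) < \<eta> * b powr (- a)"
    if b: "b \<ge> 1" and H: "0 < H" "H \<le> h * b" and L_def: "L = fgm_L H \<nu> (\<delta> b)" for b H L
  proof -
    have b0: "b > 0" using b by simp
    have \<delta>: "\<delta> b > 0" using d0 b by (simp add: \<delta>_def)
    have L: "L > 0" using \<nu> H \<delta> by (auto simp: L_def fgm_L_def intro!: mult_pos_pos)
    have "L \<le> H powr (2 / (1 + \<nu>)) * \<delta> b powr (- \<kappa>)"
      unfolding L_def \<kappa>_def by (rule fgm_L_le[OF \<nu> H(1) \<delta>])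
    also have "\<dots> \<le> (h * b) powr (2 / (1 + \<nu>)) * \<delta> b powr (- \<kappa>)"
      using H \<nu>3 by (intro mult_right_mono powr_mono2) auto
    also have "\<dots> = (h powr (1 / (1 + \<nu>)) * b powr (1 / (1 + \<nu>)) * \<delta> b powr (- (\<kappa> / 2)))\<^sup>2"
    proof -
      have sq: "(x powr t)\<^sup>2 = x powr (2 * t)" for x t :: real
        by (simp add: power2_eq_square flip: powr_add)
      show ?thesis unfolding power_mult_distrib sq by (simp add: powr_mult)
    qed
    also have "h powr (1 / (1 + \<nu>)) * b powr (1 / (1 + \<nu>)) * \<delta> b powr (- (\<kappa> / 2)) = sqrt \<rho> * (c2 * b powr p)"
    proof -
      have "\<delta> b powr (- (\<kappa> / 2)) = d0 powr (- (\<kappa> / 2)) * b powr (e * \<kappa> / 2)"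
        using d0 b0 by (simp add: \<delta>_def powr_mult powr_powr)
      then show ?thesis
        unfolding p_eq[symmetric] powr_add using pos by (simp add: c2_def c1_def)
    qed
    also have "(sqrt \<rho> * (c2 * b powr p))\<^sup>2 = \<rho> * (c2 * b powr p)\<^sup>2"
      using pos by (simp add: power_mult_distrib)
    finally have L_le: "L \<le> \<rho> * (c2 * b powr p)\<^sup>2" .
    define Q where "Q = sqrt (L / \<rho>)"
    have Q0: "Q > 0" using L pos by (simp add: Q_def)
    have Q: "Q \<le> c2 * b powr p"
    proof -
      have "L / \<rho> \<le> (c2 * b powr p)\<^sup>2" using L_le pos by (simp add: divide_le_eq mult.commute)
      then show ?thesis unfolding Q_def using c2 by (intro real_le_lsqrt) auto
    qed
    have "b powr p \<ge> 1" using b p0 by (intro ge_one_powr_ge_zero) auto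
    have \<delta>Q: "\<delta> b * (1 + Q) \<le> \<eta> / 2 * b powr (- a)"
    proof -
      have "\<delta> b * (1 + Q) \<le> \<delta> b * (1 + c2 * b powr p)"
        using \<delta> Q by (intro mult_left_mono) auto
      also have "\<dots> = d0 * b powr (- e) + c1 * (d0 * d0 powr (- (\<kappa> / 2))) * (b powr p * b powr (- e))"
        by (simp add: \<delta>_def c2_def algebra_simps)
      also have "b powr p * b powr (- e) = b powr (- a)"
        using pe by (simp flip: powr_add)
      also have "d0 * d0 powr (- (\<kappa> / 2)) = d0 powr \<theta>"
        using d0 by (simp add: powr_mult_base \<theta>_def)
      also have "d0 * b powr (- e) \<le> d0 powr \<theta> * b powr (- a)"
      proof (intro mult_mono)
        show "d0 \<le> d0 powr \<theta>" using powr_mono'[OF \<theta>(2), of d0] d0 by simp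
        show "b powr (- e) \<le> b powr (- a)" using b pe p0 by (intro powr_mono) auto
      qed auto
      finally have "\<delta> b * (1 + Q) \<le> (1 + c1) * d0 powr \<theta> * b powr (- a)" by (simp add: algebra_simps)
      also have "\<dots> \<le> (1 + c1) * (\<eta> / (2 * (1 + c1))) * b powr (- a)"
        using d0\<theta> c1 by (intro mult_right_mono mult_left_mono) auto
      also have "(1 + c1) * (\<eta> / (2 * (1 + c1))) = \<eta> / 2"
      proof -
        have "u * (\<eta> / (2 * u)) = \<eta> / 2" if "u \<noteq> 0" for u using that by simp
        then show ?thesis using c1 by (metis add_pos_pos less_irrefl zero_less_one)
      qed
      finally show ?thesis .
    qed
    \<comment> \<open>A lower bound for the rate \<open>sqrt (\<rho> / L)\<close> that no longer
      depends on \<open>H\<close>.\<close>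
    define q where "q = 1 / (c2 * b powr p)"
    have q0: "q > 0" using c2 b0 by (simp add: q_def)
    have q_le: "q \<le> sqrt (\<rho> / L)"
    proof -
      have "sqrt (\<rho> / L) = 1 / Q" by (simp add: Q_def real_sqrt_divide)
      then show ?thesis unfolding q_def using Q Q0 c2 b0 by (simp add: frac_le)
    qed
    have W_le: "W b \<le> (1 + sqrt (\<rho> / L)) ^ (N b - 1)"
    proof -
      define n where "n = N b - 1"
      have n: "(1 + c2) * b powr p * ln (W b) \<le> real n" unfolding n_def N_def by linarith
      have "q / (1 + q) = 1 / (c2 * b powr p + 1)"
        unfolding q_def using c2 b0 by (simp add: field_simps)
      moreover have "c2 * b powr p + 1 \<le> (1 + c2) * b powr p"
        using \<open>b powr p \<ge> 1\<close> by (simp add: algebra_simps)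
      ultimately have "1 / ((1 + c2) * b powr p) \<le> q / (1 + q)"
        using c2 b0 by (simp add: frac_le add_pos_pos)
      also have "\<dots> \<le> ln (1 + q)" by (rule ln_one_plus_ge[OF q0])
      finally have "1 / ((1 + c2) * b powr p) \<le> ln (1 + q)" .
      then have "real n * (1 / ((1 + c2) * b powr p)) \<le> real n * ln (1 + q)"
        by (intro mult_left_mono) auto
      moreover have "ln (W b) \<le> real n * (1 / ((1 + c2) * b powr p))"
        using n c2 b0 by (simp add: pos_le_divide_eq mult.commute)
      ultimately have "ln (W b) \<le> ln ((1 + q) ^ n)" using q0 by (simp add: ln_realpow)
      then have "W b \<le> (1 + q) ^ n" using W1[OF b] q0 by simp
      also have "\<dots> \<le> (1 + sqrt (\<rho> / L)) ^ n" using q_le q0 by (intro power_mono) auto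
      finally show ?thesis by (simp add: n_def)
    qed
    have "L / 2 * D\<^sup>2 / (1 + sqrt (\<rho> / L)) ^ (N b - 1) \<le> L / 2 * D\<^sup>2 / W b"
    proof -
      have "0 < W b" "0 < (1 + sqrt (\<rho> / L)) ^ (N b - 1)" using W_le W1[OF b] by linarith+
      then show ?thesis using L by (intro divide_left_mono W_le mult_pos_pos) simp_all
    qed
    also have "\<dots> \<le> \<rho> * (c2 * b powr p)\<^sup>2 / 2 * D\<^sup>2 / W b"
      using L_le W1[OF b] by (intro divide_right_mono mult_right_mono) auto
    also have "\<dots> = (\<rho> * c2\<^sup>2 * D\<^sup>2 / K) / 2 * b powr (- a)"
    proof -
      have "b powr (2 * p + a) = (b powr p)\<^sup>2 * b powr a"
        by (simp add: power2_eq_square flip: powr_add)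
      then have "W b = K * (b powr p)\<^sup>2 * b powr a" by (simp add: W_def)
      moreover have "\<rho> * (c2 * u)\<^sup>2 / 2 * D\<^sup>2 / (K * u\<^sup>2 * v) = \<rho> * c2\<^sup>2 * D\<^sup>2 / K / 2 * (1 / v)"
        if "u > 0" "v > 0" for u v
        using that K by (simp add: power_mult_distrib)
      ultimately show ?thesis using b0 unfolding powr_minus_divide by simp
    qed
    also have "\<dots> < \<eta> / 2 * b powr (- a)"
    proof -
      have "\<rho> * c2\<^sup>2 * D\<^sup>2 < \<eta> * K" using pos by (simp add: K_def field_simps)
      then have "\<rho> * c2\<^sup>2 * D\<^sup>2 / K < \<eta>" using K by (simp add: divide_less_eq)
      then show ?thesis using b0 by (intro mult_strict_right_mono) auto
    qed
    finally have "L / 2 * D\<^sup>2 / (1 + sqrt (\<rho> / L)) ^ (N b - 1) < \<eta> / 2 * b powr (- a)" .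
    then show ?thesis using \<delta>Q unfolding Q_def by simp
  qed
  show ?thesis
  proof (rule exI[of _ \<delta>], rule exI[of _ N], rule exI[of _ C], intro allI impI conjI)
    fix b :: real assume b: "1 \<le> b"
    show "\<delta> b > 0" using d0 b by (simp add: \<delta>_def)
    show "N b \<ge> 1" by (simp add: N_def)
    show "real (N b) \<le> C * b powr p * (1 + ln b)" by (rule N_bound[OF b])
  next
    fix b H :: real assume "1 \<le> b" "0 < H \<and> H \<le> h * b"
    then show "let L = fgm_L H \<nu> (\<delta> b) in
        L / 2 * D\<^sup>2 / (1 + sqrt (\<rho> / L)) ^ (N b - 1) + \<delta> b * (1 + sqrt (L / \<rho>)) < \<eta> * b powr (- a)"
      unfolding Let_def using gap by blast
  qed
qed

text \<open>The argument of \<open>G\<close> is at most a constant times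
  \<open>\<epsilon> powr (- t)\<close>, so each of its two logarithmic factors is at most a multiple
  of \<open>\<bar>ln \<epsilon>\<bar>\<close>; this explains the square.\<close>

lemma soft_O_geometric_cost:
  fixes C \<omega> p c t :: real
  assumes "C \<ge> 0" "\<omega> > 1" "p \<ge> 0" "t > 0"
  defines "G \<equiv> \<lambda>b. C * (1 + ln b / ln \<omega>) * (1 + ln b) * b powr p"
  shows "(\<lambda>\<epsilon>. G (\<omega> * max 1 (c / \<epsilon> powr t))) \<in> soft_O (\<lambda>\<epsilon>. \<epsilon> powr (- (t * p)))"
proof -
  define c' where "c' = \<omega> * max 1 c"
  have c': "c' \<ge> 1" using mult_mono[of 1 \<omega> 1 "max 1 c"] assms by (simp add: c'_def)
  define m where "m = 1 + ln c' + t"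
  have m: "m \<ge> 1" using c' assms by (simp add: m_def)
  have l\<omega>: "ln \<omega> > 0" using assms by simp
  have bound: "\<bar>G (\<omega> * max 1 (c / \<epsilon> powr t))\<bar>
      \<le> C * (1 + m / ln \<omega>) * m * c' powr p * \<bar>\<epsilon> powr (- (t * p)) * \<bar>ln \<epsilon>\<bar> ^ 2\<bar>"
    if \<epsilon>: "0 < \<epsilon>" "\<epsilon> < exp (- 1)" for \<epsilon>
  proof -
    define l where "l = \<bar>ln \<epsilon>\<bar>"
    have "ln \<epsilon> < ln (exp (- 1))" using \<epsilon> by (subst ln_less_cancel_iff) auto
    \<comment> \<open>Below \<open>exp (- 1)\<close> the logarithm has absolute value at least 1, so
      additive constants are absorbed in multiples of \<open>l\<close>.\<close>
    then have ln\<epsilon>: "ln \<epsilon> = - l" "l \<ge> 1" by (auto simp: l_def)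
    have "\<epsilon> < 1" using \<epsilon> by (smt (verit) exp_le_one_iff)
    define b where "b = \<omega> * max 1 (c / \<epsilon> powr t)"
    have b1: "b \<ge> 1" using mult_mono[of 1 \<omega> 1 "max 1 (c / \<epsilon> powr t)"] assms by (simp add: b_def)
    have "max 1 (c / \<epsilon> powr t) \<le> max 1 c / \<epsilon> powr t"
    proof -
      have "\<epsilon> powr t \<le> 1" using \<epsilon> \<open>\<epsilon> < 1\<close> assms by (intro powr_le1) auto
      then have "1 \<le> max 1 c / \<epsilon> powr t" using \<epsilon> by (simp add: le_divide_eq)
      moreover have "c / \<epsilon> powr t \<le> max 1 c / \<epsilon> powr t" by (intro divide_right_mono) auto
      ultimately show ?thesis by simp
    qed
    then have b_le: "b \<le> c' * \<epsilon> powr (- t)"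
      using assms by (simp add: b_def c'_def powr_minus divide_inverse mult.assoc)
    have "ln b \<le> ln (c' * \<epsilon> powr (- t))" using b_le b1 c' \<epsilon> by (subst ln_le_cancel_iff) auto
    also have "\<dots> = ln c' + t * l" using c' \<epsilon> ln\<epsilon> by (simp add: ln_mult)
    also have "\<dots> \<le> ln c' * l + t * l" using c' ln\<epsilon> by (simp add: mult_le_cancel_left1)
    finally have lnb: "ln b \<le> (m - 1) * l" by (simp add: m_def algebra_simps)
    have lnb0: "ln b \<ge> 0" using b1 by simp
    have lnb': "ln b \<le> m * l" using lnb ln\<epsilon> by (simp add: algebra_simps)
    have 1: "1 + ln b \<le> m * l" using lnb ln\<epsilon> by (simp add: algebra_simps)
    have "ln b / ln \<omega> \<le> m * l / ln \<omega>" using lnb' l\<omega> by (intro divide_right_mono) auto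
    then have 2: "1 + ln b / ln \<omega> \<le> (1 + m / ln \<omega>) * l" using ln\<epsilon> by (simp add: algebra_simps)
    have "b powr p \<le> (c' * \<epsilon> powr (- t)) powr p" using b_le b1 assms by (intro powr_mono2) auto
    also have "\<dots> = c' powr p * \<epsilon> powr (- (t * p))" by (simp add: powr_mult powr_powr)
    finally have 3: "b powr p \<le> c' powr p * \<epsilon> powr (- (t * p))" .
    have "G b \<le> C * ((1 + m / ln \<omega>) * l) * (m * l) * (c' powr p * \<epsilon> powr (- (t * p)))"
      unfolding G_def using assms 1 2 3 lnb0 l\<omega> m ln\<epsilon> by (intro mult_mono) auto
    moreover have "0 \<le> G b" unfolding G_def using assms lnb0 l\<omega> by (intro mult_nonneg_nonneg add_nonneg_nonneg) auto
    ultimately have "\<bar>G b\<bar> \<le> C * ((1 + m / ln \<omega>) * l) * (m * l) * (c' powr p * \<epsilon> powr (- (t * p)))" by simp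
    also have "\<dots> = C * (1 + m / ln \<omega>) * m * c' powr p * \<bar>\<epsilon> powr (- (t * p)) * \<bar>ln \<epsilon>\<bar> ^ 2\<bar>"
      by (simp add: l_def[symmetric] power2_eq_square abs_mult mult_ac)
    finally show ?thesis by (simp add: b_def)
  qed
  have "eventually (\<lambda>\<epsilon>::real. 0 < \<epsilon> \<and> \<epsilon> < exp (- 1)) (at_right 0)"
    using eventually_at_right_real[of 0 "exp (- 1)"] by simp
  then have "(\<lambda>\<epsilon>. G (\<omega> * max 1 (c / \<epsilon> powr t))) \<in> O[at_right 0](\<lambda>\<epsilon>. \<epsilon> powr (- (t * p)) * \<bar>ln \<epsilon>\<bar> ^ 2)"
    by (intro bigoI[where c = "C * (1 + m / ln \<omega>) * m * c' powr p"])
      (auto elim!: eventually_mono dest: bound)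
  then show ?thesis unfolding soft_O_def by blast
qed

text \<open>Up to a factor 2 the term is at most the increment of \<open>ln\<close> divided by the
  square of its later value. Replacing one of the two later values by the earlier one leaves a
  difference of reciprocals.\<close>

lemma inverse_ln_telescope:
  assumes "k \<ge> 1"
  shows "1 / (real (k + 1) * (ln (real (k + 2)))\<^sup>2) \<le> 2 * (1 / ln (real (k + 1)) - 1 / ln (real (k + 2)))"
proof -
  define l1 l2 where "l1 = ln (real (k + 1))" and "l2 = ln (real (k + 2))"
  have l: "0 < l1" "l1 \<le> l2" using assms by (auto simp: l1_def l2_def)
  have "ln (real (k + 1) / real (k + 2)) \<le> real (k + 1) / real (k + 2) - 1"
    by (intro ln_le_minus_one) auto
  then have d: "1 / real (k + 2) \<le> l2 - l1"
    by (simp add: l1_def l2_def ln_div field_simps)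
  have "1 / (real (k + 1) * l2\<^sup>2) \<le> 2 / real (k + 2) / l2\<^sup>2"
    using l by (simp add: frac_le divide_simps)
  also have "\<dots> = 2 * ((1 / real (k + 2)) / l2\<^sup>2)" by simp
  also have "\<dots> \<le> 2 * ((l2 - l1) / l2\<^sup>2)" using d by (intro mult_left_mono divide_right_mono) auto
  also have "\<dots> \<le> 2 * ((l2 - l1) / (l1 * l2))"
    using l by (intro mult_left_mono divide_left_mono) (auto simp: power2_eq_square)
  also have "(l2 - l1) / (l1 * l2) = 1 / l1 - 1 / l2" using l by (simp add: field_simps)
  finally show ?thesis by (simp add: l1_def l2_def)
qed

section \<open>Complexity of the complete method\<close>

text \<open>The rule \<open>s\<close> for the FGM starting points is arbitrary within
  \<open>X\<close>; the estimates bound the distance from the start by \<open>D\<close>.\<close>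

locale linear_power_alm_run = linear_power_alm X f A D Lf Amax JAmax gfmax \<nu>
  for X :: "(real^'n) set" and f :: "real^'n \<Rightarrow> real" and A :: "real^'n \<Rightarrow> real^'m"
    and D Lf Amax JAmax gfmax \<nu> :: real +
  fixes lam \<omega> \<sigma>\<^sub>1 \<beta>\<^sub>1 :: real and x\<^sub>1 :: "real^'n" and y\<^sub>1 :: "real^'m"
    and s :: "nat \<Rightarrow> nat \<Rightarrow> real^'n \<Rightarrow> real^'n"
  assumes R: "assumption_R X A"
    and params: "lam > 0" "\<omega> > 1" "\<sigma>\<^sub>1 > 0" "\<beta>\<^sub>1 > 0"
    and start: "x\<^sub>1 \<in> X"
    and fgm_start: "\<And>k t c. c \<in> X \<Longrightarrow> s k t c \<in> X"
begin

text \<open>The factor \<open>b\<close> of the overview. The first penalty is the unscaled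
  \<open>\<beta>\<^sub>1\<close>, hence \<open>k - 1\<close>; index 0 also gets the value 1, so
  bounds need no case for it.\<close>

definition growth :: "nat \<Rightarrow> real" where "growth k = \<omega> ^ (k - 1)"

definition pen :: "nat \<Rightarrow> real" where "pen k = \<beta>\<^sub>1 * growth k"

definition tol :: "nat \<Rightarrow> real" where "tol k = lam / pen k"

lemma growth_ge_1: "growth k \<ge> 1"
  using params by (simp add: growth_def)

lemma growth_Suc: "k \<ge> 1 \<Longrightarrow> growth (k + 1) = \<omega> * growth k"
  by (cases k) (simp_all add: growth_def)

lemma pen_pos: "pen k > 0"
  using params growth_ge_1[of k] by (simp add: pen_def)

lemma tol_pos: "tol k > 0"
  using params pen_pos[of k] by (simp add: tol_def)

section \<open>Outer iterates and their multipliers\<close>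

abbreviation outer where
  "outer x y \<sigma> \<beta> eps \<equiv> inexact_power_alm X f A \<nu> lam \<omega> \<sigma>\<^sub>1 \<beta>\<^sub>1 x\<^sub>1 y\<^sub>1 x y \<sigma> \<beta> eps"

lemma outer_step:
  assumes "outer x y \<sigma> \<beta> eps" "k \<ge> 1"
  shows "eps (k + 1) = lam / \<beta> k" "x (k + 1) \<in> X" "\<beta> (k + 1) = \<omega> * \<beta> k"
    and "infdist (- gradient (psi \<nu> f A (\<beta> k) (y k)) (x (k + 1))) (normal_cone X (x (k + 1))) \<le> eps (k + 1)"
  using assms unfolding inexact_power_alm_def by blast+

lemma outer_penalty:
  assumes "outer x y \<sigma> \<beta> eps" "k \<ge> 1"
  shows "\<beta> k = pen k"
  using assms(2)
proof (induction k rule: nat_induct_at_least)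
  case base
  then show ?case using assms(1) by (simp add: inexact_power_alm_def pen_def growth_def)
next
  case (Suc k)
  then show ?case using outer_step(3)[OF assms(1) Suc.hyps] growth_Suc[OF Suc.hyps] by (simp add: pen_def)
qed

lemma outer_tolerance: "outer x y \<sigma> \<beta> eps \<Longrightarrow> k \<ge> 1 \<Longrightarrow> eps (k + 1) = tol k"
  using outer_penalty[of x y \<sigma> \<beta> eps k] outer_step(1)[of x y \<sigma> \<beta> eps k] by (simp add: tol_def)

lemma outer_in_X:
  assumes "outer x y \<sigma> \<beta> eps" "k \<ge> 1"
  shows "x k \<in> X"
proof (cases "k = 1")
  case True
  then show ?thesis using assms start by (simp add: inexact_power_alm_def)
next
  case False
  then show ?thesis using outer_step(2)[OF assms(1), of "k - 1"] assms(2) by simp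
qed

lemma outer_stationary:
  assumes "outer x y \<sigma> \<beta> eps" "k \<ge> 1"
  shows "infdist (- gradient (psi \<nu> f A (pen k) (y k)) (x (k + 1))) (normal_cone X (x (k + 1))) \<le> tol k"
  using outer_step(4)[OF assms] outer_penalty[OF assms] outer_tolerance[OF assms] by simp

definition dual_step :: real where
  "dual_step = \<sigma>\<^sub>1 * (norm (A x\<^sub>1) powr \<nu> * (ln 2)\<^sup>2)"

definition multiplier_bound :: real where
  "multiplier_bound = norm y\<^sub>1 + dual_step * (2 / ln 2)"

text \<open>The denominator in the dual step size contains
  \<open>norm (A (x (k + 1))) powr \<nu>\<close>, which is the norm of the gradient of
  \<open>phi \<nu>\<close>. It cancels, and a summable increment remains; a zero residual gives a
  zero increment.\<close>

lemma outer_multiplier_step: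
  assumes "outer x y \<sigma> \<beta> eps" "k \<ge> 1"
  shows "norm (y (k + 1)) \<le> norm (y k) + dual_step * (1 / (real (k + 1) * (ln (real (k + 2)))\<^sup>2))"
proof -
  let ?r = "norm (A (x (k + 1))) powr \<nu>"
  let ?c = "real (k + 1) * (ln (real (k + 2)))\<^sup>2"
  have \<sigma>: "\<sigma> (k + 1) = \<sigma>\<^sub>1 * (if A (x (k + 1)) = 0 then 1
      else min 1 (norm (A x\<^sub>1) powr \<nu> * (ln 2)\<^sup>2 / (?r * real (k + 1) * (ln (real (k + 2)))\<^sup>2)))"
    and y: "y (k + 1) = y k + \<sigma> (k + 1) *\<^sub>R gradient (phi \<nu>) (A (x (k + 1)))"
    using assms unfolding inexact_power_alm_def by blast+
  have "norm (y (k + 1)) \<le> norm (y k) + norm (\<sigma> (k + 1) *\<^sub>R gradient (phi \<nu>) (A (x (k + 1))))"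
    unfolding y by (rule norm_triangle_ineq)
  also have "norm (\<sigma> (k + 1) *\<^sub>R gradient (phi \<nu>) (A (x (k + 1)))) = \<bar>\<sigma> (k + 1)\<bar> * ?r"
    by (simp add: norm_gradient_phi)
  also have "\<bar>\<sigma> (k + 1)\<bar> * ?r \<le> dual_step * (1 / ?c)"
  proof (cases "A (x (k + 1)) = 0")
    case True
    have "dual_step \<ge> 0" using params by (simp add: dual_step_def)
    then show ?thesis using True by simp
  next
    case False
    then have r: "?r > 0" by simp
    define q where "q = norm (A x\<^sub>1) powr \<nu> * (ln 2)\<^sup>2 / (?r * real (k + 1) * (ln (real (k + 2)))\<^sup>2)"
    have "q \<ge> 0" unfolding q_def by (intro divide_nonneg_nonneg mult_nonneg_nonneg) auto
    moreover have "\<sigma> (k + 1) = \<sigma>\<^sub>1 * min 1 q" using \<sigma> False by (simp only: q_def if_False)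
    ultimately have "\<bar>\<sigma> (k + 1)\<bar> \<le> \<sigma>\<^sub>1 * q" using params by (simp add: abs_mult)
    then have "\<bar>\<sigma> (k + 1)\<bar> * ?r \<le> \<sigma>\<^sub>1 * q * ?r" by (rule mult_right_mono) simp
    also have "\<dots> = dual_step * (1 / ?c)"
      using r False by (simp add: q_def dual_step_def)
    finally show ?thesis .
  qed
  finally show ?thesis by simp
qed

text \<open>The induction carries the remainder \<open>1 / ln (real (k + 1))\<close> of the
  telescoping sum and drops it only at the end.\<close>

lemma outer_multiplier_bound:
  assumes run: "outer x y \<sigma> \<beta> eps" and "k \<ge> 1"
  shows "norm (y k) \<le> multiplier_bound"
proof -
  have d: "dual_step \<ge> 0" using params by (simp add: dual_step_def)
  have "norm (y k) \<le> norm y\<^sub>1 + dual_step * (2 * (1 / ln 2 - 1 / ln (real (k + 1))))"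
    using \<open>k \<ge> 1\<close>
  proof (induction k rule: nat_induct_at_least)
    case base
    then show ?case using run by (simp add: inexact_power_alm_def)
  next
    case (Suc k)
    have "norm (y (k + 1)) \<le> norm (y k) + dual_step * (1 / (real (k + 1) * (ln (real (k + 2)))\<^sup>2))"
      by (rule outer_multiplier_step[OF run Suc.hyps])
    also have "\<dots> \<le> norm (y k) + dual_step * (2 * (1 / ln (real (k + 1)) - 1 / ln (real (k + 2))))"
      by (intro add_left_mono mult_left_mono inverse_ln_telescope Suc.hyps d)
    also have "\<dots> \<le> norm y\<^sub>1 + dual_step * (2 * (1 / ln 2 - 1 / ln (real (k + 1))))
        + dual_step * (2 * (1 / ln (real (k + 1)) - 1 / ln (real (k + 2))))"
      using Suc.IH by simp
    also have "\<dots> = norm y\<^sub>1 + dual_step * (2 * (1 / ln 2 - 1 / ln (real (Suc k + 1))))"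
      by (simp add: algebra_simps)
    finally show ?case by simp
  qed
  also have "\<dots> \<le> norm y\<^sub>1 + dual_step * (2 / ln 2)"
  proof -
    have "ln (real (k + 1)) \<ge> 0" by (rule ln_ge_zero) simp
    then show ?thesis by (intro add_left_mono mult_left_mono d) simp
  qed
  finally show ?thesis by (simp add: multiplier_bound_def)
qed

text \<open>The constant is obtained before the run, because the complexity functions must serve all
  runs at once. Regularity is used for the compact set \<open>X\<close> itself.\<close>

lemma residual_bound:
  obtains C where "C > 0"
    "\<And>x y \<sigma> \<beta> eps k. outer x y \<sigma> \<beta> eps \<Longrightarrow> k \<ge> 1 \<Longrightarrow> pen k * norm (A (x (k + 1))) powr \<nu> \<le> C"
proof -
  obtain r where r: "r > 0"
    "\<And>x. x \<in> X \<Longrightarrow> r * norm (A x) \<le> infdist (- (transpose M *v A x)) (normal_cone X x)"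
    using R[unfolded assumption_R_def jacobian_eq, rule_format, of X] X by auto
  define C where "C = (lam / \<beta>\<^sub>1 + gfmax + JAmax * multiplier_bound) / r"
  have "0 \<le> multiplier_bound"
    using params by (simp add: multiplier_bound_def dual_step_def)
  then have "C > 0" unfolding C_def using params pos r by (intro divide_pos_pos add_pos_nonneg add_pos_pos) auto
  moreover have "pen k * norm (A (x (k + 1))) powr \<nu> \<le> C" if run: "outer x y \<sigma> \<beta> eps" and k: "k \<ge> 1" for x y \<sigma> \<beta> eps k
  proof -
    have xX: "x (k + 1) \<in> X" using outer_in_X[OF run, of "k + 1"] by simp
    have "tol k \<le> lam / \<beta>\<^sub>1"
      unfolding tol_def pen_def using params growth_ge_1[of k] by (intro divide_left_mono) auto
    moreover have "JAmax * norm (y k) \<le> JAmax * multiplier_bound"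
      using outer_multiplier_bound[OF run k] pos by (intro mult_left_mono) auto
    moreover have "r * (pen k * norm (A (x (k + 1))) powr \<nu>) \<le> tol k + gfmax + JAmax * norm (y k)"
      by (rule feasibility_bound[OF xX pen_pos less_imp_le[OF tol_pos] outer_stationary[OF run k] r(2)[OF xX]])
    ultimately have "r * (pen k * norm (A (x (k + 1))) powr \<nu>) \<le> lam / \<beta>\<^sub>1 + gfmax + JAmax * multiplier_bound"
      by linarith
    then show ?thesis unfolding C_def using r(1) by (simp add: pos_le_divide_eq mult.commute)
  qed
  ultimately show ?thesis using that by blast
qed

section \<open>Number of iPPM iterations per outer iteration\<close>

abbreviation run where
  "run \<delta> \<gamma> N x T \<equiv> full_run X f A D Lf 0 Amax JAmax \<nu> lam \<omega> \<sigma>\<^sub>1 \<beta>\<^sub>1 x\<^sub>1 y\<^sub>1 s \<delta> \<gamma> N x T"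

lemma ippm_rho_eq: "ippm_rho Lf 0 Amax \<nu> \<beta> y = Lf"
  by (simp add: ippm_rho_def)

text \<open>By \<open>ippm_run_length\<close> the count is the initial gap over a multiple of
  \<open>(tol k)\<^sup>2\<close>, hence of order \<open>(growth k)\<^sup>2\<close> once the gap is
  bounded uniformly in k. For that, the penalty at \<open>x k\<close> must be bounded under the new
  weight \<open>pen k\<close>.\<close>

lemma run_ippm_count:
  obtains C where "C \<ge> 0"
    "\<And>\<delta> \<gamma> N x T k. run \<delta> \<gamma> N x T \<Longrightarrow> k \<ge> 1 \<Longrightarrow> real (T k) \<le> C * (growth k)\<^sup>2"
proof -
  obtain B where B: "\<And>x. x \<in> X \<Longrightarrow> \<bar>f x\<bar> \<le> B" using bounded_f by blast
  obtain C1 where C1: "C1 > 0"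
    "\<And>x y \<sigma> \<beta> eps k. outer x y \<sigma> \<beta> eps \<Longrightarrow> k \<ge> 1 \<Longrightarrow> pen k * norm (A (x (k + 1))) powr \<nu> \<le> C1"
    using residual_bound by blast
  \<comment> \<open>The residual of \<open>x k\<close> was controlled under the weight
    \<open>pen (k - 1)\<close>; the factor \<open>\<omega>\<close> passes to \<open>pen k\<close>.
    The starting point \<open>x\<^sub>1\<close> is only known to lie in \<open>X\<close>, which
    explains the first summand.\<close>
  define S where "S = \<beta>\<^sub>1 * Amax powr \<nu> + \<omega> * C1"
  define \<Delta> where "\<Delta> = 2 * \<bar>B\<bar> + 2 * (Amax * multiplier_bound) + Amax * S"
  define C where "C = 1 + 32 * Lf * \<Delta> * \<beta>\<^sub>1\<^sup>2 / lam\<^sup>2"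
  have S: "S \<ge> 0" using params pos C1(1) by (simp add: S_def)
  have "0 \<le> multiplier_bound"
    using params by (simp add: multiplier_bound_def dual_step_def)
  then have \<Delta>: "\<Delta> \<ge> 0" using S pos by (simp add: \<Delta>_def)
  have "C \<ge> 0" using \<Delta> pos by (simp add: C_def)
  moreover have "real (T k) \<le> C * (growth k)\<^sup>2" if full: "run \<delta> \<gamma> N x T" and k: "k \<ge> 1" for \<delta> \<gamma> N x T k
  proof -
    obtain y \<sigma> \<beta> eps u where out: "outer x y \<sigma> \<beta> eps"
      and inner: "ippm_run X (psi \<nu> f A (\<beta> k) (y k)) Lf (eps (k + 1)) (x k) (u k) (T k)"
      using full k unfolding full_run_def Let_def ippm_rho_eq by blast
    have inner: "ippm_run X (psi \<nu> f A (pen k) (y k)) Lf (tol k) (x k) (u k) (T k)"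
      using inner outer_penalty[OF out k] outer_tolerance[OF out k] by simp
    have xX: "x k \<in> X" by (rule outer_in_X[OF out k])
    have T1: "T k \<ge> 1" using inner by (simp add: ippm_run_def)
    have uX: "u k (T k) \<in> X" using ippm_run_in_set[OF inner xX] T1 by simp
    have res: "pen k * norm (A (x k)) powr \<nu> \<le> S"
    proof (cases "k = 1")
      case True
      have "norm (A (x k)) powr \<nu> \<le> Amax powr \<nu>"
        using P xX \<nu> by (intro powr_mono2) (auto simp: assumption_P_def)
      then have "\<beta>\<^sub>1 * norm (A (x k)) powr \<nu> \<le> \<beta>\<^sub>1 * Amax powr \<nu>" using params by simp
      then show ?thesis using True params C1(1) by (simp add: S_def pen_def growth_def add_increasing2)
    next
      case False
      define j where "j = k - 1"
      have j: "j \<ge> 1" "k = j + 1" using False k by (auto simp: j_def)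
      have "pen k = \<omega> * pen j" using growth_Suc[OF j(1)] j(2) by (simp add: pen_def)
      then have "pen k * norm (A (x k)) powr \<nu> = \<omega> * (pen j * norm (A (x (j + 1))) powr \<nu>)" using j by simp
      also have "\<dots> \<le> \<omega> * C1" using C1(2)[OF out j(1)] params by (intro mult_left_mono) auto
      finally show ?thesis using params pos by (simp add: S_def add_increasing)
    qed
    have "real (T k - 1) * ((tol k)\<^sup>2 / (32 * Lf)) \<le> psi \<nu> f A (pen k) (y k) (x k) - psi \<nu> f A (pen k) (y k) (u k (T k))"
      by (rule ippm_run_length[OF pos(2) less_imp_le[OF tol_pos] xX inner prox_psi_lower])
        (use pen_pos less_imp_le in auto)
    also have "\<dots> \<le> \<Delta>"
    proof -
      have "Amax * norm (y k) \<le> Amax * multiplier_bound"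
        using outer_multiplier_bound[OF out k] pos by (intro mult_left_mono) auto
      moreover have "Amax * (pen k * norm (A (x k)) powr \<nu>) \<le> Amax * S"
        using res pos by (intro mult_left_mono) auto
      ultimately show ?thesis
        using psi_le[OF B xX less_imp_le[OF pen_pos[of k]], of "y k"]
          psi_ge[OF B uX less_imp_le[OF pen_pos[of k]], of "y k"] abs_ge_self[of B]
        unfolding \<Delta>_def by linarith
    qed
    finally have count: "real (T k - 1) * ((tol k)\<^sup>2 / (32 * Lf)) \<le> \<Delta>" .
    have "0 < (tol k)\<^sup>2 / (32 * Lf)" using tol_pos[of k] pos by simp
    then have "real (T k - 1) \<le> \<Delta> / ((tol k)\<^sup>2 / (32 * Lf))"
      using count by (simp only: pos_le_divide_eq)
    also have "\<dots> = 32 * Lf * \<Delta> * \<beta>\<^sub>1\<^sup>2 / lam\<^sup>2 * (growth k)\<^sup>2"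
      by (simp add: tol_def pen_def power_divide power_mult_distrib)
    finally have "real (T k) \<le> 1 + 32 * Lf * \<Delta> * \<beta>\<^sub>1\<^sup>2 / lam\<^sup>2 * (growth k)\<^sup>2"
      using T1 by (simp add: of_nat_diff)
    also have "\<dots> \<le> C * (growth k)\<^sup>2"
      using growth_ge_1[of k] by (simp add: C_def distrib_right)
    finally show ?thesis .
  qed
  ultimately show ?thesis using that by blast
qed

text \<open>This is \<open>2 + 2 / \<nu>\<close>. Tolerance times radius decays like
  \<open>b powr (- 1 - 2 / \<nu>)\<close>; the target is taken smaller by one more power of
  \<open>b\<close>, which produces exactly the exponent of the claimed bound.\<close>

definition gap_exponent :: real where
  "gap_exponent = 2 * (1 + \<nu>) / \<nu>"

definition fgm_exponent :: real where
  "fgm_exponent = (1 - \<nu>) / (1 + 3 * \<nu>) * gap_exponent + 2 / (1 + 3 * \<nu>)"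

text \<open>The accuracy hypothesis of \<open>prox_update_stationary\<close> as it arises in outer
  iteration \<open>k\<close>.\<close>

definition fgm_gap_ok :: "nat \<Rightarrow> real \<Rightarrow> nat \<Rightarrow> bool" where
  "fgm_gap_ok k \<delta> N \<longleftrightarrow> (let L = fgm_L (prox_holder (pen k)) \<nu> \<delta> in
     L / 2 * D\<^sup>2 / (1 + sqrt (Lf / L)) ^ (N - 1) + \<delta> * (1 + sqrt (L / Lf))
       < tol k / 12 * prox_radius (pen k) (tol k))"

lemma run_parameters:
  obtains \<delta> :: "nat \<Rightarrow> real" and N :: "nat \<Rightarrow> nat" and C where
    "\<And>k. \<delta> k > 0" "\<And>k. N k \<ge> 1" "\<And>k. fgm_gap_ok k (\<delta> k) (N k)"
    "\<And>k. real (N k) \<le> C * growth k powr fgm_exponent * (1 + ln (growth k))"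
proof -
  define m where "m = max 1 (D powr (1 - \<nu>))"
  define c where "c = 2 powr (1 - \<nu>) * JAmax powr (1 + \<nu>)"
  define h where "h = (3 * Lf + \<beta>\<^sub>1 * c) * m"
  have h: "h > 0" unfolding h_def using pos params by (intro mult_pos_pos add_pos_nonneg) (auto simp: m_def c_def)
  define e0 where "e0 = lam / \<beta>\<^sub>1"
  have e0: "e0 > 0" using params by (simp add: e0_def)
  \<comment> \<open>The required gap at growth 1, with \<open>h\<close> as the Hoelder constant and
    \<open>e0\<close> as the tolerance.\<close>
  define \<eta> where "\<eta> = e0 / 12 * (e0 / (12 * h)) powr (1 / \<nu>)"
  have \<eta>: "\<eta> > 0" using e0 h by (simp add: \<eta>_def)
  have a: "gap_exponent > 0" using \<nu> by (simp add: gap_exponent_def)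
  have H_le: "prox_holder (pen k) \<le> h * growth k" for k
  proof -
    have "3 * Lf \<le> 3 * Lf * growth k" using pos growth_ge_1[of k] by simp
    then have "(3 * Lf + \<beta>\<^sub>1 * growth k * c) * m \<le> (3 * Lf * growth k + \<beta>\<^sub>1 * growth k * c) * m"
      by (intro mult_right_mono add_right_mono) (auto simp: m_def)
    then show ?thesis
      unfolding prox_holder_eq pen_def m_def[symmetric] c_def[symmetric] h_def by (simp add: algebra_simps)
  qed
  have target: "\<eta> * growth k powr (- gap_exponent) \<le> tol k / 12 * prox_radius (pen k) (tol k)" for k
  proof -
    let ?b = "growth k"
    have b: "?b \<ge> 1" by (rule growth_ge_1)
    have tol_eq: "tol k = e0 / ?b" by (simp add: tol_def pen_def e0_def)
    have H: "prox_holder (pen k) > 0" using pen_pos[of k] by (intro prox_holder_pos) simp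
    have "e0 / (12 * h) * ?b powr (- 2) = e0 / ?b / (12 * (h * ?b))"
      using b by (simp add: powr_minus_divide power2_eq_square)
    also have "\<dots> \<le> tol k / (12 * prox_holder (pen k))"
      unfolding tol_eq using H_le[of k] H h b e0
      by (intro divide_left_mono mult_left_mono mult_pos_pos) auto
    finally have "(e0 / (12 * h) * ?b powr (- 2)) powr (1 / \<nu>) \<le> prox_radius (pen k) (tol k)"
      unfolding prox_radius_def using \<nu> e0 h by (intro powr_mono2) auto
    then have rad: "(e0 / (12 * h)) powr (1 / \<nu>) * ?b powr (- (2 / \<nu>)) \<le> prox_radius (pen k) (tol k)"
      unfolding powr_mult powr_powr by simp
    \<comment> \<open>\<open>- gap_exponent\<close> is smaller than \<open>- 1 - 2 / \<nu>\<close>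
      by 1, so reaching the power with this exponent suffices.\<close>
    have "?b powr (- gap_exponent) \<le> ?b powr (- 1 - 2 / \<nu>)"
      using b \<nu> by (intro powr_mono) (auto simp: gap_exponent_def field_simps)
    also have "\<dots> = ?b powr (- (2 / \<nu>)) / ?b"
      using b by (simp add: powr_diff powr_minus_divide)
    finally have "\<eta> * ?b powr (- gap_exponent) \<le> \<eta> * (?b powr (- (2 / \<nu>)) / ?b)"
      using \<eta> by (intro mult_left_mono) auto
    also have "\<dots> = tol k / 12 * ((e0 / (12 * h)) powr (1 / \<nu>) * ?b powr (- (2 / \<nu>)))"
      by (simp add: \<eta>_def tol_eq)
    also have "\<dots> \<le> tol k / 12 * prox_radius (pen k) (tol k)"
      using rad tol_pos[of k] by (intro mult_left_mono) auto
    finally show ?thesis .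
  qed
  obtain \<delta> :: "real \<Rightarrow> real" and N :: "real \<Rightarrow> nat" and C where par: "\<And>b. b \<ge> 1 \<Longrightarrow>
      \<delta> b > 0 \<and> N b \<ge> 1 \<and> real (N b) \<le> C * b powr fgm_exponent * (1 + ln b) \<and>
      (\<forall>H. 0 < H \<and> H \<le> h * b \<longrightarrow>
        (let L = fgm_L H \<nu> (\<delta> b) in L / 2 * D\<^sup>2 / (1 + sqrt (Lf / L)) ^ (N b - 1)
          + \<delta> b * (1 + sqrt (L / Lf)) < \<eta> * b powr (- gap_exponent)))"
    using fgm_parameters[OF \<nu> pos(2,1) h \<eta> a] unfolding fgm_exponent_def by blast
  show ?thesis
  proof (rule that)
    fix k
    note p = par[OF growth_ge_1[of k]]
    show "\<delta> (growth k) > 0" "N (growth k) \<ge> 1"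
      "real (N (growth k)) \<le> C * growth k powr fgm_exponent * (1 + ln (growth k))"
      using p by blast+
    have "prox_holder (pen k) > 0" using pen_pos[of k] by (intro prox_holder_pos) simp
    then have "let L = fgm_L (prox_holder (pen k)) \<nu> (\<delta> (growth k)) in
        L / 2 * D\<^sup>2 / (1 + sqrt (Lf / L)) ^ (N (growth k) - 1) + \<delta> (growth k) * (1 + sqrt (L / Lf))
        < \<eta> * growth k powr (- gap_exponent)"
      using p H_le[of k] by blast
    then show "fgm_gap_ok k (\<delta> (growth k)) (N (growth k))"
      using target[of k] unfolding fgm_gap_ok_def Let_def by (rule less_le_trans)
  qed
qed

section \<open>Existence of complete runs\<close>

definition update :: "(nat \<Rightarrow> real) \<Rightarrow> (nat \<Rightarrow> nat) \<Rightarrow> nat \<Rightarrow> real^'m \<Rightarrow> nat \<Rightarrow> real^'n \<Rightarrow> real^'n \<Rightarrow> bool" where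
  "update \<delta> N k y t c = fgm_then_projected_step X (prox_objective (psi \<nu> f A (pen k) y) Lf c)
     (fgm_L (prox_holder (pen k)) \<nu> (\<delta> k)) Lf (s k t c) (N k) (step_length (pen k) (tol k))"

lemma update_stationary:
  assumes "\<delta> k > 0" "fgm_gap_ok k (\<delta> k) (N k)" "c \<in> X" "update \<delta> N k y t c v"
  shows "v \<in> X \<and> infdist (- gradient (prox_objective (psi \<nu> f A (pen k) y) Lf c) v) (normal_cone X v) \<le> tol k / 4"
  using prox_update_stationary[OF less_imp_le[OF pen_pos] tol_pos assms(1,3) fgm_start[OF assms(3)]]
    assms(2,4) unfolding update_def fgm_gap_ok_def Let_def by blast

lemma inner_run_exists:
  assumes \<delta>: "\<delta> k > 0" and N: "N k \<ge> 1" "fgm_gap_ok k (\<delta> k) (N k)" and x: "x \<in> X"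
  shows "\<exists>u T. ippm_run X (psi \<nu> f A (pen k) y) Lf (tol k) x u T \<and>
    (\<forall>t\<in>{1..T}. update \<delta> N k y t (u t) (u (t + 1)))"
proof -
  obtain B where B: "\<And>x. x \<in> X \<Longrightarrow> \<bar>f x\<bar> \<le> B" using bounded_f by blast
  show ?thesis
  proof (rule ippm_run_exists[OF pos(2) tol_pos x])
    show "- B - Amax * norm y \<le> psi \<nu> f A (pen k) y v" if "v \<in> X" for v
      using psi_ge[OF B that less_imp_le[OF pen_pos]] .
    show "prox_objective (psi \<nu> f A (pen k) y) Lf c v
        + gradient (prox_objective (psi \<nu> f A (pen k) y) Lf c) v \<bullet> (c - v) + Lf / 2 * (norm (c - v))\<^sup>2
        \<le> prox_objective (psi \<nu> f A (pen k) y) Lf c c" if "c \<in> X" "v \<in> X" for c v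
      by (rule prox_psi_lower[OF that(2,1) less_imp_le[OF pen_pos]])
    show "\<exists>v. update \<delta> N k y t c v" for t c
      unfolding update_def
      by (intro fgm_then_projected_step_exists fgm_L_pos prox_holder_pos pos \<delta> N less_imp_le[OF pen_pos])
    show "v \<in> X \<and> infdist (- gradient (prox_objective (psi \<nu> f A (pen k) y) Lf c) v) (normal_cone X v) \<le> tol k / 4"
      if "c \<in> X" "update \<delta> N k y t c v" for t c v
      by (rule update_stationary[of \<delta>, OF \<delta> N(2) that])
  qed
qed

text \<open>The gradients of the prox objective and of \<open>psi\<close> differ by
  \<open>2 * Lf\<close> times the last displacement, at most \<open>tol k / 2\<close> by the
  stopping test; with the inner error \<open>tol k / 4\<close> this stays below
  \<open>tol k\<close>.\<close>

lemma ippm_result_stationary: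
  assumes run: "ippm_run X (psi \<nu> f A (pen k) y) Lf (tol k) x u T" and x: "x \<in> X"
  shows "u (T + 1) \<in> X"
    and "infdist (- gradient (psi \<nu> f A (pen k) y) (u (T + 1))) (normal_cone X (u (T + 1))) \<le> tol k"
proof -
  let ?c = "u T" and ?v = "u (T + 1)"
  have T: "T \<ge> 1" using run by (simp add: ippm_run_def)
  show "?v \<in> X" using ippm_run_in_set[OF run x, of "T + 1"] by simp
  have "infdist (- gradient (prox_objective (psi \<nu> f A (pen k) y) Lf ?c) ?v) (normal_cone X ?v) \<le> tol k / 4"
    using run T unfolding ippm_run_def by auto
  moreover have "norm (- gradient (prox_objective (psi \<nu> f A (pen k) y) Lf ?c) ?v
      - (- gradient (psi \<nu> f A (pen k) y) ?v)) \<le> tol k / 2"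
    using run pos unfolding ippm_run_def gradient_prox_psi gradient_psi by simp
  ultimately show "infdist (- gradient (psi \<nu> f A (pen k) y) ?v) (normal_cone X ?v) \<le> tol k"
    using infdist_normal_cone_add tol_pos[of k] by fastforce
qed

text \<open>The complexity claim ranges over all runs, and existence shows that it is not vacuous.
  One run is built by choosing, in each outer iteration, a whole inner run together with its
  length.\<close>

lemma run_exists:
  assumes \<delta>: "\<And>k. \<delta> k > 0" and N: "\<And>k. N k \<ge> 1" "\<And>k. fgm_gap_ok k (\<delta> k) (N k)"
  shows "\<exists>x T. run \<delta> (\<lambda>k. step_length (pen k) (tol k)) N x T"
proof -
  define good where "good k x y p \<longleftrightarrow> (case p of (u, T) \<Rightarrow>
    ippm_run X (psi \<nu> f A (pen k) y) Lf (tol k) x u T \<and> (\<forall>t\<in>{1..T}. update \<delta> N k y t (u t) (u (t + 1))))"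
    for k x y p
  define U where "U k x y = (SOME p. good k x y p)" for k x y
  have U: "good k x y (U k x y)" if "x \<in> X" for k x y
  proof -
    have "\<exists>p. good k x y p" using inner_run_exists[of \<delta> k N x y, OF \<delta> N that] by (auto simp: good_def)
    then show ?thesis unfolding U_def by (rule someI_ex)
  qed
  define res where "res k x y = fst (U k x y) (snd (U k x y) + 1)" for k x y
  \<comment> \<open>Written at the index of the new iterate, so \<open>k\<close> and
    \<open>k + 1\<close> correspond to \<open>k + 1\<close> and \<open>k + 2\<close> in
    \<open>inexact_power_alm\<close>.\<close>
  define sg where "sg k x = \<sigma>\<^sub>1 * (if A x = 0 then 1
      else min 1 (norm (A x\<^sub>1) powr \<nu> * (ln 2)\<^sup>2 / (norm (A x) powr \<nu> * real k * (ln (real (k + 1)))\<^sup>2)))" for k x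
  \<comment> \<open>The state is the pair of iterate and multiplier; recursion index
    \<open>j\<close> belongs to outer iteration \<open>Suc j\<close>.\<close>
  define st where "st = rec_nat (x\<^sub>1, y\<^sub>1) (\<lambda>j (x, y).
    (res (Suc j) x y, y + sg (Suc (Suc j)) (res (Suc j) x y) *\<^sub>R gradient (phi \<nu>) (A (res (Suc j) x y))))"
  define x where "x k = fst (st (k - 1))" for k
  define y where "y k = snd (st (k - 1))" for k
  define \<sigma> where "\<sigma> k = (if k \<le> 1 then \<sigma>\<^sub>1 else sg k (x k))" for k
  have x1: "x 1 = x\<^sub>1" "y 1 = y\<^sub>1" by (simp_all add: x_def y_def st_def)
  have xS: "x (k + 1) = res k (x k) (y k)"
    and yS: "y (k + 1) = y k + \<sigma> (k + 1) *\<^sub>R gradient (phi \<nu>) (A (x (k + 1)))" if "k \<ge> 1" for k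
    using that by (cases k; simp add: x_def y_def st_def \<sigma>_def split_beta)+
  have xX: "x k \<in> X" if "k \<ge> 1" for k
    using that
  proof (induction k rule: nat_induct_at_least)
    case base
    show ?case unfolding x1 by (rule start)
  next
    case (Suc k)
    then show ?case
      using ippm_result_stationary(1)[OF _ Suc.IH] U[OF Suc.IH, of k "y k"] xS[OF Suc.hyps]
      by (auto simp: good_def res_def split_beta)
  qed
  define u where "u k = fst (U k (x k) (y k))" for k
  define T where "T k = snd (U k (x k) (y k))" for k
  have inner: "ippm_run X (psi \<nu> f A (pen k) (y k)) Lf (tol k) (x k) (u k) (T k)"
    and upd: "\<forall>t\<in>{1..T k}. update \<delta> N k (y k) t (u k t) (u k (t + 1))" if "k \<ge> 1" for k
    using U[OF xX[OF that], of k "y k"] by (auto simp: good_def u_def T_def split_beta)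
  have last: "x (k + 1) = u k (T k + 1)" if "k \<ge> 1" for k
    using xS[OF that] by (simp add: res_def u_def T_def)
  \<comment> \<open>The tolerance of outer iteration \<open>k\<close> is \<open>eps (k + 1)\<close>,
    hence the shifted index in \<open>tol (k - 1)\<close>.\<close>
  have "outer x y \<sigma> pen (\<lambda>k. tol (k - 1))"
    unfolding inexact_power_alm_def
  proof (intro conjI allI impI)
    fix k :: nat assume k: "1 \<le> k"
    show "tol (k + 1 - 1) = lam / pen k" by (simp add: tol_def)
    show "x (k + 1) \<in> X" using xX[of "k + 1"] by simp
    show "infdist (- gradient (psi \<nu> f A (pen k) (y k)) (x (k + 1))) (normal_cone X (x (k + 1))) \<le> tol (k + 1 - 1)"
      using ippm_result_stationary(2)[OF inner[OF k] xX[OF k]] last[OF k] by simp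
    show "\<sigma> (k + 1) = \<sigma>\<^sub>1 * (if A (x (k + 1)) = 0 then 1
        else min 1 (norm (A x\<^sub>1) powr \<nu> * (ln 2)\<^sup>2 / (norm (A (x (k + 1))) powr \<nu> * real (k + 1) * (ln (real (k + 2)))\<^sup>2)))"
      using k by (simp add: \<sigma>_def sg_def)
    show "y (k + 1) = y k + \<sigma> (k + 1) *\<^sub>R gradient (phi \<nu>) (A (x (k + 1)))" by (rule yS[OF k])
    show "pen (k + 1) = \<omega> * pen k" using growth_Suc[OF k] by (simp add: pen_def)
  qed (use x1 in \<open>simp_all add: \<sigma>_def pen_def growth_def\<close>)
  moreover have "ippm_run X (psi \<nu> f A (pen k) (y k)) Lf (tol (k + 1 - 1)) (x k) (u k) (T k) \<and>
      x (k + 1) = u k (T k + 1) \<and>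
      (\<forall>t\<in>{1..T k}. fgm_then_projected_step X (prox_objective (psi \<nu> f A (pen k) (y k)) Lf (u k t))
        (fgm_L (prox_holder (pen k)) \<nu> (\<delta> k)) Lf (s k t (u k t)) (N k) (step_length (pen k) (tol k)) (u k (t + 1)))"
    if "k \<ge> 1" for k
    using inner[OF that] last[OF that] upd[OF that] unfolding update_def by simp
  ultimately have "run \<delta> (\<lambda>k. step_length (pen k) (tol k)) N x T"
    unfolding full_run_def Let_def ippm_rho_eq holder_F_eq by blast
  then show ?thesis by blast
qed

section \<open>Total number of FGM iterations\<close>

definition cost :: "real \<Rightarrow> real \<Rightarrow> real" where
  "cost C b = C * (1 + ln b / ln \<omega>) * (1 + ln b) * b powr (2 + fgm_exponent)"

lemma fgm_exponent_nonneg: "fgm_exponent \<ge> 0"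
  using \<nu> by (simp add: fgm_exponent_def gap_exponent_def)

lemma cost_mono:
  assumes "C \<ge> 0" "1 \<le> a" "a \<le> b"
  shows "cost C a \<le> cost C b"
proof -
  have "ln a / ln \<omega> \<le> ln b / ln \<omega>" using assms params by (intro divide_right_mono) auto
  moreover have "0 \<le> ln a / ln \<omega>" "0 \<le> ln a" "ln a \<le> ln b" using assms params by auto
  moreover have "a powr (2 + fgm_exponent) \<le> b powr (2 + fgm_exponent)"
    using assms fgm_exponent_nonneg by (intro powr_mono2) auto
  ultimately show ?thesis unfolding cost_def using assms by (intro mult_mono) auto
qed

text \<open>Every outer iteration is charged the cost of the last one. Their number is exactly
  \<open>1 + ln (growth k) / ln \<omega>\<close>, the additional logarithm in \<open>cost\<close>.
  Iterations 1 to k are the ones that produce \<open>x (k + 1)\<close>.\<close>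

lemma run_cost:
  assumes C: "C \<ge> 0" and k: "k \<ge> 1"
    and T: "\<And>j. j \<ge> 1 \<Longrightarrow> real (T j) \<le> C1 * (growth j)\<^sup>2" and C1: "C1 \<ge> 0"
    and N: "\<And>j. real (N j) \<le> C2 * growth j powr fgm_exponent * (1 + ln (growth j))"
    and C_eq: "C = C1 * C2"
  shows "real (\<Sum>j = 1..<k + 1. T j * N j) \<le> cost C (growth k)"
proof -
  let ?q = "\<lambda>b. C * (1 + ln b) * b powr (2 + fgm_exponent)"
  have "real (T j * N j) \<le> ?q (growth k)" if "j \<in> {1..<k + 1}" for j
  proof -
    have j: "j \<ge> 1" "j \<le> k" using that by auto
    have le: "growth j \<le> growth k" unfolding growth_def using params j by (intro power_increasing) auto
    have "real (T j * N j) \<le> (C1 * (growth j)\<^sup>2) * (C2 * growth j powr fgm_exponent * (1 + ln (growth j)))"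
      unfolding of_nat_mult using T[OF j(1)] N[of j] C1 by (intro mult_mono) auto
    also have "\<dots> = ?q (growth j)"
      using growth_ge_1[of j] by (simp add: C_eq powr_add mult_ac)
    also have "\<dots> \<le> ?q (growth k)"
      using le growth_ge_1[of j] C fgm_exponent_nonneg by (intro mult_mono powr_mono2) auto
    finally show ?thesis .
  qed
  then have "(\<Sum>j = 1..<k + 1. real (T j * N j)) \<le> real (card {1..<k + 1}) * ?q (growth k)"
    by (rule sum_bounded_above)
  also have "real (card {1..<k + 1}) = 1 + ln (growth k) / ln \<omega>"
    using k params by (simp add: growth_def ln_realpow of_nat_diff)
  finally show ?thesis unfolding of_nat_sum cost_def by (simp only: mult_ac)
qed

text \<open>The least power of \<open>\<omega>\<close> that reaches \<open>B\<close> overshoots by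
  at most one factor \<open>\<omega>\<close>, so passing the threshold inflates the cost only by a
  constant.\<close>

lemma exists_outer_index:
  assumes "B \<ge> 1"
  obtains k where "k \<ge> 1" "growth k \<ge> B" "growth k \<le> \<omega> * B"
proof -
  obtain n0 where "B < \<omega> ^ n0" using real_arch_pow params by blast
  then have ex: "\<exists>n. B \<le> \<omega> ^ n" by (auto intro: less_imp_le)
  define n where "n = (LEAST n. B \<le> \<omega> ^ n)"
  have n: "B \<le> \<omega> ^ n" unfolding n_def by (rule LeastI_ex[OF ex])
  have "\<omega> ^ n \<le> \<omega> * B"
  proof (cases n)
    case 0
    then show ?thesis using mult_mono[of 1 \<omega> 1 B] assms params by simp
  next
    case (Suc m)
    then have "\<not> B \<le> \<omega> ^ m" using not_less_Least[of m] unfolding n_def by (metis lessI)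
    then show ?thesis using Suc params by simp
  qed
  then show ?thesis using that[of "n + 1"] n by (simp add: growth_def)
qed

lemma complexity:
  "\<exists>(\<delta> :: nat \<Rightarrow> real) (\<gamma> :: nat \<Rightarrow> real) (N :: nat \<Rightarrow> nat).
    (\<forall>k. \<delta> k > 0 \<and> \<gamma> k > 0) \<and> (\<exists>x T. run \<delta> \<gamma> N x T) \<and>
    (\<exists>T\<phi> TA :: real \<Rightarrow> real.
       T\<phi> \<in> soft_O (\<lambda>\<epsilon>. \<epsilon> powr (- (2 + fgm_exponent))) \<and>
       TA \<in> soft_O (\<lambda>\<epsilon>. \<epsilon> powr (- (\<nu> * (2 + fgm_exponent)))) \<and>
       (\<forall>x T. run \<delta> \<gamma> N x T \<longrightarrow>
          (\<forall>eps_phi>0. \<forall>eps_A>0. \<exists>K\<ge>1. stationary_point X f A eps_phi eps_A (x K) \<and>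
             real (\<Sum>k = 1..<K. T k * N k) \<le> max (T\<phi> eps_phi) (TA eps_A))))"
proof -
  obtain \<delta> :: "nat \<Rightarrow> real" and N :: "nat \<Rightarrow> nat" and C2 where par:
    "\<And>k. \<delta> k > 0" "\<And>k. N k \<ge> 1" "\<And>k. fgm_gap_ok k (\<delta> k) (N k)"
    and N: "\<And>k. real (N k) \<le> C2 * growth k powr fgm_exponent * (1 + ln (growth k))"
    using run_parameters by blast
  obtain C1 where C1: "C1 \<ge> 0"
    "\<And>\<delta> \<gamma> N x T k. run \<delta> \<gamma> N x T \<Longrightarrow> k \<ge> 1 \<Longrightarrow> real (T k) \<le> C1 * (growth k)\<^sup>2"
    using run_ippm_count by blast
  obtain CA where CA: "CA > 0"
    "\<And>x y \<sigma> \<beta> eps k. outer x y \<sigma> \<beta> eps \<Longrightarrow> k \<ge> 1 \<Longrightarrow> pen k * norm (A (x (k + 1))) powr \<nu> \<le> CA"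
    using residual_bound by blast
  define \<gamma> where "\<gamma> k = step_length (pen k) (tol k)" for k
  define C where "C = C1 * C2"
  \<comment> \<open>At \<open>k = 1\<close> the growth is 1, so the bound on the FGM count reads
    \<open>N 1 \<le> C2\<close>.\<close>
  have "C2 \<ge> 0" using N[of 1] par(2)[of 1] by (simp add: growth_def)
  then have C: "C \<ge> 0" using C1(1) by (simp add: C_def)
  \<comment> \<open>Growth \<open>lam / \<beta>\<^sub>1 / \<epsilon>\<close> brings the tolerance
    down to \<open>\<epsilon>\<close>; the factor \<open>\<omega>\<close> is the overshoot from
    \<open>exists_outer_index\<close>, and \<open>powr 1\<close> fits the form of
    \<open>soft_O_geometric_cost\<close>.\<close>
  define T\<phi> where "T\<phi> \<epsilon> = cost C (\<omega> * max 1 (lam / \<beta>\<^sub>1 / \<epsilon> powr 1))" for \<epsilon>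
  \<comment> \<open>Feasibility is controlled through \<open>norm (A x) powr \<nu>\<close>, hence
    the power \<open>\<nu>\<close> of \<open>\<epsilon>\<close> here and the factor
    \<open>\<nu>\<close> in the exponent of the bound.\<close>
  define TA where "TA \<epsilon> = cost C (\<omega> * max 1 (CA / \<beta>\<^sub>1 / \<epsilon> powr \<nu>))" for \<epsilon>
  have T\<phi>: "T\<phi> \<in> soft_O (\<lambda>\<epsilon>. \<epsilon> powr (- (2 + fgm_exponent)))"
    using soft_O_geometric_cost[OF C params(2), of "2 + fgm_exponent" 1 "lam / \<beta>\<^sub>1"] fgm_exponent_nonneg
    by (simp add: T\<phi>_def[abs_def] cost_def[abs_def])
  have TA: "TA \<in> soft_O (\<lambda>\<epsilon>. \<epsilon> powr (- (\<nu> * (2 + fgm_exponent))))"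
    using soft_O_geometric_cost[OF C params(2), of "2 + fgm_exponent" \<nu> "CA / \<beta>\<^sub>1"] fgm_exponent_nonneg \<nu>
    by (simp add: TA_def[abs_def] cost_def[abs_def])
  have final: "\<exists>K\<ge>1. stationary_point X f A eps_phi eps_A (x K) \<and>
      real (\<Sum>k = 1..<K. T k * N k) \<le> max (T\<phi> eps_phi) (TA eps_A)"
    if full: "run \<delta> \<gamma> N x T" and eps: "eps_phi > 0" "eps_A > 0" for x T eps_phi eps_A
  proof -
    obtain y \<sigma> \<beta> eps where out: "outer x y \<sigma> \<beta> eps"
      using full unfolding full_run_def by blast
    define B1 where "B1 = max 1 (lam / \<beta>\<^sub>1 / eps_phi)"
    define B2 where "B2 = max 1 (CA / \<beta>\<^sub>1 / eps_A powr \<nu>)"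
    have "max B1 B2 \<ge> 1" by (simp add: B1_def)
    then obtain k where k: "k \<ge> 1" "growth k \<ge> max B1 B2" "growth k \<le> \<omega> * max B1 B2"
      by (rule exists_outer_index)
    have xX: "x (k + 1) \<in> X" using outer_in_X[OF out, of "k + 1"] by simp
    have "lam / \<beta>\<^sub>1 / eps_phi \<le> growth k" using k(2) by (simp add: B1_def)
    then have "tol k \<le> eps_phi"
      using eps params growth_ge_1[of k] by (simp add: tol_def pen_def field_simps)
    then have stat: "infdist (- gradient (psi \<nu> f A (pen k) (y k)) (x (k + 1))) (normal_cone X (x (k + 1))) \<le> eps_phi"
      using outer_stationary[OF out k(1)] by simp
    have "CA / \<beta>\<^sub>1 / eps_A powr \<nu> \<le> growth k" using k(2) by (simp add: B2_def)
    then have "CA \<le> pen k * eps_A powr \<nu>"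
      using eps params by (simp add: pen_def field_simps)
    then have "pen k * norm (A (x (k + 1))) powr \<nu> \<le> pen k * eps_A powr \<nu>"
      using CA(2)[OF out k(1)] by simp
    then have "norm (A (x (k + 1))) powr \<nu> \<le> eps_A powr \<nu>" using pen_pos[of k] by simp
    then have feas: "norm (A (x (k + 1))) \<le> eps_A"
      using powr_less_mono2[OF \<nu>(1), of eps_A "norm (A (x (k + 1)))"] eps by fastforce
    have "real (\<Sum>j = 1..<k + 1. T j * N j) \<le> cost C (growth k)"
      by (rule run_cost[OF C k(1) C1(2)[OF full] C1(1) N C_def])
    also have "\<dots> \<le> cost C (\<omega> * max B1 B2)"
      by (rule cost_mono[OF C growth_ge_1 k(3)])
    \<comment> \<open>The larger of the two thresholds is one of them, so the cost there is one of
      the two complexity functions.\<close>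
    also have "\<dots> \<le> max (T\<phi> eps_phi) (TA eps_A)"
      using eps unfolding T\<phi>_def TA_def B1_def[symmetric] B2_def[symmetric]
      by (cases "B1 \<le> B2") (simp_all add: B1_def B2_def max_def)
    finally show ?thesis
      using stationary_pointI[OF xX stat feas] by (intro exI[of _ "k + 1"]) simp
  qed
  have "\<gamma> k > 0" for k
    unfolding \<gamma>_def using step_length_pos[OF less_imp_le[OF pen_pos] tol_pos] .
  moreover have "\<exists>x T. run \<delta> \<gamma> N x T"
    using run_exists[OF par] by (simp add: \<gamma>_def[abs_def])
  ultimately show ?thesis using par(1) T\<phi> TA final by blast
qed

end

theorem theorem6:
  fixes X :: "(real^'n) set"
    and f :: "real^'n \<Rightarrow> real"
    and A :: "real^'n \<Rightarrow> real^'m"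
    and D Lf LA Amax JAmax gfmax \<nu> lam \<omega> \<sigma>\<^sub>1 \<beta>\<^sub>1 :: real
    and x\<^sub>1 :: "real^'n" and y\<^sub>1 :: "real^'m"
    and s :: "nat \<Rightarrow> nat \<Rightarrow> real^'n \<Rightarrow> real^'n"
  assumes f_C1: "\<forall>x. f differentiable (at x)" "continuous_on UNIV (gradient f)"
    and A_C1: "\<forall>x. A differentiable (at x)" "continuous_on UNIV (\<lambda>x. jacobian A (at x))"
    and P: "assumption_P X f A D Lf LA Amax JAmax gfmax"
    and R: "assumption_R X A"
    and A_linear: "linear (\<lambda>x. A x - A 0)" "LA = 0"
    and \<nu>: "0 < \<nu>" "\<nu> \<le> 1"
    and params: "lam > 0" "\<omega> > 1" "\<sigma>\<^sub>1 > 0" "\<beta>\<^sub>1 > 0"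
    and start: "x\<^sub>1 \<in> X"
    and fgm_start: "\<forall>k t c. c \<in> X \<longrightarrow> s k t c \<in> X"
  shows "\<exists>(\<delta> :: nat \<Rightarrow> real) (\<gamma> :: nat \<Rightarrow> real) (N :: nat \<Rightarrow> nat).
    (\<forall>k. \<delta> k > 0 \<and> \<gamma> k > 0) \<and>
    (\<exists>x T. full_run X f A D Lf LA Amax JAmax \<nu> lam \<omega> \<sigma>\<^sub>1 \<beta>\<^sub>1 x\<^sub>1 y\<^sub>1 s \<delta> \<gamma> N x T) \<and>
    (\<exists>T\<phi> TA :: real \<Rightarrow> real.
       T\<phi> \<in> soft_O (\<lambda>\<epsilon>. \<epsilon> powr
         (- 2 - 2 * ((1 - \<nu>) / (1 + 3 * \<nu>)) * ((1 + \<nu>) / \<nu>) - 2 / (1 + 3 * \<nu>))) \<and>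
       TA \<in> soft_O (\<lambda>\<epsilon>. \<epsilon> powr
         (- 2 * \<nu> - 2 * ((1 - \<nu>) / (1 + 3 * \<nu>)) * (1 + \<nu>) - 2 * \<nu> / (1 + 3 * \<nu>))) \<and>
       (\<forall>x T. full_run X f A D Lf LA Amax JAmax \<nu> lam \<omega> \<sigma>\<^sub>1 \<beta>\<^sub>1 x\<^sub>1 y\<^sub>1 s \<delta> \<gamma> N x T \<longrightarrow>
          (\<forall>eps_phi>0. \<forall>eps_A>0. \<exists>K\<ge>1.
             stationary_point X f A eps_phi eps_A (x K) \<and>
             real (\<Sum>k = 1..<K. T k * N k) \<le> max (T\<phi> eps_phi) (TA eps_A))))"
proof -
  interpret linear_power_alm_run X f A D Lf Amax JAmax gfmax \<nu> lam \<omega> \<sigma>\<^sub>1 \<beta>\<^sub>1 x\<^sub>1 y\<^sub>1 s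
    by (intro linear_power_alm_run.intro linear_power_alm.intro linear_power_alm_run_axioms.intro)
      (use assms in auto)
  define q where "q = (1 - \<nu>) / (1 + 3 * \<nu>)"
  have fe: "fgm_exponent = q * (2 * (1 + \<nu>) / \<nu>) + 2 / (1 + 3 * \<nu>)"
    by (simp add: fgm_exponent_def gap_exponent_def q_def)
  have e1: "- 2 - 2 * q * ((1 + \<nu>) / \<nu>) - 2 / (1 + 3 * \<nu>) = - (2 + fgm_exponent)"
    by (simp add: fe)
  \<comment> \<open>Multiplication by \<open>\<nu>\<close> cancels the denominator of
    \<open>gap_exponent\<close>, which turns the exponent for stationarity into the one for
    feasibility.\<close>
  have "\<nu> * fgm_exponent = q * (2 * (1 + \<nu>)) + 2 * \<nu> / (1 + 3 * \<nu>)"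
    unfolding fe distrib_left[of \<nu>] using \<nu>(1) by (simp add: mult.commute)
  then have e2: "- 2 * \<nu> - 2 * q * (1 + \<nu>) - 2 * \<nu> / (1 + 3 * \<nu>) = - (\<nu> * (2 + fgm_exponent))"
    by (simp add: distrib_left)
  show ?thesis
    unfolding q_def[symmetric] e1 e2 \<open>LA = 0\<close> by (rule complexity)
qed

end
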